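(* Let $\mathcal R$ be a regular sequence of harmonic structures on the stretched fractal $K$, let $\eta\in(0,1]$ and $\mu_\eta=\eta\mu_I+(1-\eta)\mu_\Sigma$. Then $(\mathcal E_{\mathcal R},\mathcal D_{\mathcal R})$, where $\mathcal D_{\mathcal R}=\mathcal F_{\mathcal R}$, is a regular Dirichlet form on $L^2(K,\mu_\eta)$.
   Context: GEOMETRY. Let $F\subset\mathbb R^d$ be a connected p.c.f. (post-critically finite, in Kigami's sense) self-similar set generated by contracting similitudes $F_1,\dots,F_N$ ($N\ge2$) with pairwise distinct fixed points $q_1,\dots,q_N$, so $F=\bigcup_{i=1}^N F_i(F)$. Put $\mathcal A=\{1,\dots,N\}$, $\mathcal A^*=\bigcup_{n\ge1}\mathcal A^n$, $\mathcal A^*_0=\bigcup_{n\ge0}\mathcal A^n$ (with the empty word), $|w|$ the length of $w$, $F_w=F_{w_1}\circ\dots\circ F_{w_n}$, $F_\emptyset=\mathrm{id}$ (same notation for other families of maps). Critical set $\mathcal C=\bigcup_{i\ne j}F_i(F)\cap F_j(F)$; post-critical set $\mathcal P=\{x\in F:\exists w\in\mathcal A^*,\ F_w(x)\in\mathcal C\}$, which is finite. Assume: every $p\in\mathcal P$ is of the form $p=F_w(q_i)$ with $w\in\mathcal A^*_0$ and a fixed point $q_i\in\mathcal P$; and $q_i\notin\mathcal C$ for all $i$. For $x\in F$ let $\rho(x)=\#\{i\in\mathcal A: x\in F_i(F)\}$. For each $c\in\mathcal C$ fix words $w^{c,1},\dots,w^{c,\rho(c)}\in\mathcal A^*$ with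 pairwise distinct first letters and fixed points $q^c_1,\dots,q^c_{\rho(c)}\in\mathcal P$ with $F_{w^{c,l}}(q^c_l)=c$. For $\alpha\in(0,1)$ let $G_i(x)=\alpha(F_i(x)-q_i)+q_i$ and $e_{c,l}=\{\lambda G_{w^{c,l}}(q^c_l)+(1-\lambda)c:\lambda\in[0,1]\}$, $e^w_{c,l}=G_w(e_{c,l})$ for $w\in\mathcal A_0^*$. The stretched fractal $K$ (with $\alpha$ fixed) is the unique nonempty compact set with $K=\bigcup_{i=1}^N G_i(K)\cup\bigcup_{c\in\mathcal C}\bigcup_{l=1}^{\rho(c)}e_{c,l}$, and $\Sigma$ is the unique nonempty compact set with $\Sigma=\bigcup_{i=1}^NG_i(\Sigma)$. $K_w=G_w(K)$. Standing assumption (the copies are pulled apart): the sets $G_i(K)$ are pairwise disjoint and contain no point of $\mathcal C$; each $e_{c,l}$ is nondegenerate, meets $\bigcup_iG_i(K)$ only in the endpoint $G_{w^{c,l}}(q^c_l)$, and two different segments $e_{c,l},e_{c',l'}$ meet at most in the point $c$ (if $c=c'$). GRAPHS. For $p\in\mathcal P$ write $p=F_v(q_i)$ with $v\in\mathcal A_0^*$, $q_i\in\mathcal P$, and put $\hat p=G_v(q_i)$ (so $\hat p=p$ if $p$ is a fixed point). $V_0=\{\hat p:p\in\mathcal P\}$, $E_0=\{\{x,y\}:x,y\in V_0,x\ne y\}$. For $n\ge1$: $P_n=\bigcup_{w\in\mathcal A^n}G_w(V_0)$, $C_n=\bigcup_{k=1}^n\bigcup_{w\in\mathcal A^{k-1}}G_w(\mathcal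 C)$, $V_n=P_n\cup C_n$; $E_1^I=\{\{c,G_{w^{c,l}}(q^c_l)\}:c\in\mathcal C,1\le l\le\rho(c)\}$ (in bijection with the segments $e_{c,l}$). HARMONIC STRUCTURES. Let $r_0:E_0\to(0,\infty]$ (convention $1/\infty=0$), $\lambda\in(0,1)$, $\boldsymbol\rho=\{\rho_e\}_{e\in E_1^I}$ with $\rho_e\in(0,\infty)$. The triple $(r_0,\lambda,\boldsymbol\rho)$ is a harmonic structure if (1) any two points of $V_0$ are joined by a path of edges $e\in E_0$ with $r_0(e)<\infty$; (2) for all $g:V_0\to\mathbb R$, $\inf\{Q_1(f): f:V_1\to\mathbb R, f|_{V_0}=g\}=Q^\Sigma(g)$, where $Q^\Sigma(g)=\sum_{\{x,y\}\in E_0}\frac{(g(x)-g(y))^2}{r_0(x,y)}$ and $Q_1(f)=\frac1\lambda\sum_{i\in\mathcal A}Q^\Sigma(f\circ G_i)+\sum_{\{x,y\}\in E_1^I}\frac{(f(x)-f(y))^2}{\rho_{\{x,y\}}}$. A sequence of harmonic structures is $\mathcal R=(\lambda_i,\boldsymbol\rho^i)_{i\ge1}$ such that, for one fixed $r_0$, every $(r_0,\lambda_i,\boldsymbol\rho^i)$ is a harmonic structure; it is regular if there is $\lambda^*<1$ with $\lambda_i\le\lambda^*$ for all $i$, and $\rho^*:=\sup\{\rho:\rho\in\boldsymbol\rho^i,i\ge1\}<\infty$. FORM. Put $\delta_n=\lambda_1\cdots\lambda_n$, $\gamma_1=1$, $\gamma_k=\lambda_1\cdots\lambda_{k-1}$.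 For $\{x,y\}\in E_1^I$ let $\xi_{xy}(t)=tx+(1-t)y$ and $\mathcal D_{xy}(u)=\int_0^1\big(\tfrac{d(u\circ\xi_{xy})}{dz}\big)^2dz$; $\mathcal D_{\boldsymbol\rho}(u)=\sum_{\{x,y\}\in E_1^I}\frac1{\rho_{\{x,y\}}}\mathcal D_{xy}(u)$; $\mathcal D_{\boldsymbol\rho,k}(u)=\sum_{w\in\mathcal A^{k-1}}\mathcal D_{\boldsymbol\rho}(u\circ G_w)$. Let $\mathcal E_{\mathcal R,n}(u)=\frac1{\delta_n}\sum_{w\in\mathcal A^n}Q^\Sigma(u\circ G_w)+\sum_{k=1}^n\frac1{\gamma_k}\mathcal D_{\boldsymbol\rho^k,k}(u)$, which is non-decreasing in $n$. $H^1(e^w_{c,l})$ denotes the functions on $e^w_{c,l}$ that are in $H^1[0,1]$ after affine parametrization over $[0,1]$. $\mathcal E_{\mathcal R}(u)=\lim_n\mathcal E_{\mathcal R,n}(u)$ and $\mathcal F_{\mathcal R}=\{u\in C(K): u|_{e^w_{c,l}}\in H^1(e^w_{c,l})\ \forall c,l,w\in\mathcal A_0^*,\ \lim_n\mathcal E_{\mathcal R,n}(u)<\infty\}$; $\mathcal E_{\mathcal R}(\cdot,\cdot)$ is the bilinear form obtained by polarization. MEASURES. $\mu_\Sigma$ is the self-similar probability measure on $\Sigma\subset K$ with $\mu_\Sigma=\sum_{i=1}^N\frac1N\mu_\Sigma\circ G_i^{-1}$, so $\mu_\Sigma(K_w)=N^{-|w|}$. Fix $\beta\in(0,\frac1N)$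 and $a_{c,l}>0$ with $\sum_{c\in\mathcal C}\sum_{l=1}^{\rho(c)}a_{c,l}=1-\beta N$. $\mu_I$ is the probability measure concentrated on $\bigcup_{c,l,w}e^w_{c,l}$ with $\mu_I|_{e^w_{c,l}}=\beta^{|w|}a_{c,l}\,\lambda^1/\lambda^1(e^w_{c,l})$ for $w\in\mathcal A_0^*$, where $\lambda^1$ is one-dimensional Lebesgue (length) measure on the segment. *)

theory Defs
  imports "HOL-Analysis.Analysis"
begin

section \<open>Stretched fractals\<close>

text \<open>
  The alphabet is \<open>{1..N}\<close>; words are lists over it.  The attractors \<open>F\<close>, \<open>K\<close>, \<open>\<Sigma>\<close> and the
  choices of words \<open>w\<^sup>c\<^sup>,\<^sup>l\<close> and fixed points \<open>q\<^sup>c\<^sub>l\<close> are components of the record; the predicate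
  \<open>stretched_fractal\<close> below states what they have to satisfy.
\<close>

record 'a stretched =
  num   :: nat                        (* N *)
  sim   :: "nat \<Rightarrow> 'a \<Rightarrow> 'a"           (* F_1, ..., F_N *)
  fixp  :: "nat \<Rightarrow> 'a"                 (* q_1, ..., q_N *)
  attr  :: "'a set"                   (* F *)
  cword :: "'a \<Rightarrow> nat \<Rightarrow> nat list"     (* w^{c,l} *)
  cfix  :: "'a \<Rightarrow> nat \<Rightarrow> 'a"           (* q^c_l *)
  alpha :: real
  strK  :: "'a set"                   (* K *)
  strS  :: "'a set"                   (* Sigma *)

fun wmap :: "(nat \<Rightarrow> 'a \<Rightarrow> 'a) \<Rightarrow> nat list \<Rightarrow> 'a \<Rightarrow> 'a" where
  "wmap f [] = id"
| "wmap f (i # w) = f i \<circ> wmap f w"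

definition letters :: "'a stretched \<Rightarrow> nat set" where
  "letters S = {1..num S}"

definition words :: "'a stretched \<Rightarrow> nat list set" where
  "words S = {w. set w \<subseteq> letters S}"

definition words_n :: "'a stretched \<Rightarrow> nat \<Rightarrow> nat list set" where
  "words_n S n = {w \<in> words S. length w = n}"

definition contracting_similitude :: "('a::metric_space \<Rightarrow> 'a) \<Rightarrow> bool" where
  "contracting_similitude f \<longleftrightarrow> (\<exists>r. 0 < r \<and> r < 1 \<and> (\<forall>x y. dist (f x) (f y) = r * dist x y))"

definition crit :: "'a stretched \<Rightarrow> 'a set" where
  "crit S = (\<Union>i\<in>letters S. \<Union>j\<in>letters S - {i}. sim S i ` attr S \<inter> sim S j ` attr S)"

definition postcrit :: "'a stretched \<Rightarrow> 'a set" where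
  "postcrit S = {x \<in> attr S. \<exists>w\<in>words S. w \<noteq> [] \<and> wmap (sim S) w x \<in> crit S}"

text \<open>
  Kigami's post-critical finiteness is finiteness of the post-critical set in the shift space.
  An infinite word \<open>\<omega>\<close> is an address of \<open>x\<close> if \<open>x\<close> lies in all cells given by its prefixes.
\<close>

definition address :: "'a stretched \<Rightarrow> (nat \<Rightarrow> nat) \<Rightarrow> 'a \<Rightarrow> bool" where
  "address S \<omega> x \<longleftrightarrow>
     range \<omega> \<subseteq> letters S \<and> (\<forall>n. x \<in> wmap (sim S) (map \<omega> [0..<n]) ` attr S)"

definition pcf :: "'a stretched \<Rightarrow> bool" where
  "pcf S \<longleftrightarrow> finite {(\<lambda>k. \<omega> (n + k)) |\<omega> n. n \<ge> 1 \<and> (\<exists>x\<in>crit S. address S \<omega> x)}"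

definition ncells :: "'a stretched \<Rightarrow> 'a \<Rightarrow> nat" where
  "ncells S x = card {i \<in> letters S. x \<in> sim S i ` attr S}"

definition G :: "'a::real_vector stretched \<Rightarrow> nat \<Rightarrow> 'a \<Rightarrow> 'a" where
  "G S i x = alpha S *\<^sub>R (sim S i x - fixp S i) + fixp S i"

abbreviation Gw :: "'a::real_vector stretched \<Rightarrow> nat list \<Rightarrow> 'a \<Rightarrow> 'a" where
  "Gw S \<equiv> wmap (G S)"

text \<open>The second end point (besides \<open>c\<close>) of the segment \<open>e\<^sub>c\<^sub>,\<^sub>l\<close>.\<close>

definition endp :: "'a::real_vector stretched \<Rightarrow> 'a \<Rightarrow> nat \<Rightarrow> 'a" where
  "endp S c l = Gw S (cword S c l) (cfix S c l)"

definition seg :: "'a::real_vector stretched \<Rightarrow> 'a \<Rightarrow> nat \<Rightarrow> 'a set" where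
  "seg S c l = closed_segment c (endp S c l)"

definition stretched_fractal :: "'a::euclidean_space stretched \<Rightarrow> bool" where
  "stretched_fractal S \<longleftrightarrow>
     num S \<ge> 2 \<and>
     (\<forall>i\<in>letters S. contracting_similitude (sim S i)) \<and>
     (\<forall>i\<in>letters S. sim S i (fixp S i) = fixp S i) \<and>
     inj_on (fixp S) (letters S) \<and>
     attr S \<noteq> {} \<and> compact (attr S) \<and> attr S = (\<Union>i\<in>letters S. sim S i ` attr S) \<and>
     connected (attr S) \<and>
     pcf S \<and>
     (\<forall>p\<in>postcrit S. \<exists>w\<in>words S. \<exists>i\<in>letters S.
        fixp S i \<in> postcrit S \<and> p = wmap (sim S) w (fixp S i)) \<and>
     (\<forall>i\<in>letters S. fixp S i \<notin> crit S) \<and>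
     (\<forall>c\<in>crit S.
        (\<forall>l\<in>{1..ncells S c}.
           cword S c l \<in> words S \<and> cword S c l \<noteq> [] \<and>
           cfix S c l \<in> fixp S ` letters S \<and> cfix S c l \<in> postcrit S \<and>
           wmap (sim S) (cword S c l) (cfix S c l) = c) \<and>
        inj_on (\<lambda>l. hd (cword S c l)) {1..ncells S c}) \<and>
     0 < alpha S \<and> alpha S < 1 \<and>
     strK S \<noteq> {} \<and> compact (strK S) \<and>
     strK S = (\<Union>i\<in>letters S. G S i ` strK S) \<union> (\<Union>c\<in>crit S. \<Union>l\<in>{1..ncells S c}. seg S c l) \<and>
     strS S \<noteq> {} \<and> compact (strS S) \<and> strS S = (\<Union>i\<in>letters S. G S i ` strS S) \<and>
     (\<forall>i\<in>letters S. \<forall>j\<in>letters S. i \<noteq> j \<longrightarrow> G S i ` strK S \<inter> G S j ` strK S = {}) \<and>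
     (\<forall>i\<in>letters S. G S i ` strK S \<inter> crit S = {}) \<and>
     (\<forall>c\<in>crit S. \<forall>l\<in>{1..ncells S c}.
        endp S c l \<noteq> c \<and> seg S c l \<inter> (\<Union>i\<in>letters S. G S i ` strK S) \<subseteq> {endp S c l}) \<and>
     (\<forall>c\<in>crit S. \<forall>l\<in>{1..ncells S c}. \<forall>c'\<in>crit S. \<forall>l'\<in>{1..ncells S c'}.
        (c, l) \<noteq> (c', l') \<longrightarrow> seg S c l \<inter> seg S c' l' \<subseteq> (if c = c' then {c} else {}))"


section \<open>Harmonic structures\<close>

text \<open>
  \<open>V\<^sub>0\<close> consists of the points \<open>p_hat = G\<^sub>v(q\<^sub>i)\<close> for \<open>p = F\<^sub>v(q\<^sub>i)\<close>.  If some \<open>p\<close> has several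
  representations with different images, all of them are included; then still
  \<open>V\<^sub>0 \<subseteq> V\<^sub>1\<close>, and the end points of all segments lie in \<open>V\<^sub>1\<close>.
\<close>

definition V0 :: "'a::real_vector stretched \<Rightarrow> 'a set" where
  "V0 S = {Gw S v (fixp S i) |v i. v \<in> words S \<and> i \<in> letters S \<and>
             fixp S i \<in> postcrit S \<and> wmap (sim S) v (fixp S i) \<in> postcrit S}"

text \<open>
  A function on \<open>E\<^sub>0\<close> is a function of unordered pairs \<open>{x, y}\<close>.  The factor \<open>1/2\<close> compensates
  for summing over ordered pairs; \<open>1/\<infinity> = 0\<close> holds in \<open>ereal\<close>.
\<close>

definition Q0 :: "'a::real_vector stretched \<Rightarrow> ('a set \<Rightarrow> ereal) \<Rightarrow> ('a \<Rightarrow> real) \<Rightarrow> real" where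
  "Q0 S r0 g =
     (\<Sum>x\<in>V0 S. \<Sum>y\<in>V0 S - {x}. (g x - g y)\<^sup>2 * real_of_ereal (1 / r0 {x, y})) / 2"

text \<open>
  The edges in \<open>E\<^sub>1\<^sup>I\<close> correspond to the pairs \<open>(c, l)\<close>, and the resistances on these edges are
  indexed accordingly.
\<close>

definition Q1 :: "'a::real_vector stretched \<Rightarrow> ('a set \<Rightarrow> ereal) \<Rightarrow> real \<Rightarrow> ('a \<Rightarrow> nat \<Rightarrow> real)
    \<Rightarrow> ('a \<Rightarrow> real) \<Rightarrow> real" where
  "Q1 S r0 lam rho f =
     1 / lam * (\<Sum>i\<in>letters S. Q0 S r0 (f \<circ> G S i)) +
     (\<Sum>c\<in>crit S. \<Sum>l\<in>{1..ncells S c}. (f c - f (endp S c l))\<^sup>2 / rho c l)"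

text \<open>
  \<open>Q1\<close> evaluates \<open>f\<close> only on \<open>V\<^sub>1\<close>, the union of the sets \<open>G\<^sub>i(V\<^sub>0)\<close> and the critical set, so
  the infimum may be taken over functions on the whole space.
\<close>

definition harmonic_structure :: "'a::real_vector stretched \<Rightarrow> ('a set \<Rightarrow> ereal) \<Rightarrow> real
    \<Rightarrow> ('a \<Rightarrow> nat \<Rightarrow> real) \<Rightarrow> bool" where
  "harmonic_structure S r0 lam rho \<longleftrightarrow>
     (\<forall>x\<in>V0 S. \<forall>y\<in>V0 S. x \<noteq> y \<longrightarrow> 0 < r0 {x, y}) \<and>
     0 < lam \<and> lam < 1 \<and>
     (\<forall>c\<in>crit S. \<forall>l\<in>{1..ncells S c}. 0 < rho c l) \<and>
     (\<forall>x\<in>V0 S. \<forall>y\<in>V0 S.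
        (x, y) \<in> {(a, b). a \<in> V0 S \<and> b \<in> V0 S \<and> a \<noteq> b \<and> r0 {a, b} < \<infinity>}\<^sup>*) \<and>
     (\<forall>g. (INF f\<in>{f. \<forall>x\<in>V0 S. f x = g x}. Q1 S r0 lam rho f) = Q0 S r0 g)"

definition harmonic_sequence :: "'a::real_vector stretched \<Rightarrow> ('a set \<Rightarrow> ereal) \<Rightarrow> (nat \<Rightarrow> real)
    \<Rightarrow> (nat \<Rightarrow> 'a \<Rightarrow> nat \<Rightarrow> real) \<Rightarrow> bool" where
  "harmonic_sequence S r0 lam rho \<longleftrightarrow> (\<forall>i\<ge>1. harmonic_structure S r0 (lam i) (rho i))"

definition regular_harmonic_sequence :: "'a::real_vector stretched \<Rightarrow> ('a set \<Rightarrow> ereal)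
    \<Rightarrow> (nat \<Rightarrow> real) \<Rightarrow> (nat \<Rightarrow> 'a \<Rightarrow> nat \<Rightarrow> real) \<Rightarrow> bool" where
  "regular_harmonic_sequence S r0 lam rho \<longleftrightarrow>
     harmonic_sequence S r0 lam rho \<and>
     (\<exists>b<1. \<forall>i\<ge>1. lam i \<le> b) \<and>
     bdd_above {rho i c l |i c l. i \<ge> 1 \<and> c \<in> crit S \<and> l \<in> {1..ncells S c}}"


section \<open>The energy form\<close>

text \<open>
  \<open>H\<^sup>1[0,1]\<close> consists of the absolutely continuous functions on \<open>[0,1]\<close> (the continuous
  representatives) with a derivative in \<open>L\<^sup>2\<close>; the derivative is determined almost everywhere.
\<close>

definition H1_deriv :: "(real \<Rightarrow> real) \<Rightarrow> (real \<Rightarrow> real) \<Rightarrow> bool" where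
  "H1_deriv h g \<longleftrightarrow>
     set_borel_measurable lborel {0..1} g \<and>
     set_integrable lborel {0..1} (\<lambda>t. (g t)\<^sup>2) \<and>
     (\<forall>t\<in>{0..1}. h t = h 0 + (LBINT s:{0..t}. g s))"

definition H1 :: "(real \<Rightarrow> real) set" where
  "H1 = {h. \<exists>g. H1_deriv h g}"

definition dir_int :: "(real \<Rightarrow> real) \<Rightarrow> real" where
  "dir_int h = (LBINT t:{0..1}. ((SOME g. H1_deriv h g) t)\<^sup>2)"

definition \<xi> :: "'a::real_vector \<Rightarrow> 'a \<Rightarrow> real \<Rightarrow> 'a" where
  "\<xi> x y t = t *\<^sub>R x + (1 - t) *\<^sub>R y"

definition Drho :: "'a::real_vector stretched \<Rightarrow> ('a \<Rightarrow> nat \<Rightarrow> real) \<Rightarrow> ('a \<Rightarrow> real) \<Rightarrow> real" where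
  "Drho S rho u = (\<Sum>c\<in>crit S. \<Sum>l\<in>{1..ncells S c}. 1 / rho c l * dir_int (u \<circ> \<xi> c (endp S c l)))"

definition Drho_k :: "'a::real_vector stretched \<Rightarrow> ('a \<Rightarrow> nat \<Rightarrow> real) \<Rightarrow> nat \<Rightarrow> ('a \<Rightarrow> real) \<Rightarrow> real"
  where
  "Drho_k S rho k u = (\<Sum>w\<in>words_n S (k - 1). Drho S rho (u \<circ> Gw S w))"

definition energy_n :: "'a::real_vector stretched \<Rightarrow> ('a set \<Rightarrow> ereal) \<Rightarrow> (nat \<Rightarrow> real)
    \<Rightarrow> (nat \<Rightarrow> 'a \<Rightarrow> nat \<Rightarrow> real) \<Rightarrow> nat \<Rightarrow> ('a \<Rightarrow> real) \<Rightarrow> real" where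
  "energy_n S r0 lam rho n u =
     1 / (\<Prod>i=1..n. lam i) * (\<Sum>w\<in>words_n S n. Q0 S r0 (u \<circ> Gw S w)) +
     (\<Sum>k=1..n. 1 / (\<Prod>i\<in>{1..<k}. lam i) * Drho_k S (rho k) k u)"

text \<open>
  Functions on \<open>K\<close> are represented by functions on the whole space; only the values on \<open>K\<close>
  matter.  Since \<open>energy_n\<close> is non-decreasing in \<open>n\<close>, convergence means finiteness of the limit.
\<close>

definition energy_dom :: "'a::euclidean_space stretched \<Rightarrow> ('a set \<Rightarrow> ereal) \<Rightarrow> (nat \<Rightarrow> real)
    \<Rightarrow> (nat \<Rightarrow> 'a \<Rightarrow> nat \<Rightarrow> real) \<Rightarrow> ('a \<Rightarrow> real) set" where
  "energy_dom S r0 lam rho =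
     {u. continuous_on (strK S) u \<and>
         (\<forall>c\<in>crit S. \<forall>l\<in>{1..ncells S c}. \<forall>w\<in>words S. u \<circ> Gw S w \<circ> \<xi> c (endp S c l) \<in> H1) \<and>
         convergent (\<lambda>n. energy_n S r0 lam rho n u)}"

definition energy_q :: "'a::real_vector stretched \<Rightarrow> ('a set \<Rightarrow> ereal) \<Rightarrow> (nat \<Rightarrow> real)
    \<Rightarrow> (nat \<Rightarrow> 'a \<Rightarrow> nat \<Rightarrow> real) \<Rightarrow> ('a \<Rightarrow> real) \<Rightarrow> real" where
  "energy_q S r0 lam rho u = lim (\<lambda>n. energy_n S r0 lam rho n u)"

definition energy :: "'a::real_vector stretched \<Rightarrow> ('a set \<Rightarrow> ereal) \<Rightarrow> (nat \<Rightarrow> real)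
    \<Rightarrow> (nat \<Rightarrow> 'a \<Rightarrow> nat \<Rightarrow> real) \<Rightarrow> ('a \<Rightarrow> real) \<Rightarrow> ('a \<Rightarrow> real) \<Rightarrow> real" where
  "energy S r0 lam rho u v =
     (energy_q S r0 lam rho (\<lambda>x. u x + v x) - energy_q S r0 lam rho (\<lambda>x. u x - v x)) / 4"


section \<open>Measures\<close>

definition self_similar_measure :: "'a::euclidean_space stretched \<Rightarrow> 'a measure \<Rightarrow> bool" where
  "self_similar_measure S M \<longleftrightarrow>
     sets M = sets (restrict_space borel (strK S)) \<and>
     emeasure M (space M) = 1 \<and> emeasure M (strS S) = 1 \<and>
     (\<forall>A\<in>sets M. emeasure M A =
        (\<Sum>i\<in>letters S. ennreal (1 / real (num S)) * emeasure M (G S i -` A \<inter> strK S)))"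

text \<open>One-dimensional Lebesgue (length) measure on the segment from \<open>x\<close> to \<open>y\<close>.\<close>

definition length_measure :: "'a::euclidean_space \<Rightarrow> 'a \<Rightarrow> 'a measure" where
  "length_measure x y =
     scale_measure (ennreal (dist x y)) (distr (restrict_space lborel {0..1}) borel (\<xi> x y))"

definition segment_measure :: "'a::euclidean_space stretched \<Rightarrow> real \<Rightarrow> ('a \<Rightarrow> nat \<Rightarrow> real)
    \<Rightarrow> 'a measure \<Rightarrow> bool" where
  "segment_measure S \<beta> a M \<longleftrightarrow>
     sets M = sets (restrict_space borel (strK S)) \<and>
     emeasure M (space M) = 1 \<and>
     emeasure M (\<Union>c\<in>crit S. \<Union>l\<in>{1..ncells S c}. \<Union>w\<in>words S. Gw S w ` seg S c l) = 1 \<and>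
     (\<forall>c\<in>crit S. \<forall>l\<in>{1..ncells S c}. \<forall>w\<in>words S. \<forall>A\<in>sets borel. A \<subseteq> Gw S w ` seg S c l \<longrightarrow>
        (let L = length_measure (Gw S w c) (Gw S w (endp S c l))
         in emeasure M A =
            ennreal (\<beta> ^ length w * a c l) * (emeasure L A / emeasure L (Gw S w ` seg S c l))))"

definition mixture :: "real \<Rightarrow> 'a measure \<Rightarrow> 'a measure \<Rightarrow> 'a measure" where
  "mixture \<eta> M M' = measure_of (space M) (sets M)
     (\<lambda>A. ennreal \<eta> * emeasure M A + ennreal (1 - \<eta>) * emeasure M' A)"


section \<open>Dirichlet forms\<close>

text \<open>
  Elements of \<open>L\<^sup>2(M)\<close> are represented by functions, and \<open>D\<close> is a set of representatives of the
  classes in the domain.  Hence the form has to respect equality almost everywhere in order to be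
  well defined on classes.  Closedness is completeness of the domain with respect to \<open>form1\<close>.
\<close>

definition sq_integrable :: "'a measure \<Rightarrow> ('a \<Rightarrow> real) set" where
  "sq_integrable M = {f \<in> borel_measurable M. integrable M (\<lambda>x. (f x)\<^sup>2)}"

definition form1 :: "'a measure \<Rightarrow> (('a \<Rightarrow> real) \<Rightarrow> ('a \<Rightarrow> real) \<Rightarrow> real) \<Rightarrow> ('a \<Rightarrow> real) \<Rightarrow> real"
  where
  "form1 M E u = E u u + (LINT x|M. (u x)\<^sup>2)"

definition dirichlet_form :: "'a measure \<Rightarrow> (('a \<Rightarrow> real) \<Rightarrow> ('a \<Rightarrow> real) \<Rightarrow> real)
    \<Rightarrow> ('a \<Rightarrow> real) set \<Rightarrow> bool" where
  "dirichlet_form M E D \<longleftrightarrow>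
     D \<subseteq> sq_integrable M \<and>
     (\<lambda>x. 0) \<in> D \<and> (\<forall>u\<in>D. \<forall>v\<in>D. \<forall>a b. (\<lambda>x. a * u x + b * v x) \<in> D) \<and>
     (\<forall>f\<in>sq_integrable M. \<forall>\<epsilon>>0. \<exists>u\<in>D. (LINT x|M. (f x - u x)\<^sup>2) < \<epsilon>) \<and>
     (\<forall>u\<in>D. \<forall>v\<in>D. \<forall>w\<in>D. (AE x in M. u x = v x) \<longrightarrow> E u w = E v w) \<and>
     (\<forall>u\<in>D. \<forall>v\<in>D. \<forall>w\<in>D. \<forall>a b. E (\<lambda>x. a * u x + b * v x) w = a * E u w + b * E v w) \<and>
     (\<forall>u\<in>D. \<forall>v\<in>D. E u v = E v u) \<and>
     (\<forall>u\<in>D. 0 \<le> E u u) \<and>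
     (\<forall>s. (\<forall>n::nat. s n \<in> D) \<and>
          (\<forall>\<epsilon>>0. \<exists>n0. \<forall>m\<ge>n0. \<forall>n\<ge>n0. form1 M E (\<lambda>x. s m x - s n x) < \<epsilon>) \<longrightarrow>
          (\<exists>u\<in>D. (\<lambda>n. form1 M E (\<lambda>x. s n x - u x)) \<longlonglongrightarrow> 0)) \<and>
     \<comment> \<open>Markovian: the unit contraction operates\<close>
     (\<forall>u\<in>D. \<exists>v\<in>D. (AE x in M. v x = min (max (u x) 0) 1) \<and> E v v \<le> E u u)"

definition cont_compact_supp :: "'a::topological_space set \<Rightarrow> ('a \<Rightarrow> real) set" where
  "cont_compact_supp X =
     {f. continuous_on X f \<and> (\<exists>L. compact L \<and> L \<subseteq> X \<and> (\<forall>x\<in>X - L. f x = 0))}"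

text \<open>
  Regularity: the functions in the domain having a representative in \<open>C\<^sub>c(X)\<close> are dense in the
  domain with respect to \<open>form1\<close> and in \<open>C\<^sub>c(X)\<close> with respect to the supremum norm.
\<close>

definition regular_dirichlet_form :: "'a::topological_space set \<Rightarrow> 'a measure
    \<Rightarrow> (('a \<Rightarrow> real) \<Rightarrow> ('a \<Rightarrow> real) \<Rightarrow> real) \<Rightarrow> ('a \<Rightarrow> real) set \<Rightarrow> bool" where
  "regular_dirichlet_form X M E D \<longleftrightarrow>
     dirichlet_form M E D \<and>
     (\<forall>u\<in>D. \<forall>\<epsilon>>0. \<exists>v\<in>D. (\<exists>f\<in>cont_compact_supp X. AE x in M. v x = f x) \<and>
        form1 M E (\<lambda>x. u x - v x) < \<epsilon>) \<and>
     (\<forall>f\<in>cont_compact_supp X. \<forall>\<epsilon>>0. \<exists>g\<in>cont_compact_supp X.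
        (\<exists>v\<in>D. AE x in M. v x = g x) \<and> (\<forall>x\<in>X. \<bar>f x - g x\<bar> < \<epsilon>))"

end

theory Submission
  imports Defs "HOL-Probability.Probability_Measure"
begin

text \<open>
  A continuous function on \<open>[0,1]\<close> lies in \<open>H\<^sup>1\<close> iff its dyadic energies
  \<open>2\<^sup>k \<Sum>\<^sub>j (h((j+1)/2\<^sup>k) - h(j/2\<^sup>k))\<^sup>2\<close>, which increase with \<open>k\<close>, are bounded, and then they
  converge to the Dirichlet integral.  Hence the energy is the limit of an increasing sequence of
  finite sums \<open>\<Sum> c (u x - u y)\<^sup>2\<close> over points of \<open>K\<close>, and the Markov property, the parallelogram
  law and lower semicontinuity hold because they hold for such sums.
  Regularity of the sequence makes the oscillation of \<open>u\<close> on cells of level \<open>n\<close> at most a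
  constant times \<open>b\<^sup>n \<surd>\<E>(u)\<close> with \<open>b < 1\<close>, so the energy controls the oscillation of \<open>u\<close> on
  \<open>K\<close> and a Cauchy sequence for the form converges uniformly.  For density,
  Stone--Weierstrass applies: the domain is an algebra, and it separates points by Lipschitz
  functions that are constant on all cells of some level.
\<close>

section \<open>Square-integrable functions\<close>

text \<open>The definitions hide the structure that is needed: \<open>dir_int\<close> takes a
  derivative given by a choice operator and \<open>energy\<close> is a polarization, so neither
  bilinearity nor semicontinuity can be read off. Both come from the single sequence
  \<open>discrete_energy n n\<close>, in which cell level and dyadic level grow together. Growth in
  the cell level is the compatibility condition Q^Sigma \<le> Q_1, combined with the fact that a
  dyadic energy dominates the squared difference of the end values. Uniform constants require
  finitely many points in V_0 and in the critical set; this is extracted from finiteness of the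
  post-critical set in the shift space. Connectedness of F makes the first-level graph connected, so
  that differences inside subcells and along segments bound the oscillation over V_1 and the
  segments. Squared differences at level n are of order \<lambda>_1 ... \<lambda>_n \<E>(u), so b is
  the square root of a bound for the \<lambda>_i, and geometric sums along nested cells control all
  of K. Since \<eta> > 0, the segment part of the measure charges every nonempty open subset of K;
  hence functions in the domain that agree almost everywhere agree on K.\<close>

lemma integrable_mult_of_sq:
  fixes f g :: "'b \<Rightarrow> real"
  assumes [measurable]: "f \<in> borel_measurable M" "g \<in> borel_measurable M"
    and "integrable M (\<lambda>x. (f x)\<^sup>2)" "integrable M (\<lambda>x. (g x)\<^sup>2)"
  shows "integrable M (\<lambda>x. f x * g x)"
proof (rule Bochner_Integration.integrable_bound)
  show "integrable M (\<lambda>x. (f x)\<^sup>2 + (g x)\<^sup>2)" using assms by simp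
  have "\<bar>x * y\<bar> \<le> x\<^sup>2 + y\<^sup>2" for x y :: real
  proof -
    have "0 \<le> (\<bar>x\<bar> - \<bar>y\<bar>)\<^sup>2" by simp
    then have "2 * (\<bar>x\<bar> * \<bar>y\<bar>) \<le> x\<^sup>2 + y\<^sup>2" by (simp add: power2_diff)
    then show ?thesis by (simp add: abs_mult) (smt (verit) mult_nonneg_nonneg abs_ge_zero)
  qed
  then show "AE x in M. norm (f x * g x) \<le> norm ((f x)\<^sup>2 + (g x)\<^sup>2)" by simp
qed measurable

lemma integrable_lincomb_sq:
  fixes f g :: "'b \<Rightarrow> real"
  assumes [measurable]: "f \<in> borel_measurable M" "g \<in> borel_measurable M"
    and "integrable M (\<lambda>x. (f x)\<^sup>2)" "integrable M (\<lambda>x. (g x)\<^sup>2)"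
  shows "integrable M (\<lambda>x. (a * f x + b * g x)\<^sup>2)"
proof -
  have "(\<lambda>x. (a * f x + b * g x)\<^sup>2) = (\<lambda>x. a\<^sup>2 * (f x)\<^sup>2 + 2 * a * b * (f x * g x) + b\<^sup>2 * (g x)\<^sup>2)"
    by (auto simp: power2_eq_square algebra_simps)
  then show ?thesis using assms integrable_mult_of_sq[OF assms] by simp
qed

lemma integrable_diff_sq:
  fixes f g :: "'b \<Rightarrow> real"
  assumes "f \<in> borel_measurable M" "g \<in> borel_measurable M"
    and "integrable M (\<lambda>x. (f x)\<^sup>2)" "integrable M (\<lambda>x. (g x)\<^sup>2)"
  shows "integrable M (\<lambda>x. (f x - g x)\<^sup>2)"
  using integrable_lincomb_sq[OF assms, of 1 "-1"] by simp

lemma integral_diff_sq_triangle: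
  fixes f g h :: "'b \<Rightarrow> real"
  assumes [measurable]: "f \<in> borel_measurable M" "g \<in> borel_measurable M" "h \<in> borel_measurable M"
    and "integrable M (\<lambda>x. (f x)\<^sup>2)" "integrable M (\<lambda>x. (g x)\<^sup>2)" "integrable M (\<lambda>x. (h x)\<^sup>2)"
  shows "(LINT x|M. (f x - h x)\<^sup>2) \<le> 2 * (LINT x|M. (f x - g x)\<^sup>2) + 2 * (LINT x|M. (g x - h x)\<^sup>2)"
proof -
  have i: "integrable M (\<lambda>x. (f x - h x)\<^sup>2)" "integrable M (\<lambda>x. (f x - g x)\<^sup>2)"
    "integrable M (\<lambda>x. (g x - h x)\<^sup>2)"
    using assms by (auto intro!: integrable_diff_sq)
  have "(f x - h x)\<^sup>2 \<le> 2 * (f x - g x)\<^sup>2 + 2 * (g x - h x)\<^sup>2" for x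
    using zero_le_power2[of "(f x - g x) - (g x - h x)"] by (simp add: power2_eq_square algebra_simps)
  then have "(LINT x|M. (f x - h x)\<^sup>2) \<le> (LINT x|M. 2 * (f x - g x)\<^sup>2 + 2 * (g x - h x)\<^sup>2)"
    using i by (intro integral_mono) auto
  also have "\<dots> = 2 * (LINT x|M. (f x - g x)\<^sup>2) + 2 * (LINT x|M. (g x - h x)\<^sup>2)"
    using i by simp
  finally show ?thesis .
qed

text \<open>With m the measure of A and a the integral of f over A, expanding the integral of (m f -
  a)^2 over A gives m times the claim. Multiplying by m instead of dividing by it leaves m = 0 as a
  separate case.\<close>

lemma (in finite_measure) Cauchy_Schwarz_indicator:
  fixes f :: "'a \<Rightarrow> real"
  assumes f[measurable]: "f \<in> borel_measurable M" and sq: "integrable M (\<lambda>x. (f x)\<^sup>2)"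
    and A[measurable]: "A \<in> sets M"
  shows "(LINT x|M. indicator A x * f x)\<^sup>2 \<le> measure M A * (LINT x|M. indicator A x * (f x)\<^sup>2)"
proof -
  define m where "m = measure M A"
  define a where "a = (LINT x|M. indicator A x * f x)"
  have fi: "integrable M f" by (rule square_integrable_imp_integrable[OF f sq])
  have i1: "integrable M (\<lambda>x. indicator A x * f x)"
    using integrable_mult_indicator[OF A fi] by simp
  have i2: "integrable M (\<lambda>x. indicator A x * (f x)\<^sup>2)"
    using integrable_mult_indicator[OF A sq] by simp
  have "0 \<le> (LINT x|M. indicator A x * (m * f x - a)\<^sup>2)"
    by (intro integral_nonneg_AE) auto
  also have "(\<lambda>x. indicator A x * (m * f x - a)\<^sup>2) = (\<lambda>x. m\<^sup>2 * (indicator A x * (f x)\<^sup>2)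
      - (2 * m * a) * (indicator A x * f x) + a\<^sup>2 * indicator A x)"
    by (auto simp: power2_eq_square algebra_simps split: split_indicator)
  also have "(LINT x|M. m\<^sup>2 * (indicator A x * (f x)\<^sup>2)
      - (2 * m * a) * (indicator A x * f x) + a\<^sup>2 * indicator A x)
      = m\<^sup>2 * (LINT x|M. indicator A x * (f x)\<^sup>2) - 2 * m * a * a + a\<^sup>2 * m"
  proof -
    have ind: "integrable M (indicator A :: 'a \<Rightarrow> real)"
      using A emeasure_finite by (intro integrable_real_indicator) (auto simp: emeasure_eq_measure)
    have "(LINT x|M. m\<^sup>2 * (indicator A x * (f x)\<^sup>2)
      - (2 * m * a) * (indicator A x * f x) + a\<^sup>2 * indicator A x)
      = (LINT x|M. m\<^sup>2 * (indicator A x * (f x)\<^sup>2))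
        - (LINT x|M. (2 * m * a) * (indicator A x * f x)) + (LINT x|M. a\<^sup>2 * indicator A x)"
      using i1 i2 ind by (subst Bochner_Integration.integral_add Bochner_Integration.integral_diff; auto)+
    then show ?thesis by (simp add: a_def m_def)
  qed
  finally have *: "0 \<le> m * (m * (LINT x|M. indicator A x * (f x)\<^sup>2) - a\<^sup>2)"
    by (simp add: power2_eq_square algebra_simps)
  have "m \<ge> 0" by (simp add: m_def)
  show ?thesis
  proof (cases "m = 0")
    case True
    then have "A \<in> null_sets M" using A by (simp add: m_def emeasure_eq_measure null_setsI)
    then have "AE x in M. indicator A x * f x = 0"
      by (intro AE_I'[of A]) (auto split: split_indicator_asm)
    then have "a = 0" unfolding a_def by (rule integral_eq_zero_AE)
    then show ?thesis using True by (simp add: a_def[symmetric] m_def[symmetric])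
  next
    case False
    then show ?thesis using * \<open>m \<ge> 0\<close> by (simp add: a_def[symmetric] m_def[symmetric] zero_le_mult_iff)
  qed
qed

lemma (in prob_space) integral_sq_le:
  fixes f :: "'a \<Rightarrow> real"
  assumes f: "f \<in> borel_measurable M" and sq: "integrable M (\<lambda>x. (f x)\<^sup>2)"
  shows "(LINT x|M. f x)\<^sup>2 \<le> (LINT x|M. (f x)\<^sup>2)"
proof -
  have "(LINT x|M. indicator (space M) x * f x) = (LINT x|M. f x)"
    "(LINT x|M. indicator (space M) x * (f x)\<^sup>2) = (LINT x|M. (f x)\<^sup>2)"
    by (auto intro!: Bochner_Integration.integral_cong)
  then show ?thesis using Cauchy_Schwarz_indicator[OF f sq, of "space M"] by (simp add: prob_space)
qed

text \<open>On a probability space an L2 Cauchy sequence is L1 Cauchy, hence has an almost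
  everywhere convergent subsequence. Fatou's lemma along this subsequence bounds the L2 distance of
  each late term from the limit.\<close>

lemma (in prob_space) L2_complete:
  fixes s :: "nat \<Rightarrow> 'a \<Rightarrow> real"
  assumes s[measurable]: "\<And>n. s n \<in> borel_measurable M"
    and sq: "\<And>n. integrable M (\<lambda>x. (s n x)\<^sup>2)"
    and cauchy: "\<And>e. e > 0 \<Longrightarrow> \<exists>N. \<forall>i\<ge>N. \<forall>j\<ge>N. (LINT x|M. (s i x - s j x)\<^sup>2) < e"
  obtains g where "g \<in> borel_measurable M" "integrable M (\<lambda>x. (g x)\<^sup>2)"
    "(\<lambda>n. LINT x|M. (s n x - g x)\<^sup>2) \<longlonglongrightarrow> 0"
proof -
  have si: "integrable M (s n)" for n by (rule square_integrable_imp_integrable[OF s sq])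
  have dsq: "integrable M (\<lambda>x. (s i x - s j x)\<^sup>2)" for i j
    by (rule integrable_diff_sq[OF s s sq sq])
  have "\<exists>N. \<forall>i\<ge>N. \<forall>j\<ge>N. (LINT x|M. norm (s i x - s j x)) < e" if "e > 0" for e
  proof -
    from cauchy[of "e\<^sup>2"] that obtain N where N: "\<forall>i\<ge>N. \<forall>j\<ge>N. (LINT x|M. (s i x - s j x)\<^sup>2) < e\<^sup>2" by auto
    have "(LINT x|M. norm (s i x - s j x)) < e" if "i \<ge> N" "j \<ge> N" for i j
    proof -
      have "(LINT x|M. norm (s i x - s j x))\<^sup>2 \<le> (LINT x|M. (norm (s i x - s j x))\<^sup>2)"
        using dsq by (intro integral_sq_le) auto
      also have "\<dots> < e\<^sup>2" using N that by simp
      finally show ?thesis using \<open>e > 0\<close> by (simp add: power2_less_imp_less)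
    qed
    then show ?thesis by blast
  qed
  from cauchy_L1_AE_cauchy_subseq[OF si this] obtain r
    where r: "strict_mono r" "AE x in M. Cauchy (\<lambda>i. s (r i) x)" by blast
  \<comment> \<open>Taking \<open>lim\<close> at every point keeps \<open>g\<close> measurable; its
    values where the subsequence diverges concern a null set.\<close>
  define g where "g x = lim (\<lambda>i. s (r i) x)" for x
  have g[measurable]: "g \<in> borel_measurable M" unfolding g_def by measurable
  have conv: "AE x in M. (\<lambda>i. s (r i) x) \<longlonglongrightarrow> g x"
    using r(2) by eventually_elim (simp add: g_def Cauchy_convergent_iff convergent_LIMSEQ_iff)
  have le: "(\<integral>\<^sup>+x. ennreal ((s n x - g x)\<^sup>2) \<partial>M) \<le> ennreal e"
    if "e > 0" and N: "\<forall>i\<ge>N. \<forall>j\<ge>N. (LINT x|M. (s i x - s j x)\<^sup>2) < e" and n: "n \<ge> N" for n N e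
  proof -
    have "AE x in M. ennreal ((s n x - g x)\<^sup>2) = liminf (\<lambda>i. ennreal ((s n x - s (r i) x)\<^sup>2))"
      using conv
    proof eventually_elim
      case (elim x)
      then have "(\<lambda>i. ennreal ((s n x - s (r i) x)\<^sup>2)) \<longlonglongrightarrow> ennreal ((s n x - g x)\<^sup>2)"
        by (intro tendsto_intros)
      then show ?case using lim_imp_Liminf sequentially_bot by metis
    qed
    then have "(\<integral>\<^sup>+x. ennreal ((s n x - g x)\<^sup>2) \<partial>M) = (\<integral>\<^sup>+x. liminf (\<lambda>i. ennreal ((s n x - s (r i) x)\<^sup>2)) \<partial>M)"
      by (rule nn_integral_cong_AE)
    also have "\<dots> \<le> liminf (\<lambda>i. \<integral>\<^sup>+x. ennreal ((s n x - s (r i) x)\<^sup>2) \<partial>M)"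
      by (rule nn_integral_liminf) measurable
    also have "\<dots> \<le> liminf (\<lambda>i. ennreal e)"
    proof (rule Liminf_mono)
      have "eventually (\<lambda>i. r i \<ge> N) sequentially"
        using r(1) by (meson eventually_sequentiallyI le_trans seq_suble)
      then show "\<forall>\<^sub>F i in sequentially. (\<integral>\<^sup>+x. ennreal ((s n x - s (r i) x)\<^sup>2) \<partial>M) \<le> ennreal e"
      proof eventually_elim
        case (elim i)
        have "(LINT x|M. (s n x - s (r i) x)\<^sup>2) \<le> e" using N n elim by (simp add: less_imp_le)
        then show ?case by (subst nn_integral_eq_integral[OF dsq]) (simp_all add: ennreal_leI)
      qed
    qed
    also have "\<dots> = ennreal e" by (simp add: Liminf_const)
    finally show ?thesis .
  qed
  have di: "integrable M (\<lambda>x. (s n x - g x)\<^sup>2)" if "(\<integral>\<^sup>+x. ennreal ((s n x - g x)\<^sup>2) \<partial>M) \<le> ennreal e" for n e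
    using that by (intro integrableI_bounded) (auto intro: le_less_trans)
  from cauchy[of 1] obtain N where N: "\<forall>i\<ge>N. \<forall>j\<ge>N. (LINT x|M. (s i x - s j x)\<^sup>2) < 1" by auto
  \<comment> \<open>\<open>g\<close> is the difference of \<open>s N\<close> and
    \<open>s N - g\<close>, both of which are square integrable.\<close>
  have "integrable M (\<lambda>x. (1 * s N x + (-1) * (s N x - g x))\<^sup>2)"
    by (rule integrable_lincomb_sq) (use sq di[OF le[OF _ N, of N]] in auto)
  then have gsq: "integrable M (\<lambda>x. (g x)\<^sup>2)" by simp
  have "(\<lambda>n. LINT x|M. (s n x - g x)\<^sup>2) \<longlonglongrightarrow> 0"
  proof (rule LIMSEQ_I)
    fix e :: real assume "e > 0"
    then obtain N where N: "\<forall>i\<ge>N. \<forall>j\<ge>N. (LINT x|M. (s i x - s j x)\<^sup>2) < e / 2" using cauchy[of "e/2"] by auto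
    have "norm ((LINT x|M. (s n x - g x)\<^sup>2) - 0) < e" if "n \<ge> N" for n
    proof -
      have *: "(\<integral>\<^sup>+x. ennreal ((s n x - g x)\<^sup>2) \<partial>M) \<le> ennreal (e / 2)"
        using le[OF _ N that] \<open>e > 0\<close> by simp
      have "ennreal (LINT x|M. (s n x - g x)\<^sup>2) \<le> ennreal (e / 2)"
        using * by (subst nn_integral_eq_integral[OF di[OF *], symmetric]) auto
      then have "(LINT x|M. (s n x - g x)\<^sup>2) \<le> e / 2" using \<open>e > 0\<close> by (subst (asm) ennreal_le_iff) auto
      moreover have "0 \<le> (LINT x|M. (s n x - g x)\<^sup>2)" by simp
      ultimately show ?thesis using \<open>e > 0\<close> by simp
    qed
    then show "\<exists>no. \<forall>n\<ge>no. norm ((LINT x|M. (s n x - g x)\<^sup>2) - 0) < e" by blast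
  qed
  with g gsq show ?thesis using that by blast
qed

section \<open>Dyadic energies on the unit interval\<close>

abbreviation unit_lborel :: "real measure"
  where "unit_lborel \<equiv> restrict_space lborel {0..1}"

lemma prob_space_unit_lborel: "prob_space unit_lborel"
  by (rule prob_spaceI) (simp add: space_restrict_space emeasure_restrict_space)

interpretation unit_lborel: prob_space unit_lborel
  by (rule prob_space_unit_lborel)

lemma borel_measurable_unit_lborelI: "f \<in> borel_measurable borel \<Longrightarrow> f \<in> borel_measurable unit_lborel"
  by (simp add: measurable_restrict_space1)

text \<open>Set integrals become integrals over the probability space \<open>unit_lborel\<close>, on
  which square integrable functions are integrable.\<close>

lemma H1_deriv_iff:
  "H1_deriv h g \<longleftrightarrow> g \<in> borel_measurable unit_lborel \<and> integrable unit_lborel (\<lambda>t. (g t)\<^sup>2) \<and>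
     (\<forall>t\<in>{0..1}. h t = h 0 + (LINT s|unit_lborel. indicator {0..t} s * g s))"
proof -
  have "(LBINT s:{0..t}. g s) = (LINT s|unit_lborel. indicator {0..t} s * g s)" if "t \<in> {0..1}" for t
    using that by (subst integral_restrict_space)
      (auto simp: set_lebesgue_integral_def intro!: Bochner_Integration.integral_cong split: split_indicator)
  then show ?thesis
    unfolding H1_deriv_def set_borel_measurable_def set_integrable_def
    by (simp add: borel_measurable_restrict_space_iff integrable_restrict_space)
qed

lemma set_lebesgue_integral_unit_lborel:
  "(LBINT t:{0..1}. f t) = (LINT t|unit_lborel. f t :: real)"
  by (simp add: set_lebesgue_integral_def integral_restrict_space)

text \<open>Half-open intervals make neighbouring dyadic intervals disjoint; the closed intervals of
  \<open>H1_deriv\<close> differ from them by a single point.\<close>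

lemma integral_indicator_Icc_eq_Ico:
  fixes g :: "real \<Rightarrow> real"
  shows "(LINT s|unit_lborel. indicator {0..t} s * g s) = (LINT s|unit_lborel. indicator {0..<t} s * g s)"
proof -
  have *: "(LINT s|unit_lborel. indicator A s * g s) = (LINT s|lborel. indicator {0..1} s * (indicator A s * g s))" for A
    by (simp add: integral_restrict_space)
  show ?thesis unfolding *
    by (rule integral_discrete_difference[of "{t}"]) (auto split: split_indicator)
qed

lemma sets_unit_lborelI: "A \<in> sets borel \<Longrightarrow> A \<subseteq> {0..1} \<Longrightarrow> A \<in> sets unit_lborel"
  by (simp add: sets_restrict_space_iff)

lemma integrable_unit_indicator:
  fixes f :: "real \<Rightarrow> real"
  assumes "integrable unit_lborel f" "A \<in> sets borel"
  shows "integrable unit_lborel (\<lambda>s. indicator A s * f s)"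
proof -
  have "integrable unit_lborel (\<lambda>s. indicator (A \<inter> {0..1}) s *\<^sub>R f s)"
    using assms by (intro integrable_mult_indicator sets_unit_lborelI) auto
  then show ?thesis
    by (rule Bochner_Integration.integrable_cong[THEN iffD1, rotated -1]) (auto simp: space_restrict_space split: split_indicator)
qed

lemma Ico_unit:
  fixes s t :: real
  assumes "0 \<le> s" "s \<le> t" "t \<le> 1"
  shows "{s..<t} \<subseteq> {0..1}" "{s..<t} \<in> sets unit_lborel" "measure unit_lborel {s..<t} = t - s"
    "{s..<t} \<inter> space unit_lborel = {s..<t}"
proof -
  show *: "{s..<t} \<subseteq> {0..1}" using assms by auto
  show "{s..<t} \<in> sets unit_lborel" by (intro sets_unit_lborelI *) simp
  show "measure unit_lborel {s..<t} = t - s" using assms * by (subst measure_restrict_space) auto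
  show "{s..<t} \<inter> space unit_lborel = {s..<t}" using * by (auto simp: space_restrict_space)
qed

lemma Cauchy_Schwarz_unit_interval:
  fixes f :: "real \<Rightarrow> real"
  assumes f: "f \<in> borel_measurable unit_lborel" and sq: "integrable unit_lborel (\<lambda>x. (f x)\<^sup>2)"
    and st: "0 \<le> s" "s \<le> t" "t \<le> 1"
  shows "(LINT x|unit_lborel. indicator {s..<t} x * f x)\<^sup>2 \<le> (t - s) * (LINT x|unit_lborel. indicator {s..<t} x * (f x)\<^sup>2)"
  using unit_lborel.Cauchy_Schwarz_indicator[OF f sq Ico_unit(2)[OF st]] by (simp add: Ico_unit(3)[OF st])

lemma indicator_Ico_diff:
  "0 \<le> s \<Longrightarrow> s \<le> t \<Longrightarrow> indicator {s..<t} x = (indicator {0..<t} x - indicator {0..<s} x :: real)" for s t x :: real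
  by (auto split: split_indicator)

lemma integral_Ico_diff:
  fixes f :: "real \<Rightarrow> real"
  assumes "integrable unit_lborel f" "0 \<le> s" "s \<le> t"
  shows "(LINT x|unit_lborel. indicator {s..<t} x * f x) =
    (LINT x|unit_lborel. indicator {0..<t} x * f x) - (LINT x|unit_lborel. indicator {0..<s} x * f x)"
  unfolding indicator_Ico_diff[OF assms(2,3)] using assms(1) by (simp add: left_diff_distrib integrable_unit_indicator)

text \<open>Cauchy-Schwarz: the primitive of an L2 function is Hoelder continuous with exponent
  1/2.\<close>

lemma integral_Ico_sq_bound:
  fixes f :: "real \<Rightarrow> real"
  assumes f: "f \<in> borel_measurable unit_lborel" and sq: "integrable unit_lborel (\<lambda>x. (f x)\<^sup>2)"
    and st: "s \<in> {0..1}" "t \<in> {0..1}"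
  shows "((LINT x|unit_lborel. indicator {0..<t} x * f x) - (LINT x|unit_lborel. indicator {0..<s} x * f x))\<^sup>2
    \<le> \<bar>t - s\<bar> * (LINT x|unit_lborel. (f x)\<^sup>2)"
  using st
proof (induction s t rule: linorder_wlog)
  case (le s t)
  have i: "integrable unit_lborel f" by (rule unit_lborel.square_integrable_imp_integrable[OF f sq])
  have "(LINT x|unit_lborel. indicator {s..<t} x * (f x)\<^sup>2) \<le> (LINT x|unit_lborel. (f x)\<^sup>2)"
    by (intro integral_mono integrable_unit_indicator sq) (auto split: split_indicator)
  then have "(t - s) * (LINT x|unit_lborel. indicator {s..<t} x * (f x)\<^sup>2) \<le> (t - s) * (LINT x|unit_lborel. (f x)\<^sup>2)"
    using le by (intro mult_left_mono) auto
  then show ?case using Cauchy_Schwarz_unit_interval[OF f sq, of s t] integral_Ico_diff[OF i, of s t] le by simp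
next
  case (sym s t)
  then show ?case by (simp add: power2_commute abs_minus_commute)
qed

text \<open>This is the Dirichlet integral of the piecewise linear interpolant of \<open>h\<close>
  at the points j/2^k.\<close>

definition dyadic_energy :: "nat \<Rightarrow> (real \<Rightarrow> real) \<Rightarrow> real" where
  "dyadic_energy k h = 2 ^ k * (\<Sum>j<2 ^ k. (h (real (Suc j) / 2 ^ k) - h (real j / 2 ^ k))\<^sup>2)"

text \<open>Cauchy-Schwarz on each dyadic interval, followed by telescoping. Agreement of
  \<open>h\<close> with the primitive of \<open>g\<close> is asked for at the grid points of level
  \<open>k\<close>, so that \<open>g\<close> may also be built from slopes of a finer level.\<close>

lemma dyadic_energy_le_integral:
  assumes f: "g \<in> borel_measurable unit_lborel" and sq: "integrable unit_lborel (\<lambda>x. (g x)\<^sup>2)"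
    and h: "\<And>j. j \<le> 2 ^ k \<Longrightarrow> h (real j / 2 ^ k) = h 0 + (LINT s|unit_lborel. indicator {0..<real j / 2 ^ k} s * g s)"
  shows "dyadic_energy k h \<le> (LINT s|unit_lborel. (g s)\<^sup>2)"
proof -
  let ?I = "\<lambda>t. LINT s|unit_lborel. indicator {0..<t} s * (g s)\<^sup>2"
  have i: "integrable unit_lborel g" by (rule unit_lborel.square_integrable_imp_integrable[OF f sq])
  have "2 ^ k * (h (real (Suc j) / 2 ^ k) - h (real j / 2 ^ k))\<^sup>2
      \<le> ?I (real (Suc j) / 2 ^ k) - ?I (real j / 2 ^ k)" if j: "j < 2 ^ k" for j
  proof -
    let ?s = "real j / 2 ^ k" and ?t = "real (Suc j) / 2 ^ k"
    have j': "real (Suc j) \<le> 2 ^ k" using j by (metis Suc_leI of_nat_le_iff of_nat_numeral of_nat_power)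
    have st: "0 \<le> ?s" "?s \<le> ?t" "?t \<le> 1" using j' by (auto simp: divide_simps)
    have "h ?t - h ?s = (LINT x|unit_lborel. indicator {?s..<?t} x * g x)"
      using h[of j] h[of "Suc j"] j integral_Ico_diff[OF i st(1,2)] by simp
    then have "(h ?t - h ?s)\<^sup>2 \<le> (?t - ?s) * (LINT x|unit_lborel. indicator {?s..<?t} x * (g x)\<^sup>2)"
      using Cauchy_Schwarz_unit_interval[OF f sq st] by simp
    also have "(LINT x|unit_lborel. indicator {?s..<?t} x * (g x)\<^sup>2) = ?I ?t - ?I ?s"
      by (rule integral_Ico_diff[OF sq st(1,2)])
    also have "?t - ?s = 1 / 2 ^ k" by (simp add: field_simps)
    finally show ?thesis by (simp add: field_simps)
  qed
  then have "dyadic_energy k h \<le> (\<Sum>j<2 ^ k. ?I (real (Suc j) / 2 ^ k) - ?I (real j / 2 ^ k))"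
    unfolding dyadic_energy_def sum_distrib_left by (intro sum_mono) auto
  also have "\<dots> = ?I 1 - ?I 0"
    by (subst sum_lessThan_telescope) simp
  also have "\<dots> \<le> (LINT s|unit_lborel. (g s)\<^sup>2)"
    by (simp, intro integral_mono integrable_unit_indicator sq) (auto split: split_indicator)
  finally show ?thesis .
qed

section \<open>Slopes of dyadic interpolants\<close>

text \<open>\<open>F j\<close> is the value on the j-th interval of length 1/n. The point 1 has
  index n, one beyond the last interval, which is why bounds run over \<open>{..n}\<close>.\<close>

definition step_fun :: "nat \<Rightarrow> (nat \<Rightarrow> real) \<Rightarrow> real \<Rightarrow> real" where
  "step_fun n F t = F (nat \<lfloor>real n * t\<rfloor>)"

lemma borel_measurable_step_fun: "step_fun n F \<in> borel_measurable unit_lborel"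
proof -
  have "(\<lambda>t. F (nat \<lfloor>real n * t\<rfloor>)) \<in> borel_measurable borel" by measurable
  then show ?thesis unfolding step_fun_def by (intro borel_measurable_unit_lborelI)
qed

lemma integrable_step_fun: "integrable unit_lborel (step_fun n F)"
proof (rule unit_lborel.integrable_const_bound)
  show "AE x in unit_lborel. norm (step_fun n F x) \<le> (\<Sum>j\<le>n. \<bar>F j\<bar>)"
  proof (rule AE_I2)
    fix t assume "t \<in> space unit_lborel"
    then have "0 \<le> t" "t \<le> 1" by (auto simp: space_restrict_space)
    then have "real n * t \<le> real n" by (simp add: mult_left_le)
    then have "nat \<lfloor>real n * t\<rfloor> \<in> {..n}" by (simp add: nat_le_iff floor_le_iff)
    then show "norm (step_fun n F t) \<le> (\<Sum>j\<le>n. \<bar>F j\<bar>)"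
      unfolding step_fun_def real_norm_def by (rule member_le_sum) auto
  qed
qed (rule borel_measurable_step_fun)

lemma integral_step_fun:
  assumes "k \<le> n" "n > 0"
  shows "(LINT s|unit_lborel. indicator {0..<real k / real n} s * step_fun n F s) = (\<Sum>j<k. F j) / n"
  using assms(1)
proof (induction k)
  case (Suc k)
  let ?s = "real k / real n" and ?t = "real (Suc k) / real n"
  have st: "0 \<le> ?s" "?s \<le> ?t" "?t \<le> 1" using Suc.prems assms(2) by (auto simp: divide_simps)
  have "(LINT x|unit_lborel. indicator {?s..<?t} x * step_fun n F x) = (LINT x|unit_lborel. F k * indicator {?s..<?t} x)"
  proof (rule Bochner_Integration.integral_cong)
    fix x
    show "indicator {?s..<?t} x * step_fun n F x = F k * indicator {?s..<?t} x"
    proof (cases "x \<in> {?s..<?t}")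
      case True
      then have "real k \<le> real n * x" "real n * x < real k + 1" using assms(2) by (auto simp: field_simps)
      then have "\<lfloor>real n * x\<rfloor> = int k" by (intro floor_unique) auto
      then show ?thesis by (simp add: step_fun_def)
    qed simp
  qed simp
  also have "\<dots> = F k * measure unit_lborel ({?s..<?t} \<inter> space unit_lborel)"
    by simp
  also have "\<dots> = F k / n"
    unfolding Ico_unit(4)[OF st] Ico_unit(3)[OF st] by (simp add: add_divide_distrib)
  finally show ?case
    using integral_Ico_diff[OF integrable_step_fun st(1,2), of n F] Suc by (simp add: add_divide_distrib)
qed simp

text \<open>The derivative of the piecewise linear interpolant of level \<open>k\<close>.\<close>

definition dyadic_slope :: "nat \<Rightarrow> (real \<Rightarrow> real) \<Rightarrow> real \<Rightarrow> real" where
  "dyadic_slope k h = step_fun (2 ^ k) (\<lambda>j. 2 ^ k * (h (real (Suc j) / 2 ^ k) - h (real j / 2 ^ k)))"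

lemma borel_measurable_dyadic_slope: "dyadic_slope k h \<in> borel_measurable unit_lborel"
  unfolding dyadic_slope_def by (rule borel_measurable_step_fun)

lemma dyadic_slope_sq: "(dyadic_slope k h s)\<^sup>2 =
   step_fun (2 ^ k) (\<lambda>j. (2 ^ k * (h (real (Suc j) / 2 ^ k) - h (real j / 2 ^ k)))\<^sup>2) s"
  by (auto simp: dyadic_slope_def step_fun_def)

lemma integrable_dyadic_slope_sq: "integrable unit_lborel (\<lambda>s. (dyadic_slope k h s)\<^sup>2)"
  unfolding dyadic_slope_sq by (rule integrable_step_fun)

text \<open>A grid point of level \<open>k\<close> is also one of the finer level \<open>m\<close>,
  with index \<open>j * 2 ^ (m - k)\<close>, and the increments telescope up to it.\<close>

lemma integral_dyadic_slope:
  assumes "k \<le> m" "j \<le> 2 ^ k"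
  shows "h (real j / 2 ^ k) = h 0 + (LINT s|unit_lborel. indicator {0..<real j / 2 ^ k} s * dyadic_slope m h s)"
proof -
  let ?i = "j * 2 ^ (m - k)"
  have "(2::nat) ^ m = 2 ^ k * 2 ^ (m - k)" using assms(1) by (simp add: power_add[symmetric])
  then have i: "?i \<le> 2 ^ m" using assms(2) by simp
  have "(2::real) ^ m = 2 ^ k * 2 ^ (m - k)" using assms(1) by (simp add: power_add[symmetric])
  then have eq: "real j / 2 ^ k = real ?i / 2 ^ m" by (simp add: field_simps)
  have "(LINT s|unit_lborel. indicator {0..<real ?i / 2 ^ m} s * dyadic_slope m h s)
      = (\<Sum>j<?i. 2 ^ m * (h (real (Suc j) / 2 ^ m) - h (real j / 2 ^ m))) / 2 ^ m"
    using integral_step_fun[OF i, of "\<lambda>j. 2 ^ m * (h (real (Suc j) / 2 ^ m) - h (real j / 2 ^ m))"]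
    unfolding dyadic_slope_def by simp
  also have "\<dots> = (\<Sum>j<?i. h (real (Suc j) / 2 ^ m) - h (real j / 2 ^ m))"
    by (simp add: sum_distrib_left[symmetric])
  also have "\<dots> = h (real ?i / 2 ^ m) - h 0"
    by (subst sum_lessThan_telescope) simp
  finally show ?thesis unfolding eq by simp
qed

lemma integral_dyadic_slope_sq:
  "(LINT s|unit_lborel. (dyadic_slope k h s)\<^sup>2) = dyadic_energy k h"
proof -
  have "(LINT s|unit_lborel. (dyadic_slope k h s)\<^sup>2) = (LINT s|unit_lborel. indicator {0..1} s * (dyadic_slope k h s)\<^sup>2)"
    by (intro Bochner_Integration.integral_cong) (auto simp: space_restrict_space)
  also have "\<dots> = (LINT s|unit_lborel. indicator {0..<1} s * (dyadic_slope k h s)\<^sup>2)"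
    by (rule integral_indicator_Icc_eq_Ico)
  also have "\<dots> = (\<Sum>j<2 ^ k. (2 ^ k * (h (real (Suc j) / 2 ^ k) - h (real j / 2 ^ k)))\<^sup>2) / 2 ^ k"
    using integral_step_fun[of "2 ^ k" "2 ^ k"] unfolding dyadic_slope_sq by simp
  also have "\<dots> = dyadic_energy k h"
    unfolding dyadic_energy_def sum_divide_distrib sum_distrib_left
    by (intro sum.cong) (auto simp: power2_eq_square)
  finally show ?thesis .
qed

text \<open>The slope of level \<open>m\<close> has a primitive that agrees with \<open>h\<close> at
  the points of level \<open>k\<close>, and the integral of its square is the energy of level
  \<open>m\<close>.\<close>

lemma dyadic_energy_mono:
  assumes "k \<le> m" shows "dyadic_energy k h \<le> dyadic_energy m h"
  unfolding integral_dyadic_slope_sq[of m, symmetric]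
  by (intro dyadic_energy_le_integral borel_measurable_dyadic_slope integrable_dyadic_slope_sq
      integral_dyadic_slope assms)

text \<open>
  The primitive of the average of the two slopes still agrees with \<open>h\<close> at the points of level \<open>k\<close>,
  so its energy is at least that of level \<open>k\<close>; the parallelogram law then bounds the distance.
\<close>

lemma dyadic_slope_dist:
  assumes "k \<le> m"
  shows "(LINT s|unit_lborel. (dyadic_slope m h s - dyadic_slope k h s)\<^sup>2)
    \<le> 2 * (dyadic_energy m h - dyadic_energy k h)"
proof -
  let ?m = "dyadic_slope m h" and ?k = "dyadic_slope k h"
  note meas = borel_measurable_dyadic_slope integrable_dyadic_slope_sq
  let ?a = "\<lambda>s. 1/2 * ?m s + 1/2 * ?k s"
  have asq: "integrable unit_lborel (\<lambda>s. (?a s)\<^sup>2)"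
    by (intro integrable_lincomb_sq meas)
  have i: "integrable unit_lborel (\<lambda>s. indicator {0..<t} s * dyadic_slope l h s)" for t l
    by (intro integrable_unit_indicator) (auto simp: dyadic_slope_def integrable_step_fun)
  have "dyadic_energy k h \<le> (LINT s|unit_lborel. (?a s)\<^sup>2)"
  proof (intro dyadic_energy_le_integral asq)
    show "?a \<in> borel_measurable unit_lborel"
      by (intro borel_measurable_add borel_measurable_times borel_measurable_const meas)
    fix j :: nat assume j: "j \<le> 2 ^ k"
    have "(LINT s|unit_lborel. indicator {0..<real j / 2 ^ k} s * ?a s)
      = (LINT s|unit_lborel. 1/2 * (indicator {0..<real j / 2 ^ k} s * ?m s) + 1/2 * (indicator {0..<real j / 2 ^ k} s * ?k s))"
      by (simp add: algebra_simps)
    also have "\<dots> = 1/2 * (LINT s|unit_lborel. indicator {0..<real j / 2 ^ k} s * ?m s)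
        + 1/2 * (LINT s|unit_lborel. indicator {0..<real j / 2 ^ k} s * ?k s)"
      using i by simp
    finally show "h (real j / 2 ^ k) = h 0 + (LINT s|unit_lborel. indicator {0..<real j / 2 ^ k} s * ?a s)"
      using integral_dyadic_slope[OF assms j, of h] integral_dyadic_slope[OF order_refl j, of h] by simp
  qed
  moreover have "(LINT s|unit_lborel. (?m s - ?k s)\<^sup>2)
     = (LINT s|unit_lborel. 2 * (?m s)\<^sup>2 + 2 * (?k s)\<^sup>2 - 4 * (?a s)\<^sup>2)"
    by (intro Bochner_Integration.integral_cong) (auto simp: power2_eq_square algebra_simps)
  moreover have "\<dots> = 2 * dyadic_energy m h + 2 * dyadic_energy k h - 4 * (LINT s|unit_lborel. (?a s)\<^sup>2)"
    using asq integrable_dyadic_slope_sq[of m h] integrable_dyadic_slope_sq[of k h]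
    by (subst Bochner_Integration.integral_diff Bochner_Integration.integral_add;
        auto simp: integral_dyadic_slope_sq)+
  ultimately show ?thesis by simp
qed

text \<open>Young's inequality g^2 \<le> (1 + e) f^2 + (1 + 1/e) (f - g)^2 replaces the triangle
  inequality of the norm: first n tends to infinity, then e to 0.\<close>

lemma L2_norm_limit_le:
  fixes f :: "nat \<Rightarrow> 'b \<Rightarrow> real"
  assumes [measurable]: "\<And>n. f n \<in> borel_measurable M" "g \<in> borel_measurable M"
    and sq: "\<And>n. integrable M (\<lambda>x. (f n x)\<^sup>2)" "integrable M (\<lambda>x. (g x)\<^sup>2)"
    and lim: "(\<lambda>n. LINT x|M. (f n x - g x)\<^sup>2) \<longlonglongrightarrow> 0"
    and C: "\<And>n. (LINT x|M. (f n x)\<^sup>2) \<le> C"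
  shows "(LINT x|M. (g x)\<^sup>2) \<le> C"
proof -
  have e: "(LINT x|M. (g x)\<^sup>2) \<le> (1 + e) * C" if "e > 0" for e
  proof (rule LIMSEQ_le_const)
    have "(g x)\<^sup>2 \<le> (1 + e) * (f n x)\<^sup>2 + (1 + 1 / e) * (f n x - g x)\<^sup>2" for n x
    proof -
      have "0 \<le> (e * f n x + (f n x - g x))\<^sup>2 / e" using that by simp
      also have "\<dots> = (1 + e) * (f n x)\<^sup>2 + (1 + 1 / e) * (f n x - g x)\<^sup>2 - (g x)\<^sup>2"
        using that by (simp add: field_simps power2_eq_square)
      finally show ?thesis by simp
    qed
    then have "(LINT x|M. (g x)\<^sup>2) \<le> (LINT x|M. (1 + e) * (f n x)\<^sup>2 + (1 + 1 / e) * (f n x - g x)\<^sup>2)" for n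
      using sq integrable_diff_sq[OF assms(1,2) sq(1) sq(2)] by (intro integral_mono) auto
    also have "\<dots> n = (1 + e) * (LINT x|M. (f n x)\<^sup>2) + (1 + 1 / e) * (LINT x|M. (f n x - g x)\<^sup>2)" for n
      using sq integrable_diff_sq[OF assms(1,2) sq(1) sq(2)] by simp
    also have "\<dots> n \<le> (1 + e) * C + (1 + 1 / e) * (LINT x|M. (f n x - g x)\<^sup>2)" for n
      using C that by (intro add_right_mono mult_left_mono) auto
    finally show "\<exists>N. \<forall>n\<ge>N. (LINT x|M. (g x)\<^sup>2) \<le> (1 + e) * C + (1 + 1 / e) * (LINT x|M. (f n x - g x)\<^sup>2)" by blast
    have "(\<lambda>n. (1 + e) * C + (1 + 1 / e) * (LINT x|M. (f n x - g x)\<^sup>2)) \<longlonglongrightarrow> (1 + e) * C + (1 + 1 / e) * 0"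
      by (intro tendsto_intros lim)
    then show "(\<lambda>n. (1 + e) * C + (1 + 1 / e) * (LINT x|M. (f n x - g x)\<^sup>2)) \<longlonglongrightarrow> (1 + e) * C" by simp
  qed
  show ?thesis
  proof (rule tendsto_lowerbound)
    have "((\<lambda>e. (1 + e) * C) \<longlongrightarrow> (1 + 0) * C) (at_right 0)" by (intro tendsto_intros)
    then show "((\<lambda>e. (1 + e) * C) \<longlongrightarrow> C) (at_right 0)" by simp
    show "\<forall>\<^sub>F e in at_right 0. (LINT x|M. (g x)\<^sup>2) \<le> (1 + e) * C"
      using e by (auto simp: eventually_at_right_field intro: exI[of _ 1])
  qed simp
qed

lemma dyadic_approx:
  fixes t :: real
  assumes "t \<in> {0..1}"
  shows "nat \<lfloor>2 ^ k * t\<rfloor> \<le> 2 ^ k" "\<bar>real (nat \<lfloor>2 ^ k * t\<rfloor>) / 2 ^ k - t\<bar> \<le> 1 / 2 ^ k"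
proof -
  have "2 ^ k * t \<le> 2 ^ k * 1" using assms by (intro mult_left_mono) auto
  then have "\<lfloor>2 ^ k * t\<rfloor> \<le> \<lfloor>(2::real) ^ k\<rfloor>" by (intro floor_mono) simp
  also have "\<lfloor>(2::real) ^ k\<rfloor> = int (2 ^ k)"
    by (metis floor_of_nat of_nat_numeral of_nat_power)
  finally show "nat \<lfloor>2 ^ k * t\<rfloor> \<le> 2 ^ k" by simp
  have "0 \<le> 2 ^ k * t" using assms by simp
  then have "real (nat \<lfloor>2 ^ k * t\<rfloor>) \<le> 2 ^ k * t" "2 ^ k * t - 1 \<le> real (nat \<lfloor>2 ^ k * t\<rfloor>)"
    by linarith+
  then have "\<bar>real (nat \<lfloor>2 ^ k * t\<rfloor>) - 2 ^ k * t\<bar> \<le> 1" unfolding abs_le_iff by linarith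
  then have "\<bar>real (nat \<lfloor>2 ^ k * t\<rfloor>) - 2 ^ k * t\<bar> / 2 ^ k \<le> 1 / 2 ^ k"
    by (intro divide_right_mono) auto
  moreover have "real (nat \<lfloor>2 ^ k * t\<rfloor>) / 2 ^ k - t = (real (nat \<lfloor>2 ^ k * t\<rfloor>) - 2 ^ k * t) / 2 ^ k"
    by (simp add: diff_divide_distrib)
  ultimately show "\<bar>real (nat \<lfloor>2 ^ k * t\<rfloor>) / 2 ^ k - t\<bar> \<le> 1 / 2 ^ k" by simp
qed

lemma dyadic_approx_tendsto:
  assumes "t \<in> {0..1}"
  shows "(\<lambda>k. real (nat \<lfloor>2 ^ k * t\<rfloor>) / 2 ^ k) \<longlonglongrightarrow> t"
proof (rule LIM_zero_cancel, rule Lim_null_comparison)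
  show "\<forall>\<^sub>F k in sequentially. norm (real (nat \<lfloor>2 ^ k * t\<rfloor>) / 2 ^ k - t) \<le> (1 / 2) ^ k"
    using dyadic_approx(2)[OF assms] by (simp add: power_one_over)
  show "(\<lambda>k. (1 / 2 :: real) ^ k) \<longlonglongrightarrow> 0" by (intro LIMSEQ_power_zero) simp
qed

text \<open>Bounded increasing energies converge, so by \<open>dyadic_slope_dist\<close> the slopes
  are Cauchy in L2. Their limit has the right primitive at dyadic points, hence everywhere, as
  \<open>h\<close> and the primitive are both continuous.\<close>

theorem H1_deriv_of_dyadic_energy_bounded:
  assumes cont: "continuous_on {0..1} h" and C: "\<And>k. dyadic_energy k h \<le> C"
  obtains g where "H1_deriv h g" "(LINT s|unit_lborel. (g s)\<^sup>2) \<le> C"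
proof -
  let ?s = "\<lambda>k. dyadic_slope k h"
  note meas = borel_measurable_dyadic_slope integrable_dyadic_slope_sq
  have "mono (\<lambda>k. dyadic_energy k h)" by (simp add: monoI dyadic_energy_mono)
  then obtain L where L: "(\<lambda>k. dyadic_energy k h) \<longlonglongrightarrow> L" using C incseq_convergent by blast
  have "\<exists>N. \<forall>i\<ge>N. \<forall>j\<ge>N. (LINT x|unit_lborel. (?s i x - ?s j x)\<^sup>2) < e" if "e > 0" for e
  proof -
    from L that have "\<exists>N. \<forall>m\<ge>N. \<forall>n\<ge>N. dist (dyadic_energy m h) (dyadic_energy n h) < e / 2"
      using metric_CauchyD[OF LIMSEQ_imp_Cauchy[OF L], of "e / 2"] by simp
    then obtain N where N: "\<And>m n. m\<ge>N \<Longrightarrow> n\<ge>N \<Longrightarrow> dist (dyadic_energy m h) (dyadic_energy n h) < e / 2" by blast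
    have "(LINT x|unit_lborel. (?s i x - ?s j x)\<^sup>2) < e" if "i \<ge> N" "j \<ge> N" for i j
      using that
    proof (induction i j rule: linorder_wlog)
      case (le i j)
      then have "\<bar>dyadic_energy j h - dyadic_energy i h\<bar> < e / 2" using N[of j i] by (simp add: dist_real_def)
      then show ?case using dyadic_slope_dist[of i j h] le power2_commute[of "?s i _" "?s j _"]
        unfolding power2_commute[of "?s j _" "?s i _"] by argo
    next
      case (sym i j) then show ?case by (subst power2_commute) simp
    qed
    then show ?thesis by blast
  qed
  from unit_lborel.L2_complete[OF meas this] obtain g
    where g: "g \<in> borel_measurable unit_lborel" "integrable unit_lborel (\<lambda>x. (g x)\<^sup>2)"
      and lim: "(\<lambda>n. LINT x|unit_lborel. (?s n x - g x)\<^sup>2) \<longlonglongrightarrow> 0" by blast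
  have "(LINT s|unit_lborel. (g s)\<^sup>2) \<le> C"
    by (rule L2_norm_limit_le[OF meas(1) g(1) meas(2) g(2) lim]) (simp add: integral_dyadic_slope_sq C)
  define I where "I t = (LINT s|unit_lborel. indicator {0..<t} s * g s)" for t
  have intg: "integrable unit_lborel g" "integrable unit_lborel (?s n)" for n
    by (rule unit_lborel.square_integrable_imp_integrable[OF g])
      (rule unit_lborel.square_integrable_imp_integrable[OF meas])
  have I_lim: "(\<lambda>n. LINT s|unit_lborel. indicator {0..<t} s * ?s n s) \<longlonglongrightarrow> I t" if "t \<in> {0..1}" for t
  proof (rule LIM_zero_cancel, rule Lim_null_comparison)
    have "\<bar>(LINT s|unit_lborel. indicator {0..<t} s * ?s n s) - I t\<bar> \<le> sqrt (LINT x|unit_lborel. (?s n x - g x)\<^sup>2)" for n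
    proof -
      have d: "(\<lambda>x. ?s n x - g x) \<in> borel_measurable unit_lborel" by (intro borel_measurable_diff meas g)
      have dsq: "integrable unit_lborel (\<lambda>x. (?s n x - g x)\<^sup>2)" by (intro integrable_diff_sq meas g)
      have "(LINT s|unit_lborel. indicator {0..<t} s * ?s n s) - I t
        = (LINT s|unit_lborel. indicator {0..<t} s * (?s n s - g s))"
        unfolding I_def using intg by (simp add: right_diff_distrib integrable_unit_indicator)
      also have "\<dots>\<^sup>2 \<le> \<bar>t - 0\<bar> * (LINT x|unit_lborel. (?s n x - g x)\<^sup>2)"
        using integral_Ico_sq_bound[OF d dsq, of 0 t] that by simp
      also have "\<dots> \<le> 1 * (LINT x|unit_lborel. (?s n x - g x)\<^sup>2)"
        using that by (intro mult_right_mono) auto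
      finally show ?thesis by (simp add: real_le_rsqrt)
    qed
    then show "\<forall>\<^sub>F n in sequentially. norm ((LINT s|unit_lborel. indicator {0..<t} s * ?s n s) - I t)
        \<le> sqrt (LINT x|unit_lborel. (?s n x - g x)\<^sup>2)" by simp
    show "(\<lambda>n. sqrt (LINT x|unit_lborel. (?s n x - g x)\<^sup>2)) \<longlonglongrightarrow> 0"
      using tendsto_real_sqrt[OF lim] by simp
  qed
  \<comment> \<open>All slopes of level n \<ge> k reproduce the value of \<open>h\<close> at this
    point exactly, so the convergent sequence is eventually constant.\<close>
  have dyadic: "h (real j / 2 ^ k) = h 0 + I (real j / 2 ^ k)" if j: "j \<le> 2 ^ k" for j k
  proof -
    have "real j \<le> 2 ^ k" using j by (metis of_nat_le_iff of_nat_numeral of_nat_power)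
    then have "real j / 2 ^ k \<in> {0..1}" by (auto simp: divide_simps)
    from I_lim[OF this] have "(\<lambda>n. h 0 + (LINT s|unit_lborel. indicator {0..<real j / 2 ^ k} s * ?s n s)) \<longlonglongrightarrow> h 0 + I (real j / 2 ^ k)"
      by (intro tendsto_intros)
    moreover have "\<forall>\<^sub>F n in sequentially. h 0 + (LINT s|unit_lborel. indicator {0..<real j / 2 ^ k} s * ?s n s) = h (real j / 2 ^ k)"
      using eventually_ge_at_top[of k] by eventually_elim (simp add: integral_dyadic_slope[OF _ j])
    ultimately have "(\<lambda>n. h (real j / 2 ^ k)) \<longlonglongrightarrow> h 0 + I (real j / 2 ^ k)"
      by (rule Lim_transform_eventually)
    then show ?thesis by (simp add: LIMSEQ_const_iff)
  qed
  have "h t = h 0 + I t" if t: "t \<in> {0..1}" for t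
  proof -
    let ?t = "\<lambda>k. real (nat \<lfloor>2 ^ k * t\<rfloor>) / 2 ^ k"
    note tk = dyadic_approx_tendsto[OF t]
    have range: "?t k \<in> {0..1}" for k
    proof -
      have "real (nat \<lfloor>2 ^ k * t\<rfloor>) \<le> 2 ^ k" using dyadic_approx(1)[OF t, of k] by (metis of_nat_le_iff of_nat_numeral of_nat_power)
      then show ?thesis by (auto simp: divide_simps)
    qed
    have "(\<lambda>k. h (?t k)) \<longlonglongrightarrow> h t"
      by (rule continuous_on_tendsto_compose[OF cont tk t]) (use range in auto)
    moreover have "(\<lambda>k. h 0 + I (?t k)) \<longlonglongrightarrow> h 0 + I t"
    proof (intro tendsto_intros LIM_zero_cancel[of "\<lambda>k. I (?t k)"], rule Lim_null_comparison)
      show "\<forall>\<^sub>F k in sequentially. norm (I (?t k) - I t) \<le> sqrt (\<bar>?t k - t\<bar> * (LINT x|unit_lborel. (g x)\<^sup>2))"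
        using integral_Ico_sq_bound[OF g t range] t unfolding I_def
        by (intro always_eventually allI) (auto simp del: of_nat_nat intro!: real_le_rsqrt)
      have "(\<lambda>k. sqrt (\<bar>?t k - t\<bar> * (LINT x|unit_lborel. (g x)\<^sup>2))) \<longlonglongrightarrow> sqrt (\<bar>t - t\<bar> * (LINT x|unit_lborel. (g x)\<^sup>2))"
        by (intro tendsto_intros tk)
      then show "(\<lambda>k. sqrt (\<bar>?t k - t\<bar> * (LINT x|unit_lborel. (g x)\<^sup>2))) \<longlonglongrightarrow> 0" by simp
    qed
    moreover have "(\<lambda>k. h 0 + I (?t k)) = (\<lambda>k. h (?t k))"
      using dyadic[OF dyadic_approx(1)[OF t]] by simp
    ultimately show ?thesis by (metis LIMSEQ_unique)
  qed
  then have "H1_deriv h g"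
    using g unfolding H1_deriv_iff integral_indicator_Icc_eq_Ico I_def by blast
  then show ?thesis using \<open>(LINT s|unit_lborel. (g s)\<^sup>2) \<le> C\<close> that by blast
qed

lemma H1_derivD:
  assumes "H1_deriv h g"
  shows "g \<in> borel_measurable unit_lborel" "integrable unit_lborel (\<lambda>t. (g t)\<^sup>2)"
    "t \<in> {0..1} \<Longrightarrow> h t = h 0 + (LINT s|unit_lborel. indicator {0..<t} s * g s)"
  using assms unfolding H1_deriv_iff integral_indicator_Icc_eq_Ico by blast+

lemma integrable_of_H1_deriv: "H1_deriv h g \<Longrightarrow> integrable unit_lborel g"
  unfolding H1_deriv_iff by (auto intro: unit_lborel.square_integrable_imp_integrable)

section \<open>The Dirichlet integral as limit of dyadic energies\<close>

text \<open>The difference of two derivatives has integral 0 over every initial interval. A Dynkin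
  system argument from half-lines extends this to all Borel sets, so the difference vanishes almost
  everywhere. This makes \<open>dir_int\<close> independent of the chosen derivative.\<close>

lemma H1_deriv_unique:
  assumes "H1_deriv h g" "H1_deriv h g'"
  shows "AE s in unit_lborel. g s = g' s"
proof -
  define f where "f s = g s - g' s" for s
  have i: "integrable unit_lborel g" "integrable unit_lborel g'" using assms integrable_of_H1_deriv by auto
  have f: "integrable unit_lborel f" unfolding f_def using i by simp
  have f0: "(LINT s|unit_lborel. indicator {0..t} s * f s) = 0" if "t \<in> {0..1}" for t
  proof -
    have "(LINT s|unit_lborel. indicator {0..t} s * g s) = (LINT s|unit_lborel. indicator {0..t} s * g' s)"
      using assms that unfolding H1_deriv_iff by (metis add_left_cancel)
    then show ?thesis unfolding f_def using i by (simp add: right_diff_distrib integrable_unit_indicator)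
  qed
  have si: "set_integrable unit_lborel A f" if "A \<in> sets borel" for A
    unfolding set_integrable_def using integrable_unit_indicator[OF f that] by simp
  have "(LINT s:A|unit_lborel. f s) = 0" if "A \<in> sets borel" for A
  proof -
    have sb: "sets borel = sigma_sets UNIV (range (atMost :: real \<Rightarrow> real set))"
      unfolding borel_eq_atMost by (rule sets_measure_of) simp
    have Int: "Int_stable (range (atMost :: real \<Rightarrow> _))"
    proof -
      have "{..a} \<inter> {..b} = {..min a b}" for a b :: real by auto
      then show ?thesis by (auto simp: Int_stable_def)
    qed
    have all: "(LINT s|unit_lborel. f s) = 0"
    proof -
      have "(LINT s|unit_lborel. f s) = (LINT s|unit_lborel. indicator {0..1} s * f s)"
        by (intro Bochner_Integration.integral_cong) (auto simp: space_restrict_space)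
      then show ?thesis using f0[of 1] by simp
    qed
    have sub: "range (atMost :: real \<Rightarrow> _) \<subseteq> Pow UNIV" by simp
    from Int sub that[unfolded sb] show ?thesis
    proof (induction rule: sigma_sets_induct_disjoint)
      case (basic A)
      then obtain t where A: "A = {..t}" by auto
      have "(LINT s|unit_lborel. indicator A s * f s) = 0"
      proof (cases "t < 0")
        case True
        then have "(LINT s|unit_lborel. indicator A s * f s) = (LINT s|unit_lborel. 0)"
          unfolding A by (intro Bochner_Integration.integral_cong) (auto simp: space_restrict_space split: split_indicator)
        then show ?thesis by simp
      next
        case False
        then have "(LINT s|unit_lborel. indicator A s * f s) = (LINT s|unit_lborel. indicator {0..min t 1} s * f s)"
          unfolding A by (intro Bochner_Integration.integral_cong) (auto simp: space_restrict_space split: split_indicator)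
        then show ?thesis using f0[of "min t 1"] False by simp
      qed
      then show ?case by (simp add: set_lebesgue_integral_def)
    next
      case empty
      then show ?case by (simp add: set_lebesgue_integral_def)
    next
      case (compl A)
      then have A: "A \<in> sets borel" by (simp add: sb)
      have "(LINT s|unit_lborel. indicator (UNIV - A) s * f s) = (LINT s|unit_lborel. f s - indicator A s * f s)"
        by (intro Bochner_Integration.integral_cong) (auto split: split_indicator)
      also have "\<dots> = 0"
        using f integrable_unit_indicator[OF f A] all compl.IH by (simp add: set_lebesgue_integral_def)
      finally show ?case by (simp add: set_lebesgue_integral_def)
    next
      case (union A)
      then have A: "A i \<in> sets borel" for i using union by (auto simp: sb)
      have "(LINT s:(\<Union>i. A i)|unit_lborel. f s) = (\<Sum>i. LINT s:A i|unit_lborel. f s)"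
      proof -
        have *: "(LINT s:B|unit_lborel. f s) = (LINT s:B \<inter> {0..1}|unit_lborel. f s)" for B
          unfolding set_lebesgue_integral_def
          by (intro Bochner_Integration.integral_cong) (auto simp: space_restrict_space split: split_indicator)
        have "(LINT s:(\<Union>i. A i \<inter> {0..1})|unit_lborel. f s) = (\<Sum>i. LINT s:A i \<inter> {0..1}|unit_lborel. f s)"
        proof (rule lebesgue_integral_countable_add)
          show "A i \<inter> {0..1} \<in> sets unit_lborel" for i using A by (intro sets_unit_lborelI) auto
          show "i \<noteq> j \<Longrightarrow> A i \<inter> {0..1} \<inter> (A j \<inter> {0..1}) = {}" for i j
            using union.hyps(1) unfolding disjoint_family_on_def by blast
          show "set_integrable unit_lborel (\<Union>i. A i \<inter> {0..1}) f" using A by (intro si) auto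
        qed
        moreover have u: "(\<Union>i. A i) \<inter> {0..1} = (\<Union>i. A i \<inter> {0..1})" by auto
        moreover have "(\<Sum>i. LINT s:A i \<inter> {0..1}|unit_lborel. f s) = (\<Sum>i. LINT s:A i|unit_lborel. f s)"
          by (intro suminf_cong *[symmetric])
        ultimately show ?thesis using *[of "\<Union>i. A i", unfolded u] by metis
      qed
      then show ?case using union.IH by simp
    qed
  qed
  then have "AE s in unit_lborel. f s = 0"
    using f by (intro unit_lborel.density_zero) (auto simp: sets_restrict_space_iff)
  then show ?thesis by (simp add: f_def)
qed

lemma dir_int_eq:
  assumes "H1_deriv h g" shows "dir_int h = (LINT s|unit_lborel. (g s)\<^sup>2)"
proof -
  define g' where "g' = (SOME g. H1_deriv h g)"
  have g': "H1_deriv h g'" unfolding g'_def by (rule someI[of "H1_deriv h", OF assms])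
  have "dir_int h = (LINT s|unit_lborel. (g' s)\<^sup>2)"
    unfolding dir_int_def g'_def[symmetric] set_lebesgue_integral_unit_lborel ..
  also have "\<dots> = (LINT s|unit_lborel. (g s)\<^sup>2)"
  proof (rule integral_cong_AE)
    show "AE x in unit_lborel. (g' x)\<^sup>2 = (g x)\<^sup>2"
      using H1_deriv_unique[OF g' assms] by eventually_elim simp
  qed (use H1_derivD(1)[OF assms] H1_derivD(1)[OF g'] in measurable)
  finally show ?thesis .
qed

lemma H1_diff_sq_le:
  assumes "h \<in> H1" "s \<in> {0..1}" "t \<in> {0..1}"
  shows "(h t - h s)\<^sup>2 \<le> dir_int h"
proof -
  obtain g where g: "H1_deriv h g" using assms unfolding H1_def by blast
  have "(h t - h s)\<^sup>2 \<le> \<bar>t - s\<bar> * dir_int h"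
    using integral_Ico_sq_bound[OF H1_derivD(1,2)[OF g] assms(2,3)]
    unfolding dir_int_eq[OF g] H1_derivD(3)[OF g assms(2)] H1_derivD(3)[OF g assms(3)] by simp
  also have "\<dots> \<le> 1 * dir_int h"
    using assms(2,3) by (intro mult_right_mono) (auto simp: dir_int_eq[OF g])
  finally show ?thesis by simp
qed

lemma dyadic_energy_le_dir_int:
  assumes "h \<in> H1" shows "dyadic_energy k h \<le> dir_int h"
proof -
  obtain g where g: "H1_deriv h g" using assms unfolding H1_def by blast
  show ?thesis unfolding dir_int_eq[OF g]
  proof (rule dyadic_energy_le_integral)
    fix j :: nat assume "j \<le> 2 ^ k"
    then have "real j \<le> 2 ^ k" by (metis of_nat_le_iff of_nat_numeral of_nat_power)
    then have "real j / 2 ^ k \<in> {0..1}" by (auto simp: divide_simps)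
    then show "h (real j / 2 ^ k) = h 0 + (LINT s|unit_lborel. indicator {0..<real j / 2 ^ k} s * g s)"
      by (rule H1_derivD(3)[OF g])
  qed (rule H1_derivD[OF g])+
qed

lemma H1_of_dyadic_energy_bounded:
  assumes "continuous_on {0..1} h" "\<And>k. dyadic_energy k h \<le> C"
  shows "h \<in> H1" "dir_int h \<le> C"
proof -
  obtain g where "H1_deriv h g" "(LINT s|unit_lborel. (g s)\<^sup>2) \<le> C"
    using H1_deriv_of_dyadic_energy_bounded[OF assms] by blast
  then show "h \<in> H1" "dir_int h \<le> C" by (auto simp: H1_def dir_int_eq)
qed

text \<open>The limit of the dyadic energies bounds all of them, hence is an admissible bound for
  \<open>dir_int h\<close> in \<open>H1_of_dyadic_energy_bounded\<close>.\<close>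

lemma dyadic_energy_tendsto:
  assumes "continuous_on {0..1} h" "h \<in> H1"
  shows "(\<lambda>k. dyadic_energy k h) \<longlonglongrightarrow> dir_int h"
proof -
  have m: "incseq (\<lambda>k. dyadic_energy k h)" by (simp add: monoI dyadic_energy_mono)
  then obtain L where L: "(\<lambda>k. dyadic_energy k h) \<longlonglongrightarrow> L" "\<And>k. dyadic_energy k h \<le> L"
    using incseq_convergent[OF m] dyadic_energy_le_dir_int[OF assms(2)] by metis
  have "dir_int h \<le> L" using H1_of_dyadic_energy_bounded(2)[OF assms(1) L(2)] .
  moreover have "L \<le> dir_int h"
    using L(1) dyadic_energy_le_dir_int[OF assms(2)] by (intro LIMSEQ_le_const2) auto
  ultimately show ?thesis using L(1) by simp
qed

section \<open>Difference forms\<close>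

text \<open>An inductive predicate, so that each property of such sums takes one induction.
  \<open>X\<close> contains the points at which functions are evaluated; values elsewhere do not
  matter.\<close>

inductive difference_form :: "'b set \<Rightarrow> (('b \<Rightarrow> real) \<Rightarrow> real) \<Rightarrow> bool" for X where
  zero: "difference_form X (\<lambda>u. 0)"
| step: "difference_form X q \<Longrightarrow> 0 \<le> c \<Longrightarrow> x \<in> X \<Longrightarrow> y \<in> X \<Longrightarrow> difference_form X (\<lambda>u. c * (u x - u y)\<^sup>2 + q u)"

lemma difference_form_single:
  "0 \<le> c \<Longrightarrow> x \<in> X \<Longrightarrow> y \<in> X \<Longrightarrow> difference_form X (\<lambda>u. c * (u x - u y)\<^sup>2)"
  using difference_form.step[OF difference_form.zero] by simp

lemma difference_form_add:
  "difference_form X q \<Longrightarrow> difference_form X q' \<Longrightarrow> difference_form X (\<lambda>u. q u + q' u)"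
  by (induction rule: difference_form.induct) (auto simp: add.assoc intro: difference_form.step)

lemma difference_form_cmult:
  assumes "difference_form X q" "0 \<le> a" shows "difference_form X (\<lambda>u. a * q u)"
  using assms
proof (induction rule: difference_form.induct)
  case (step q c x y)
  then have "difference_form X (\<lambda>u. (a * c) * (u x - u y)\<^sup>2 + a * q u)"
    by (intro difference_form.step) auto
  then show ?case by (simp add: distrib_left mult.assoc)
qed (simp add: difference_form.zero)

lemma difference_form_sum:
  "(\<And>i. i \<in> I \<Longrightarrow> difference_form X (q i)) \<Longrightarrow> difference_form X (\<lambda>u. \<Sum>i\<in>I. q i u)"
  by (induction I rule: infinite_finite_induct) (auto intro: difference_form.zero difference_form_add)

lemma difference_form_compose:
  "difference_form X q \<Longrightarrow> f ` X \<subseteq> Y \<Longrightarrow> difference_form Y (\<lambda>u. q (u \<circ> f))"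
  by (induction rule: difference_form.induct)
    (auto simp: image_subset_iff intro: difference_form.zero intro!: difference_form.step)

lemma difference_form_nonneg: "difference_form X q \<Longrightarrow> 0 \<le> q u"
  by (induction rule: difference_form.induct) auto

text \<open>Common source of the Markov property, of independence from values outside
  \<open>X\<close>, and of invariance under a change of sign.\<close>

lemma difference_form_contraction:
  "difference_form X q \<Longrightarrow> (\<And>x y. x \<in> X \<Longrightarrow> y \<in> X \<Longrightarrow> \<bar>v x - v y\<bar> \<le> \<bar>u x - u y\<bar>) \<Longrightarrow> q v \<le> q u"
  by (induction rule: difference_form.induct)
    (auto intro!: add_mono mult_left_mono simp: abs_le_square_iff[symmetric])

lemma difference_form_cong:
  assumes "difference_form X q" "\<And>x. x \<in> X \<Longrightarrow> u x = v x" shows "q u = q v"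
  using difference_form_contraction[OF assms(1), of u v] difference_form_contraction[OF assms(1), of v u] assms(2)
  by force

lemma difference_form_const: "difference_form X q \<Longrightarrow> q (\<lambda>x. c) = 0"
  by (induction rule: difference_form.induct) auto

lemma difference_form_lincomb_le:
  assumes "difference_form X q"
  shows "q (\<lambda>x. a * u x + b * v x) \<le> 2 * a\<^sup>2 * q u + 2 * b\<^sup>2 * q v"
  using assms
proof (induction rule: difference_form.induct)
  case (step q c x y)
  have "((a * u x + b * v x) - (a * u y + b * v y))\<^sup>2 \<le> 2 * a\<^sup>2 * (u x - u y)\<^sup>2 + 2 * b\<^sup>2 * (v x - v y)\<^sup>2"
    using zero_le_power2[of "a * (u x - u y) - b * (v x - v y)"] by (simp add: power2_eq_square algebra_simps)
  from mult_left_mono[OF this step(2)] step(5) show ?case by (simp add: algebra_simps)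
qed simp

text \<open>Product rule: the difference of uv between x and y is u(x) (v(x) - v(y)) + v(y) (u(x) -
  u(y)). This makes the domain an algebra.\<close>

lemma difference_form_mult_le:
  assumes "difference_form X q" "\<And>x. x \<in> X \<Longrightarrow> \<bar>u x\<bar> \<le> a" "\<And>x. x \<in> X \<Longrightarrow> \<bar>v x\<bar> \<le> b"
  shows "q (\<lambda>x. u x * v x) \<le> 2 * a\<^sup>2 * q v + 2 * b\<^sup>2 * q u"
  using assms
proof (induction rule: difference_form.induct)
  case (step q c x y)
  have "(u x * v x - u y * v y)\<^sup>2 \<le> 2 * ((u x)\<^sup>2 * (v x - v y)\<^sup>2) + 2 * ((v y)\<^sup>2 * (u x - u y)\<^sup>2)"
    using zero_le_power2[of "u x * (v x - v y) - v y * (u x - u y)"] by (simp add: power2_eq_square algebra_simps)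
  also have "\<dots> \<le> 2 * (a\<^sup>2 * (v x - v y)\<^sup>2) + 2 * (b\<^sup>2 * (u x - u y)\<^sup>2)"
    using step.prems(1)[OF step.hyps(3)] step.prems(2)[OF step.hyps(4)]
    by (intro add_mono mult_left_mono mult_right_mono) (auto simp: abs_le_square_iff[symmetric])
  finally show ?case
    using mult_left_mono[OF _ step.hyps(2)] step.IH step.prems by (fastforce simp: algebra_simps)
qed simp

lemma difference_form_tendsto:
  "difference_form X q \<Longrightarrow> (\<And>x. x \<in> X \<Longrightarrow> (\<lambda>n. s n x) \<longlonglongrightarrow> u x) \<Longrightarrow> (\<lambda>n. q (s n)) \<longlonglongrightarrow> q u"
  by (induction rule: difference_form.induct) (auto intro!: tendsto_intros)

definition polar :: "(('b \<Rightarrow> real) \<Rightarrow> real) \<Rightarrow> ('b \<Rightarrow> real) \<Rightarrow> ('b \<Rightarrow> real) \<Rightarrow> real" where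
  "polar q u v = (q (\<lambda>x. u x + v x) - q (\<lambda>x. u x - v x)) / 4"

text \<open>The term c (u(x) - u(y))^2 polarizes to c (u(x) - u(y)) (v(x) - v(y)). Being an
  identity, linearity survives the passage to the limit energy.\<close>

lemma polar_difference_form_lincomb:
  assumes "difference_form X q"
  shows "polar q (\<lambda>x. a * u x + b * v x) w = a * polar q u w + b * polar q v w"
  using assms
proof (induction rule: difference_form.induct)
  case (step q c x y)
  have *: "polar (\<lambda>u. c * (u x - u y)\<^sup>2 + q u) u v = c * ((u x - u y) * (v x - v y)) + polar q u v" for u v
    unfolding polar_def by (simp add: power2_eq_square field_simps)
  show ?case unfolding * step.IH by (simp add: algebra_simps)
qed (simp add: polar_def)

lemma polar_difference_form_self:
  assumes "difference_form X q" shows "polar q u u = q u"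
  using assms
  by (induction rule: difference_form.induct) (auto simp: polar_def power2_eq_square field_simps)

lemma difference_form_commute:
  assumes "difference_form X q" shows "q (\<lambda>x. u x - v x) = q (\<lambda>x. v x - u x)"
proof -
  have "\<bar>u x - v x - (u y - v y)\<bar> = \<bar>v x - u x - (v y - u y)\<bar>" for x y by linarith
  then show ?thesis using assms by (intro antisym difference_form_contraction[OF assms]) simp_all
qed

lemma difference_form_dyadic_energy:
  "difference_form {0..1} (dyadic_energy k)"
proof -
  have "difference_form {0..1} (\<lambda>h. 2 ^ k * (\<Sum>j<2 ^ k. 1 * (h (real (Suc j) / 2 ^ k) - h (real j / 2 ^ k))\<^sup>2))"
  proof (intro difference_form_single difference_form_cmult difference_form_sum)
    fix j :: nat assume "j \<in> {..<2 ^ k}"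
    then have "real (Suc j) \<le> 2 ^ k" by (metis Suc_leI lessThan_iff of_nat_le_iff of_nat_numeral of_nat_power)
    then show "real (Suc j) / 2 ^ k \<in> {0..1}" "real j / 2 ^ k \<in> {0..1}" using \<open>j \<in> {..<2 ^ k}\<close> by (auto simp: divide_simps)
  qed auto
  then show ?thesis unfolding dyadic_energy_def[abs_def] by simp
qed

section \<open>Density of continuous functions in L2 over a compact set\<close>

lemma borel_measurable_of_continuous_on:
  fixes u :: "'a::euclidean_space \<Rightarrow> real"
  assumes "sets M = sets (restrict_space borel K)" "continuous_on K u"
  shows "u \<in> borel_measurable M"
  using borel_measurable_continuous_on_restrict[OF assms(2)] measurable_cong_sets[OF assms(1) refl] by blast

lemma integrable_sq_of_continuous_on:
  fixes u :: "'a::euclidean_space \<Rightarrow> real"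
  assumes "finite_measure M" and sets: "sets M = sets (restrict_space borel K)"
    and K: "compact K" and u: "continuous_on K u"
  shows "integrable M (\<lambda>x. (u x)\<^sup>2)"
proof -
  interpret finite_measure M by fact
  have sp: "space M = K" using sets_eq_imp_space_eq[OF sets] by (simp add: space_restrict_space)
  have "bounded (u ` K)" using compact_continuous_image[OF u K] by (rule compact_imp_bounded)
  then obtain B where B: "\<And>x. x \<in> K \<Longrightarrow> norm (u x) \<le> B" unfolding bounded_iff by blast
  have "norm ((u x)\<^sup>2) \<le> B\<^sup>2" if "x \<in> K" for x
    using power_mono[OF B[OF that], of 2] by simp
  then show ?thesis
    using borel_measurable_of_continuous_on[OF sets u] sp by (intro integrable_const_bound[of _ "B\<^sup>2"]) auto
qed

text \<open>Approximability \<open>P\<close> is passed from compact sets to measurable sets by inner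
  regularity, then by sums and monotone limits to nonnegative functions, and finally to differences
  of positive and negative parts.\<close>

lemma L2_dense_continuous:
  fixes K :: "'a::euclidean_space set" and f :: "'a \<Rightarrow> real"
  assumes fin: "finite_measure M" and sets: "sets M = sets (restrict_space borel K)" and K: "compact K"
    and f: "f \<in> sq_integrable M" and e: "e > 0"
  obtains g where "continuous_on K g" "(LINT x|M. (f x - g x)\<^sup>2) < e"
proof -
  interpret finite_measure M by (rule fin)
  have sp: "space M = K" using sets_eq_imp_space_eq[OF sets] by (simp add: space_restrict_space)
  have Kb: "K \<in> sets borel" using K by (simp add: compact_imp_closed)
  note cm = borel_measurable_of_continuous_on[OF sets]
  note csq = integrable_sq_of_continuous_on[OF fin sets K]
  define P where "P f \<longleftrightarrow> (\<forall>e>0. \<exists>g. continuous_on K g \<and> (LINT x|M. (f x - g x)\<^sup>2) < e)" for f :: "'a \<Rightarrow> real"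
  have P_I: "P f" if m: "f \<in> borel_measurable M" "integrable M (\<lambda>x. (f x)\<^sup>2)"
    and ap: "\<And>e. e > 0 \<Longrightarrow> \<exists>h. h \<in> borel_measurable M \<and> integrable M (\<lambda>x. (h x)\<^sup>2) \<and> P h \<and> (LINT x|M. (f x - h x)\<^sup>2) < e" for f :: "'a \<Rightarrow> real"
    unfolding P_def
  proof safe
    fix e :: real assume "e > 0"
    then obtain h where h: "h \<in> borel_measurable M" "integrable M (\<lambda>x. (h x)\<^sup>2)" "P h" "(LINT x|M. (f x - h x)\<^sup>2) < e/4"
      using ap[of "e/4"] by auto
    then obtain g where g: "continuous_on K g" "(LINT x|M. (h x - g x)\<^sup>2) < e/4"
      unfolding P_def using \<open>e > 0\<close> by (metis zero_less_divide_iff zero_less_numeral)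
    have "(LINT x|M. (f x - g x)\<^sup>2) \<le> 2 * (LINT x|M. (f x - h x)\<^sup>2) + 2 * (LINT x|M. (h x - g x)\<^sup>2)"
      using m h g by (intro integral_diff_sq_triangle) (auto intro: cm csq)
    then show "\<exists>g. continuous_on K g \<and> (LINT x|M. (f x - g x)\<^sup>2) < e" using h g by (intro exI[of _ g]) simp
  qed
  have P_lim: "P f" if m: "f \<in> borel_measurable M" "integrable M (\<lambda>x. (f x)\<^sup>2)"
    and s: "\<And>i. s i \<in> borel_measurable M" "\<And>i. P (s i)" "\<And>x. x \<in> space M \<Longrightarrow> (\<lambda>i. s i x) \<longlonglongrightarrow> f x"
    and dom: "\<And>i x. \<bar>s i x\<bar> \<le> \<bar>d x\<bar>" "\<And>x. \<bar>f x\<bar> \<le> \<bar>d x\<bar>" and d: "integrable M (\<lambda>x. (d x)\<^sup>2)" for f s d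
  proof (rule P_I[OF m])
    fix e :: real assume "e > 0"
    have bnd: "(f x - s i x)\<^sup>2 \<le> 4 * (d x)\<^sup>2" for i x
    proof -
      have "\<bar>f x - s i x\<bar> \<le> \<bar>2 * d x\<bar>" using dom(1)[of i x] dom(2)[of x] by linarith
      then have "(f x - s i x)\<^sup>2 \<le> (2 * d x)\<^sup>2" by (simp only: abs_le_square_iff)
      then show ?thesis by simp
    qed
    have "(\<lambda>i. LINT x|M. (f x - s i x)\<^sup>2) \<longlonglongrightarrow> (LINT x|M. 0)"
    proof (rule integral_dominated_convergence[where w="\<lambda>x. 4 * (d x)\<^sup>2"])
      show "AE x in M. (\<lambda>i. (f x - s i x)\<^sup>2) \<longlonglongrightarrow> 0"
      proof (rule AE_I2)
        fix x assume "x \<in> space M"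
        then have "(\<lambda>i. (f x - s i x)\<^sup>2) \<longlonglongrightarrow> (f x - f x)\<^sup>2" by (intro tendsto_intros s)
        then show "(\<lambda>i. (f x - s i x)\<^sup>2) \<longlonglongrightarrow> 0" by simp
      qed
    qed (use m s d bnd in auto)
    then obtain i where "(LINT x|M. (f x - s i x)\<^sup>2) < e"
      using order_tendstoD(2)[of _ 0 sequentially e] \<open>e > 0\<close> by (auto simp: eventually_sequentially)
    moreover have "integrable M (\<lambda>x. (s i x)\<^sup>2)"
      by (rule Bochner_Integration.integrable_bound[OF d]) (use s dom in \<open>auto simp: abs_le_square_iff\<close>)
    ultimately show "\<exists>h. h \<in> borel_measurable M \<and> integrable M (\<lambda>x. (h x)\<^sup>2) \<and> P h \<and> (LINT x|M. (f x - h x)\<^sup>2) < e"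
      using s by blast
  qed
  have P_cont: "P g" if "continuous_on K g" for g
    unfolding P_def using that by (auto intro!: exI[of _ g])
  have P_lin: "P (\<lambda>x. a * f x + b * g x)"
    if f: "f \<in> borel_measurable M" "integrable M (\<lambda>x. (f x)\<^sup>2)" "P f"
      and g: "g \<in> borel_measurable M" "integrable M (\<lambda>x. (g x)\<^sup>2)" "P g" for f g a b
    unfolding P_def
  proof safe
    fix e :: real assume "e > 0"
    define d where "d = e / (2 * a\<^sup>2 + 2 * b\<^sup>2 + 1)"
    have pos: "2 * a\<^sup>2 + 2 * b\<^sup>2 + 1 > 0" by (simp add: add_nonneg_pos)
    have "d > 0" using \<open>e > 0\<close> pos by (simp add: d_def)
    then obtain f' g' where f': "continuous_on K f'" "(LINT x|M. (f x - f' x)\<^sup>2) < d"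
      and g': "continuous_on K g'" "(LINT x|M. (g x - g' x)\<^sup>2) < d"
      using f(3) g(3) unfolding P_def by blast
    have i: "integrable M (\<lambda>x. (f x - f' x)\<^sup>2)" "integrable M (\<lambda>x. (g x - g' x)\<^sup>2)"
      using f g f' g' by (auto intro!: integrable_diff_sq intro: cm csq)
    have "integrable M (\<lambda>x. (a * (f x - f' x) + b * (g x - g' x))\<^sup>2)"
      using f g f' g' i by (intro integrable_lincomb_sq) (auto intro: cm intro!: borel_measurable_diff)
    moreover have eq: "(a * (f x - f' x) + b * (g x - g' x))\<^sup>2 = (a * f x + b * g x - (a * f' x + b * g' x))\<^sup>2" for x
      by (simp add: algebra_simps)
    moreover have "(a * f x + b * g x - (a * f' x + b * g' x))\<^sup>2 \<le> 2 * a\<^sup>2 * (f x - f' x)\<^sup>2 + 2 * b\<^sup>2 * (g x - g' x)\<^sup>2" for x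
      using zero_le_power2[of "a * (f x - f' x) - b * (g x - g' x)"] by (simp add: power2_eq_square algebra_simps)
    ultimately have "(LINT x|M. (a * f x + b * g x - (a * f' x + b * g' x))\<^sup>2)
        \<le> (LINT x|M. 2 * a\<^sup>2 * (f x - f' x)\<^sup>2 + 2 * b\<^sup>2 * (g x - g' x)\<^sup>2)"
      using i by (intro integral_mono) auto
    also have "\<dots> = 2 * a\<^sup>2 * (LINT x|M. (f x - f' x)\<^sup>2) + 2 * b\<^sup>2 * (LINT x|M. (g x - g' x)\<^sup>2)"
      using i by simp
    also have "\<dots> \<le> 2 * a\<^sup>2 * d + 2 * b\<^sup>2 * d"
      using f' g' by (intro add_mono mult_left_mono) auto
    also have "\<dots> < (2 * a\<^sup>2 + 2 * b\<^sup>2 + 1) * d" using \<open>d > 0\<close> by (simp add: algebra_simps)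
    also have "\<dots> = e" using pos by (simp add: d_def)
    finally show "\<exists>h. continuous_on K h \<and> (LINT x|M. (a * f x + b * g x - h x)\<^sup>2) < e"
      using f' g' by (intro exI[of _ "\<lambda>x. a * f' x + b * g' x"]) (auto intro!: continuous_intros)
  qed
  have P_compact: "P (indicator C)" if C: "compact C" "C \<subseteq> K" for C
  proof (cases "C = {}")
    case True
    then have "indicator C = (\<lambda>x::'a. 0::real)" by (simp add: indicator_def fun_eq_iff)
    then show ?thesis using P_cont[of "\<lambda>x. 0"] by simp
  next
    case False
    have Cb: "C \<in> sets M" unfolding sets sets_restrict_space using C by (auto simp: compact_imp_closed)
    \<comment> \<open>Continuous functions equal to 1 on \<open>C\<close> which, for i > 0, vanish
      at distance 1/i or more from \<open>C\<close>.\<close>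
    define s where "s i x = max 0 (1 - real i * infdist x C)" for i x
    have ci: "continuous_on K (s i)" for i unfolding s_def by (intro continuous_intros)
    show ?thesis
    proof (rule P_lim[where s=s and d="\<lambda>x. 1"])
      from ci show "s i \<in> borel_measurable M" for i by (rule cm)
      show "P (s i)" for i by (rule P_cont[OF ci])
      show "(\<lambda>i. s i x) \<longlonglongrightarrow> indicator C x" for x
      proof (cases "x \<in> C")
        case True then show ?thesis by (simp add: s_def)
      next
        case x: False
        then have "infdist x C > 0"
          using False C in_closed_iff_infdist_zero[of C x] infdist_nonneg[of x C] by (auto simp: compact_imp_closed order_less_le)
        then obtain N where N: "real N * infdist x C > 1" using reals_Archimedean3 by blast
        have "\<forall>\<^sub>F i in sequentially. s i x = indicator C x"
          using eventually_ge_at_top[of N]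
        proof eventually_elim
          case (elim i)
          have "real N * infdist x C \<le> real i * infdist x C" using elim by (intro mult_right_mono) (auto simp: infdist_nonneg)
          then show ?case using N x by (simp add: s_def)
        qed
        then show ?thesis by (rule tendsto_eventually)
      qed
      show "\<bar>s i x\<bar> \<le> \<bar>1\<bar>" for i x using infdist_nonneg[of x C] by (auto simp: s_def)
    qed (use Cb in \<open>auto simp: indicator_def power2_eq_square intro!: integrable_const_bound[of _ 1]\<close>)
  qed
  have ind_sq: "integrable M (\<lambda>x. (indicator A x)\<^sup>2 :: real)" if "A \<in> sets M" for A
  proof -
    have "(\<lambda>x. (indicator A x)\<^sup>2 :: real) = indicator A" by (auto simp: indicator_def)
    then show ?thesis using that by (simp add: emeasure_eq_measure)
  qed
  have P_set: "P (indicator A)" if A: "A \<in> sets M" for A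
  proof (rule P_I)
    have A': "A \<in> sets borel" "A \<subseteq> K"
      using A Kb unfolding sets by (auto simp: sets_restrict_space_iff)
    show "indicator A \<in> borel_measurable M" using A by simp
    show "integrable M (\<lambda>x. (indicator A x)\<^sup>2 :: real)" by (rule ind_sq[OF A])
    fix e :: real assume "e > 0"
    \<comment> \<open>Inner regularity is applied to the image of \<open>M\<close> under the
      inclusion of \<open>K\<close>, a Borel measure on the whole space.\<close>
    define N where "N = distr M borel (\<lambda>x. x)"
    have mid: "(\<lambda>x. x) \<in> measurable M borel"
      unfolding measurable_cong_sets[OF sets refl] by (rule measurable_restrict_space1) simp
    have N: "emeasure N B = emeasure M B" if "B \<in> sets borel" "B \<subseteq> K" for B
      unfolding N_def using that sp by (subst emeasure_distr[OF mid]) (auto simp: Int_absorb2)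
    have "emeasure N (space N) \<noteq> \<infinity>" unfolding N_def using finite_emeasure_space by (subst emeasure_distr[OF mid]) auto
    from inner_regular[OF _ this A'(1)] have reg: "emeasure N A = (SUP C\<in>{C. C \<subseteq> A \<and> compact C}. emeasure N C)"
      by (simp add: N_def)
    obtain C where C: "compact C" "C \<subseteq> A" "measure M A < measure M C + e"
    \<comment> \<open>The case split keeps \<open>measure M A - e\<close> nonnegative, so that
      \<open>ennreal\<close> does not truncate it.\<close>
    proof (cases "measure M A < e")
      case True
      then show ?thesis using that[of "{}"] by simp
    next
      case False
      then have "ennreal (measure M A - e) < emeasure N A"
        using \<open>e > 0\<close> by (simp add: N[OF A'] emeasure_eq_measure ennreal_less_iff)
      then obtain C where C: "compact C" "C \<subseteq> A" "ennreal (measure M A - e) < emeasure N C"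
        unfolding reg less_SUP_iff by blast
      moreover have "emeasure N C = measure M C"
        using C A' by (subst N) (auto simp: emeasure_eq_measure compact_imp_closed)
      ultimately show ?thesis using that[of C] False by (auto simp: ennreal_less_iff)
    qed
    have CM: "C \<in> sets M" using C A' unfolding sets by (auto simp: sets_restrict_space_iff Kb compact_imp_closed)
    have "(LINT x|M. (indicator A x - indicator C x)\<^sup>2 :: real) = (LINT x|M. indicator (A - C) x)"
      using C by (intro Bochner_Integration.integral_cong) (auto simp: indicator_def)
    also have "\<dots> = measure M (A - C)" using A CM sets.sets_into_space by (simp add: Int_absorb2 sets.Diff)
    also have "\<dots> = measure M A - measure M C" using A CM C by (intro finite_measure_Diff) auto
    also have "\<dots> < e" using C by simp
    finally have "(LINT x|M. (indicator A x - indicator C x)\<^sup>2 :: real) < e" .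
    moreover have "P (indicator C)" using C A' by (intro P_compact) auto
    moreover have "integrable M (\<lambda>x. (indicator C x)\<^sup>2 :: real)" by (rule ind_sq[OF CM])
    ultimately show "\<exists>h. h \<in> borel_measurable M \<and> integrable M (\<lambda>x. (h x)\<^sup>2) \<and> P h \<and> (LINT x|M. (indicator A x - h x)\<^sup>2) < e"
      using CM by (intro exI[of _ "indicator C"]) auto
  qed
  have P_nn: "P f" if "f \<in> borel_measurable M" "\<And>x. 0 \<le> f x" "integrable M (\<lambda>x. (f x)\<^sup>2)" for f
  proof -
    have "integrable M (\<lambda>x. (f x)\<^sup>2) \<longrightarrow> P f"
      using that(1,2)
    proof (induction rule: borel_measurable_induct_real)
      case (set A)
      then show ?case using P_set by simp
    next
      case (mult u c)
      show ?case
      proof (cases "c = 0")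
        case True
        then show ?thesis using P_cont[of "\<lambda>x. 0"] by simp
      next
        case False
        then have "integrable M (\<lambda>x. (u x)\<^sup>2)" if "integrable M (\<lambda>x. (c * u x)\<^sup>2)"
          using that by (simp add: power_mult_distrib)
        then show ?thesis using mult P_lin[of u u c 0] by auto
      qed
    next
      case (add u v)
      show ?case
      proof
        assume i: "integrable M (\<lambda>x. (v x + u x)\<^sup>2)"
        have "integrable M (\<lambda>x. (u x)\<^sup>2)" "integrable M (\<lambda>x. (v x)\<^sup>2)"
          by (rule Bochner_Integration.integrable_bound[OF i]; use add in \<open>auto intro!: power_mono\<close>)+
        then show "P (\<lambda>x. v x + u x)" using add P_lin[of v u 1 1] by simp
      qed
    next
      case (seq U)
      show ?case
      proof
        assume i: "integrable M (\<lambda>x. (f x)\<^sup>2)"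
        have le: "U i x \<le> f x" if "x \<in> space M" for i x
          using seq(3,4) that by (intro incseq_le) (auto simp: incseq_def le_fun_def)
        \<comment> \<open>\<open>P_lim\<close> asks for domination at every point, whereas
          \<open>U i x\<close> \<le> \<open>f x\<close> is available on
          \<open>space M\<close>.\<close>
        define U' where "U' i x = (if x \<in> space M then U i x else 0)" for i x
        have U': "U' i \<in> borel_measurable M" for i
          using seq(1)[of i] by (rule measurable_cong[THEN iffD2, rotated]) (simp add: U'_def)
        have Ui: "integrable M (\<lambda>x. (U i x)\<^sup>2)" for i
          by (rule Bochner_Integration.integrable_bound[OF i]) (use seq le in \<open>auto intro!: power_mono\<close>)
        have PU: "P (U' i)" for i
        proof -
          have "(LINT x|M. (U' i x - g x)\<^sup>2) = (LINT x|M. (U i x - g x)\<^sup>2)" for g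
            by (intro Bochner_Integration.integral_cong) (auto simp: U'_def)
          moreover have "P (U i)" using seq(5) Ui by blast
          ultimately show ?thesis unfolding P_def by simp
        qed
        show "P f"
        proof (rule P_lim[OF that(1) i U' PU _ _ _ i])
          show "x \<in> space M \<Longrightarrow> (\<lambda>i. U' i x) \<longlonglongrightarrow> f x" for x using seq(4) by (simp add: U'_def)
          show "\<bar>U' i x\<bar> \<le> \<bar>f x\<bar>" for i x using le[of x i] seq(2)[of i x] by (auto simp: U'_def)
        qed simp
      qed
    qed
    then show ?thesis using that(3) by simp
  qed
  have fm: "f \<in> borel_measurable M" "integrable M (\<lambda>x. (f x)\<^sup>2)" using f by (auto simp: sq_integrable_def)
  have "P (\<lambda>x. 1 * max (f x) 0 + (-1) * max (- f x) 0)"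
  proof (rule P_lin)
    show m: "(\<lambda>x. max (f x) 0) \<in> borel_measurable M" "(\<lambda>x. max (- f x) 0) \<in> borel_measurable M"
      using fm by auto
    show i: "integrable M (\<lambda>x. (max (f x) 0)\<^sup>2)" "integrable M (\<lambda>x. (max (- f x) 0)\<^sup>2)"
      by (rule Bochner_Integration.integrable_bound[OF fm(2)]; use m in \<open>auto simp: max_def\<close>)+
    show "P (\<lambda>x. max (f x) 0)" "P (\<lambda>x. max (- f x) 0)" using m i by (auto intro!: P_nn)
  qed
  moreover have "(\<lambda>x. 1 * max (f x) 0 + (-1) * max (- f x) 0) = f" by (auto simp: max_def)
  ultimately have "P f" by simp
  then show ?thesis using e that unfolding P_def by blast
qed

section \<open>Regular Dirichlet forms from increasing difference forms\<close>

text \<open>The interface between functional analysis and fractal geometry: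
  \<open>full_support\<close> makes the continuous representative unique on \<open>K\<close>,
  \<open>oscillation\<close> bounds the supremum norm by \<open>form1\<close>, and
  \<open>separation\<close> feeds Stone-Weierstrass.\<close>

locale regular_energy =
  fixes K :: "'a::euclidean_space set" and A :: "nat \<Rightarrow> ('a \<Rightarrow> real) \<Rightarrow> real"
    and M :: "'a measure" and E :: "('a \<Rightarrow> real) \<Rightarrow> ('a \<Rightarrow> real) \<Rightarrow> real" and D :: "('a \<Rightarrow> real) set"
    and q :: "('a \<Rightarrow> real) \<Rightarrow> real"
  assumes compact: "compact K"
    and form: "\<And>n. difference_form K (A n)"
    and mono: "\<And>n u. A n u \<le> A (Suc n) u"
    and D_iff: "\<And>u. u \<in> D \<longleftrightarrow> continuous_on K u \<and> (\<exists>C. \<forall>n. A n u \<le> C)"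
    and q_tendsto: "\<And>u. u \<in> D \<Longrightarrow> (\<lambda>n. A n u) \<longlonglongrightarrow> q u"
    and E_eq: "\<And>u v. E u v = polar q u v"
    and prob: "prob_space M" and sets: "sets M = sets (restrict_space borel K)"
    and full_support: "\<And>u x. continuous_on K u \<Longrightarrow> AE x in M. u x = 0 \<Longrightarrow> x \<in> K \<Longrightarrow> u x = (0::real)"
    and oscillation: "\<exists>C. \<forall>u\<in>D. \<forall>x\<in>K. \<forall>y\<in>K. (u x - u y)\<^sup>2 \<le> C * q u"
    and separation: "\<And>x y. x \<in> K \<Longrightarrow> y \<in> K \<Longrightarrow> x \<noteq> y \<Longrightarrow> \<exists>u\<in>D. u x \<noteq> u y"
begin

interpretation prob_space M by (rule prob)

lemma space_M: "space M = K"
  using sets_eq_imp_space_eq[OF sets] by (simp add: space_restrict_space)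

lemma continuous_of_D: "u \<in> D \<Longrightarrow> continuous_on K u"
  by (simp add: D_iff)

lemmas measurable_of_continuous = borel_measurable_of_continuous_on[OF sets]

lemmas integrable_sq_of_continuous =
  integrable_sq_of_continuous_on[OF finite_measure_axioms sets compact]

lemma bounded_of_continuous:
  fixes u :: "'a \<Rightarrow> real"
  assumes "continuous_on K u"
  obtains B where "\<And>x. x \<in> K \<Longrightarrow> \<bar>u x\<bar> \<le> B"
proof -
  have "bounded (u ` K)" using compact_continuous_image[OF assms compact] by (rule compact_imp_bounded)
  then show ?thesis using that unfolding bounded_iff by force
qed

lemma incseq_A: "incseq (\<lambda>n. A n u)"
  using mono by (simp add: incseq_SucI)

lemma A_le_q: "u \<in> D \<Longrightarrow> A n u \<le> q u"
  by (rule incseq_le[OF incseq_A q_tendsto])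

lemma D_I: "continuous_on K u \<Longrightarrow> (\<And>n. A n u \<le> C) \<Longrightarrow> u \<in> D"
  using D_iff by blast

lemma q_le: "continuous_on K u \<Longrightarrow> (\<And>n. A n u \<le> C) \<Longrightarrow> q u \<le> C"
  by (rule LIMSEQ_le_const2[OF q_tendsto[OF D_I]]) auto

lemma q_nonneg: "u \<in> D \<Longrightarrow> 0 \<le> q u"
  using A_le_q[of u 0] difference_form_nonneg[OF form, of 0 u] by linarith

lemma D_lincomb:
  assumes "u \<in> D" "v \<in> D" shows "(\<lambda>x. a * u x + b * v x) \<in> D"
proof (rule D_I)
  show "continuous_on K (\<lambda>x. a * u x + b * v x)"
    using assms by (intro continuous_intros continuous_of_D)
  fix n
  have "2 * a\<^sup>2 * A n u + 2 * b\<^sup>2 * A n v \<le> 2 * a\<^sup>2 * q u + 2 * b\<^sup>2 * q v"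
    using assms by (intro add_mono mult_left_mono A_le_q) auto
  with difference_form_lincomb_le[OF form]
  show "A n (\<lambda>x. a * u x + b * v x) \<le> 2 * a\<^sup>2 * q u + 2 * b\<^sup>2 * q v"
    by (rule order_trans)
qed

lemma D_add: "u \<in> D \<Longrightarrow> v \<in> D \<Longrightarrow> (\<lambda>x. u x + v x) \<in> D"
  using D_lincomb[of u v 1 1] by simp

lemma D_diff: "u \<in> D \<Longrightarrow> v \<in> D \<Longrightarrow> (\<lambda>x. u x - v x) \<in> D"
  using D_lincomb[of u v 1 "-1"] by simp

lemma D_const: "(\<lambda>x. c) \<in> D"
  using difference_form_const[OF form] by (intro D_I[of _ 0]) auto

lemma D_mult:
  assumes "u \<in> D" "v \<in> D" shows "(\<lambda>x. u x * v x) \<in> D"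
proof -
  obtain a b where ab: "\<And>x. x \<in> K \<Longrightarrow> \<bar>u x\<bar> \<le> a" "\<And>x. x \<in> K \<Longrightarrow> \<bar>v x\<bar> \<le> b"
    using bounded_of_continuous[OF continuous_of_D] assms by metis
  show ?thesis
  proof (rule D_I)
    show "continuous_on K (\<lambda>x. u x * v x)"
      using assms by (intro continuous_intros continuous_of_D)
    fix n
    have "2 * a\<^sup>2 * A n v + 2 * b\<^sup>2 * A n u \<le> 2 * a\<^sup>2 * q v + 2 * b\<^sup>2 * q u"
      using assms by (intro add_mono mult_left_mono A_le_q) auto
    with difference_form_mult_le[OF form ab]
    show "A n (\<lambda>x. u x * v x) \<le> 2 * a\<^sup>2 * q v + 2 * b\<^sup>2 * q u"
      by (rule order_trans)
  qed
qed

lemma D_uniformly_dense: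
  assumes "continuous_on K f" "e > 0"
  shows "\<exists>g\<in>D. \<forall>x\<in>K. \<bar>f x - g x\<bar> < e"
proof -
  interpret R: function_ring_on D K
    by unfold_locales (auto intro: compact continuous_of_D D_add D_mult D_const separation)
  show ?thesis by (rule R.Stone_Weierstrass_basic[OF assms])
qed

lemma E_tendsto:
  assumes "u \<in> D" "v \<in> D" shows "(\<lambda>n. polar (A n) u v) \<longlonglongrightarrow> E u v"
  unfolding E_eq polar_def
  using assms by (intro tendsto_intros q_tendsto D_add D_diff) auto

lemma E_lincomb:
  assumes "u \<in> D" "v \<in> D" "w \<in> D"
  shows "E (\<lambda>x. a * u x + b * v x) w = a * E u w + b * E v w"
proof (rule LIMSEQ_unique)
  show "(\<lambda>n. polar (A n) (\<lambda>x. a * u x + b * v x) w) \<longlonglongrightarrow> E (\<lambda>x. a * u x + b * v x) w"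
    using assms by (intro E_tendsto D_lincomb)
  show "(\<lambda>n. polar (A n) (\<lambda>x. a * u x + b * v x) w) \<longlonglongrightarrow> a * E u w + b * E v w"
    unfolding polar_difference_form_lincomb[OF form]
    using assms by (intro tendsto_intros E_tendsto)
qed

lemma E_self: "u \<in> D \<Longrightarrow> E u u = q u"
  using E_tendsto[of u u] q_tendsto[of u] by (simp add: polar_difference_form_self[OF form] LIMSEQ_unique)

lemma E_commute:
  assumes "u \<in> D" "v \<in> D" shows "E u v = E v u"
proof -
  have "polar (A n) u v = polar (A n) v u" for n
    unfolding polar_def using difference_form_commute[OF form, of n u v] by (simp add: add.commute)
  then show ?thesis using E_tendsto[OF assms] E_tendsto[OF assms(2,1)] by (simp add: LIMSEQ_unique)
qed

lemma A_cong: "(\<And>x. x \<in> K \<Longrightarrow> u x = v x) \<Longrightarrow> A n u = A n v"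
  by (rule difference_form_cong[OF form])

text \<open>By \<open>full_support\<close> the two functions coincide on \<open>K\<close>, and the
  forms \<open>A n\<close> see no other points.\<close>

lemma E_AE_cong:
  assumes "u \<in> D" "v \<in> D" "w \<in> D" "AE x in M. u x = v x"
  shows "E u w = E v w"
proof -
  have "u x - v x = 0" if "x \<in> K" for x
    using assms that by (intro full_support[of "\<lambda>x. u x - v x"] continuous_intros continuous_of_D) auto
  then have "polar (A n) u w = polar (A n) v w" for n
    unfolding polar_def by (intro arg_cong2[where f="\<lambda>a b. (a - b) / 4"] A_cong) auto
  then show ?thesis using E_tendsto[OF assms(1,3)] E_tendsto[OF assms(2,3)] by (simp add: LIMSEQ_unique)
qed

lemma form1_eq: "u \<in> D \<Longrightarrow> form1 M E u = q u + (LINT x|M. (u x)\<^sup>2)"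
  by (simp add: form1_def E_self)

lemma q_le_form1: "u \<in> D \<Longrightarrow> q u \<le> form1 M E u"
  by (simp add: form1_eq)

text \<open>Averaging u(x)^2 \<le> 2 (u(x) - u(y))^2 + 2 u(y)^2 over y with respect to the
  probability measure. The constant from \<open>oscillation\<close> carries no sign, hence its
  absolute value.\<close>

lemma sup_le_form1:
  obtains C where "C \<ge> 0" "\<And>u x. u \<in> D \<Longrightarrow> x \<in> K \<Longrightarrow> (u x)\<^sup>2 \<le> C * form1 M E u"
proof -
  obtain C where C: "\<And>u x y. u \<in> D \<Longrightarrow> x \<in> K \<Longrightarrow> y \<in> K \<Longrightarrow> (u x - u y)\<^sup>2 \<le> C * q u"
    using oscillation by blast
  have "(u x)\<^sup>2 \<le> (2 + 2 * \<bar>C\<bar>) * form1 M E u" if u: "u \<in> D" and x: "x \<in> K" for u x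
  proof -
    have "(u x)\<^sup>2 \<le> 2 * (C * q u) + 2 * (u y)\<^sup>2" if "y \<in> K" for y
      using zero_le_power2[of "(u x - u y) - u y"] C[OF u x that] by (simp add: power2_eq_square algebra_simps)
    then have "(LINT y|M. (u x)\<^sup>2) \<le> (LINT y|M. 2 * (C * q u) + 2 * (u y)\<^sup>2)"
      using integrable_sq_of_continuous[OF continuous_of_D[OF u]] by (intro integral_mono) (auto simp: space_M)
    also have "(LINT y|M. (u x)\<^sup>2) = (u x)\<^sup>2" by (simp add: prob_space)
    also have "(LINT y|M. 2 * (C * q u) + 2 * (u y)\<^sup>2) = 2 * (C * q u) + 2 * (LINT y|M. (u y)\<^sup>2)"
      using integrable_sq_of_continuous[OF continuous_of_D[OF u]] by (simp add: prob_space)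
    also have "\<dots> \<le> 2 * (\<bar>C\<bar> * q u) + 2 * (LINT y|M. (u y)\<^sup>2)"
      using q_nonneg[OF u] by (intro add_right_mono mult_left_mono mult_right_mono) auto
    also have "\<dots> \<le> (2 + 2 * \<bar>C\<bar>) * form1 M E u"
      unfolding form1_eq[OF u] using q_nonneg[OF u] by (simp add: algebra_simps)
    finally show ?thesis .
  qed
  then show ?thesis by (intro that[of "2 + 2 * \<bar>C\<bar>"]) auto
qed

text \<open>By \<open>sup_le_form1\<close> the sequence converges uniformly to some
  \<open>u\<close>. For fixed \<open>k\<close> the bound on \<open>A k\<close> of the differences
  passes to the limit in m, because \<open>A k\<close> involves finitely many points; letting k grow
  afterwards gives the bound on \<open>q\<close>.\<close>

lemma D_complete:
  assumes s: "\<And>n::nat. s n \<in> D"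
    and cauchy: "\<And>e. e > 0 \<Longrightarrow> \<exists>n0. \<forall>m\<ge>n0. \<forall>n\<ge>n0. form1 M E (\<lambda>x. s m x - s n x) < e"
  shows "\<exists>u\<in>D. (\<lambda>n. form1 M E (\<lambda>x. s n x - u x)) \<longlonglongrightarrow> 0"
proof -
  obtain C where C: "C \<ge> 0" "\<And>u x. u \<in> D \<Longrightarrow> x \<in> K \<Longrightarrow> (u x)\<^sup>2 \<le> C * form1 M E u"
    using sup_le_form1 by blast
  have dD: "(\<lambda>x. s m x - s n x) \<in> D" for m n by (intro D_diff s)
  have "uniformly_Cauchy_on K s"
  proof (rule uniformly_Cauchy_onI)
    fix e :: real assume e: "e > 0"
    \<comment> \<open>\<open>C\<close> may be 0; adding 1 also makes the final estimate
      strict.\<close>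
    then have "e\<^sup>2 / (C + 1) > 0" using C(1) by simp
    from cauchy[OF this] obtain n0 where n0: "\<And>m n. m \<ge> n0 \<Longrightarrow> n \<ge> n0 \<Longrightarrow> form1 M E (\<lambda>x. s m x - s n x) < e\<^sup>2 / (C + 1)" by blast
    have "dist (s m x) (s n x) < e" if "x \<in> K" "m \<ge> n0" "n \<ge> n0" for x m n
    proof -
      have "(s m x - s n x)\<^sup>2 \<le> C * form1 M E (\<lambda>x. s m x - s n x)" by (rule C(2)[OF dD that(1)])
      also have "\<dots> \<le> C * (e\<^sup>2 / (C + 1))" using n0[OF that(2,3)] C(1) by (intro mult_left_mono) auto
      also have "\<dots> < e\<^sup>2" using C(1) e by (simp add: divide_simps algebra_simps)
      finally have "\<bar>s m x - s n x\<bar>\<^sup>2 < e\<^sup>2" by simp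
      then have "\<bar>s m x - s n x\<bar> < e" by (rule power2_less_imp_less) (use e in simp)
      then show ?thesis using e by (simp add: dist_real_def)
    qed
    then show "\<exists>M. \<forall>x\<in>K. \<forall>m\<ge>M. \<forall>n\<ge>M. dist (s m x) (s n x) < e" by blast
  qed
  then obtain u where u: "uniform_limit K s u sequentially"
    using Cauchy_uniformly_convergent unfolding uniformly_convergent_on_def by blast
  have cu: "continuous_on K u"
    by (rule uniform_limit_theorem[OF _ u]) (simp_all add: continuous_of_D s)
  have lim: "(\<lambda>m. s m x) \<longlonglongrightarrow> u x" if "x \<in> K" for x by (rule tendsto_uniform_limitI[OF u that])
  have bound: "A k (\<lambda>x. u x - s n x) \<le> e \<and> (\<forall>x\<in>K. (u x - s n x)\<^sup>2 \<le> C * e)"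
    if n0: "\<And>m n. m \<ge> n0 \<Longrightarrow> n \<ge> n0 \<Longrightarrow> form1 M E (\<lambda>x. s m x - s n x) < e" and n: "n \<ge> n0" for n0 n e k
  proof
    have "(\<lambda>m. A k (\<lambda>x. s m x - s n x)) \<longlonglongrightarrow> A k (\<lambda>x. u x - s n x)"
      by (intro difference_form_tendsto[OF form] tendsto_intros lim)
    moreover have "A k (\<lambda>x. s m x - s n x) \<le> e" if "m \<ge> n0" for m
      using A_le_q[OF dD, of k m n] q_le_form1[OF dD, of m n] n0[OF that n] by linarith
    ultimately show "A k (\<lambda>x. u x - s n x) \<le> e" by (intro LIMSEQ_le_const2) auto
    show "\<forall>x\<in>K. (u x - s n x)\<^sup>2 \<le> C * e"
    proof
      fix x assume x: "x \<in> K"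
      have "(\<lambda>m. (s m x - s n x)\<^sup>2) \<longlonglongrightarrow> (u x - s n x)\<^sup>2" by (intro tendsto_intros lim x)
      moreover have "(s m x - s n x)\<^sup>2 \<le> C * e" if "m \<ge> n0" for m
        using C(2)[OF dD x, of m n] mult_left_mono[OF less_imp_le[OF n0[OF that n]] C(1)] by linarith
      ultimately show "(u x - s n x)\<^sup>2 \<le> C * e" by (intro LIMSEQ_le_const2) auto
    qed
  qed
  have cd: "continuous_on K (\<lambda>x. u x - s n x)" for n by (intro continuous_intros cu continuous_of_D s)
  obtain n1 where n1: "\<And>m n. m \<ge> n1 \<Longrightarrow> n \<ge> n1 \<Longrightarrow> form1 M E (\<lambda>x. s m x - s n x) < 1" using cauchy[of 1] by auto
  have "(\<lambda>x. u x - s n1 x) \<in> D" using bound[OF n1] by (intro D_I[OF cd]) auto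
  from D_add[OF this s[of n1]] have uD: "u \<in> D" by simp
  have uD': "(\<lambda>x. s n x - u x) \<in> D" for n by (intro D_diff s uD)
  have "(\<lambda>n. form1 M E (\<lambda>x. s n x - u x)) \<longlonglongrightarrow> 0"
  proof (rule LIMSEQ_I)
    fix r :: real assume r: "r > 0"
    \<comment> \<open>The energy contributes at most e and the L2 part at most C e; C + 2 leaves
      room for a strict inequality.\<close>
    define e where "e = r / (C + 2)"
    have e: "e > 0" unfolding e_def using r C(1) by simp
    from cauchy[OF e] obtain n0 where n0: "\<And>m n. m \<ge> n0 \<Longrightarrow> n \<ge> n0 \<Longrightarrow> form1 M E (\<lambda>x. s m x - s n x) < e" by blast
    have "norm (form1 M E (\<lambda>x. s n x - u x) - 0) < r" if n: "n \<ge> n0" for n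
    proof -
      have b: "A k (\<lambda>x. s n x - u x) \<le> e" for k
        using bound[OF n0 n, of k] difference_form_commute[OF form, of k u "s n"] by simp
      have "q (\<lambda>x. s n x - u x) \<le> e" by (rule q_le[OF continuous_of_D[OF uD'] b])
      moreover have "(LINT x|M. (s n x - u x)\<^sup>2) \<le> (LINT x|M. C * e)"
        using bound[OF n0 n] integrable_sq_of_continuous[OF continuous_of_D[OF uD'], of n]
        by (intro integral_mono) (auto simp: space_M power2_commute[of "s n _"])
      then have "(LINT x|M. (s n x - u x)\<^sup>2) \<le> C * e" by (simp add: prob_space)
      ultimately have "form1 M E (\<lambda>x. s n x - u x) \<le> e + C * e" unfolding form1_eq[OF uD'] by simp
      also have "\<dots> < (C + 2) * e" using e by (simp add: algebra_simps)
      also have "\<dots> = r" unfolding e_def using C(1) by simp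
      finally have "form1 M E (\<lambda>x. s n x - u x) < r" .
      moreover have "0 \<le> form1 M E (\<lambda>x. s n x - u x)"
        unfolding form1_eq[OF uD'] using q_nonneg[OF uD', of n] by simp
      ultimately show ?thesis by simp
    qed
    then show "\<exists>no. \<forall>n\<ge>no. norm (form1 M E (\<lambda>x. s n x - u x) - 0) < r" by blast
  qed
  then show ?thesis using uD by blast
qed

lemma D_Markov:
  assumes "u \<in> D"
  shows "(\<lambda>x. min (max (u x) 0) 1) \<in> D" "q (\<lambda>x. min (max (u x) 0) 1) \<le> q u"
proof -
  have "A n (\<lambda>x. min (max (u x) 0) 1) \<le> q u" for n
  proof -
    have "A n (\<lambda>x. min (max (u x) 0) 1) \<le> A n u"
      by (rule difference_form_contraction[OF form]) linarith
    then show ?thesis using A_le_q[OF assms, of n] by linarith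
  qed
  moreover have "continuous_on K (\<lambda>x. min (max (u x) 0) 1)"
    by (intro continuous_intros continuous_of_D assms)
  ultimately show "(\<lambda>x. min (max (u x) 0) 1) \<in> D" "q (\<lambda>x. min (max (u x) 0) 1) \<le> q u"
    by (auto intro: D_I q_le)
qed

lemma D_subset_sq_integrable: "D \<subseteq> sq_integrable M"
  unfolding sq_integrable_def using measurable_of_continuous integrable_sq_of_continuous continuous_of_D by auto

lemma D_L2_dense:
  assumes f: "f \<in> sq_integrable M" and e: "e > 0"
  shows "\<exists>u\<in>D. (LINT x|M. (f x - u x)\<^sup>2) < e"
proof -
  obtain g where g: "continuous_on K g" "(LINT x|M. (f x - g x)\<^sup>2) < e / 4"
    using L2_dense_continuous[OF finite_measure_axioms sets compact f, of "e / 4"] e by auto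
  obtain u where u: "u \<in> D" "\<And>x. x \<in> K \<Longrightarrow> \<bar>g x - u x\<bar> < sqrt (e / 4)"
    using D_uniformly_dense[OF g(1), of "sqrt (e / 4)"] e by auto
  note cu = continuous_of_D[OF u(1)]
  have "(g x - u x)\<^sup>2 \<le> e / 4" if "x \<in> K" for x
    using power_mono[OF less_imp_le[OF u(2)[OF that]] abs_ge_zero, of 2] e by simp
  moreover have "integrable M (\<lambda>x. (g x - u x)\<^sup>2)"
    by (intro integrable_sq_of_continuous continuous_intros g cu)
  ultimately have "(LINT x|M. (g x - u x)\<^sup>2) \<le> (LINT x|M. e / 4)"
    by (intro integral_mono) (auto simp: space_M)
  then have "(LINT x|M. (g x - u x)\<^sup>2) \<le> e / 4" by (simp add: prob_space)
  moreover have "(LINT x|M. (f x - u x)\<^sup>2) \<le> 2 * (LINT x|M. (f x - g x)\<^sup>2) + 2 * (LINT x|M. (g x - u x)\<^sup>2)"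
    using f g cu by (intro integral_diff_sq_triangle) (auto simp: sq_integrable_def intro: measurable_of_continuous integrable_sq_of_continuous)
  ultimately show ?thesis using g(2) u(1) by (intro bexI[of _ u]) auto
qed

theorem regular_dirichlet_form: "regular_dirichlet_form K M E D"
proof -
  have cc: "u \<in> cont_compact_supp K" if "continuous_on K u" for u
    unfolding cont_compact_supp_def using that compact by auto
  have "dirichlet_form M E D"
    unfolding dirichlet_form_def
  proof (intro conjI)
    show "\<forall>u\<in>D. \<exists>v\<in>D. (AE x in M. v x = min (max (u x) 0) 1) \<and> E v v \<le> E u u"
      using D_Markov by (auto simp: E_self intro!: bexI[of _ "\<lambda>x. min (max (_ x) 0) 1"])
    show "\<forall>s. (\<forall>n::nat. s n \<in> D) \<and> (\<forall>\<epsilon>>0. \<exists>n0. \<forall>m\<ge>n0. \<forall>n\<ge>n0. form1 M E (\<lambda>x. s m x - s n x) < \<epsilon>) \<longrightarrow>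
          (\<exists>u\<in>D. (\<lambda>n. form1 M E (\<lambda>x. s n x - u x)) \<longlonglongrightarrow> 0)"
      using D_complete by blast
    show "\<forall>u\<in>D. \<forall>v\<in>D. \<forall>w\<in>D. (AE x in M. u x = v x) \<longrightarrow> E u w = E v w"
      using E_AE_cong by blast
    show "\<forall>u\<in>D. 0 \<le> E u u" by (simp add: E_self q_nonneg)
  qed (use D_subset_sq_integrable D_const D_lincomb D_L2_dense E_lincomb E_commute in auto)
  \<comment> \<open>Every function of \<open>D\<close> is continuous on the compact set
    \<open>K\<close>, so it serves as its own approximation.\<close>
  moreover have "\<forall>u\<in>D. \<forall>\<epsilon>>0. \<exists>v\<in>D. (\<exists>f\<in>cont_compact_supp K. AE x in M. v x = f x) \<and> form1 M E (\<lambda>x. u x - v x) < \<epsilon>"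
  proof (intro ballI allI impI)
    fix u and \<epsilon> :: real assume u: "u \<in> D" and "\<epsilon> > 0"
    have "q (\<lambda>x. 0) \<le> 0" by (rule q_le) (auto simp: difference_form_const[OF form])
    then have "form1 M E (\<lambda>x. u x - u x) < \<epsilon>"
      using form1_eq[OF D_const[of 0]] \<open>\<epsilon> > 0\<close> by simp
    then show "\<exists>v\<in>D. (\<exists>f\<in>cont_compact_supp K. AE x in M. v x = f x) \<and> form1 M E (\<lambda>x. u x - v x) < \<epsilon>"
      using u cc[OF continuous_of_D[OF u]] by (intro bexI[of _ u] conjI bexI[of _ u]) auto
  qed
  moreover have "\<exists>g\<in>cont_compact_supp K. (\<exists>v\<in>D. AE x in M. v x = g x) \<and> (\<forall>x\<in>K. \<bar>f x - g x\<bar> < \<epsilon>)"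
    if "f \<in> cont_compact_supp K" "\<epsilon> > 0" for f \<epsilon>
  proof -
    have "continuous_on K f" using that(1) by (simp add: cont_compact_supp_def)
    then obtain g where "g \<in> D" "\<forall>x\<in>K. \<bar>f x - g x\<bar> < \<epsilon>"
      using D_uniformly_dense \<open>\<epsilon> > 0\<close> by blast
    then show ?thesis using cc[OF continuous_of_D] by (intro bexI[of _ g] conjI bexI[of _ g]) auto
  qed
  ultimately show ?thesis unfolding regular_dirichlet_form_def by blast
qed

end

section \<open>Geometry of the stretched fractal\<close>

lemma wmap_append: "wmap f (v @ w) = wmap f v \<circ> wmap f w"
  by (induction v) (auto simp: comp_assoc)

lemma wmap_replicate_fixed: "f i x = x \<Longrightarrow> wmap f (replicate n i) x = x"
  by (induction n) auto

lemma Nil_in_words [simp]: "[] \<in> words S"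
  by (simp add: words_def)

lemma Cons_in_words_iff [simp]: "i # w \<in> words S \<longleftrightarrow> i \<in> letters S \<and> w \<in> words S"
  by (auto simp: words_def)

lemma append_in_words_iff [simp]: "v @ w \<in> words S \<longleftrightarrow> v \<in> words S \<and> w \<in> words S"
  by (auto simp: words_def)

lemma finite_letters [simp]: "finite (letters S)"
  by (simp add: letters_def)

lemma finite_words_n [simp]: "finite (words_n S n)"
  using finite_lists_length_eq[of "letters S" n]
  by (simp add: words_n_def words_def)

lemma words_n_0 [simp]: "words_n S 0 = {[]}"
  by (auto simp: words_n_def)

lemma sum_words_n_Suc:
  "(\<Sum>w\<in>words_n S (Suc n). g w) = (\<Sum>w\<in>words_n S n. \<Sum>i\<in>letters S. g (w @ [i]))"
proof -
  have "bij_betw (\<lambda>(w, i). w @ [i]) (words_n S n \<times> letters S) (words_n S (Suc n))"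
  proof (rule bij_betwI[where g="\<lambda>w. (butlast w, last w)"])
    show "(\<lambda>w. (butlast w, last w)) \<in> words_n S (Suc n) \<rightarrow> words_n S n \<times> letters S"
    proof
      fix w assume w: "w \<in> words_n S (Suc n)"
      then have "w \<noteq> []" by (auto simp: words_n_def)
      with w have "butlast w @ [last w] \<in> words S" by (simp add: words_n_def)
      then show "(butlast w, last w) \<in> words_n S n \<times> letters S" using w by (simp add: words_n_def)
    qed
  qed (auto simp: words_n_def intro!: append_butlast_last_id)
  from sum.reindex_bij_betw[OF this, of g, symmetric] show ?thesis
    by (simp add: sum.cartesian_product case_prod_unfold)
qed

lemma wmap_dist_le:
  fixes f :: "nat \<Rightarrow> 'a::metric_space \<Rightarrow> 'a"
  assumes "\<And>i x y. i \<in> I \<Longrightarrow> dist (f i x) (f i y) \<le> R * dist x y" "0 \<le> R" "set w \<subseteq> I"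
  shows "dist (wmap f w x) (wmap f w y) \<le> R ^ length w * dist x y"
  using assms(3)
proof (induction w)
  case (Cons i w)
  then have "dist (wmap f (i # w) x) (wmap f (i # w) y) \<le> R * dist (wmap f w x) (wmap f w y)"
    using assms(1) by simp
  also have "\<dots> \<le> R * (R ^ length w * dist x y)"
    using Cons assms(2) by (intro mult_left_mono) auto
  finally show ?case by (simp add: mult.assoc)
qed simp

text \<open>The cells along \<open>\<tau>\<close> have diameter at most R^n B. The lemma serves both
  families of maps, on F and on K; the threshold \<open>m\<close> is for points whose cell is known
  from some length on.\<close>

lemma eq_of_common_cells:
  fixes f :: "nat \<Rightarrow> 'a::metric_space \<Rightarrow> 'a"
  assumes R: "\<And>i x y. i \<in> I \<Longrightarrow> dist (f i x) (f i y) \<le> R * dist x y" "0 \<le> R" "R < 1"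
    and \<tau>: "range \<tau> \<subseteq> I" and A: "bounded A"
    and x: "\<And>n. n \<ge> m \<Longrightarrow> x \<in> wmap f (map \<tau> [0..<n]) ` A"
    and y: "\<And>n. n \<ge> m \<Longrightarrow> y \<in> wmap f (map \<tau> [0..<n]) ` A"
  shows "x = y"
proof -
  obtain B where B: "\<And>a b. a \<in> A \<Longrightarrow> b \<in> A \<Longrightarrow> dist a b \<le> B"
    using A by (meson bounded_two_points)
  have "dist x y \<le> R ^ n * B" if n: "n \<ge> m" for n
  proof -
    obtain a b where ab: "a \<in> A" "b \<in> A" "x = wmap f (map \<tau> [0..<n]) a" "y = wmap f (map \<tau> [0..<n]) b"
      using x[OF n] y[OF n] by blast
    have "dist x y \<le> R ^ length (map \<tau> [0..<n]) * dist a b"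
      unfolding ab using \<tau> by (intro wmap_dist_le[OF R(1,2)]) auto
    also have "\<dots> \<le> R ^ n * B" using B[OF ab(1,2)] R(2) by (simp add: mult_left_mono)
    finally show ?thesis .
  qed
  moreover have "(\<lambda>n. R ^ n * B) \<longlonglongrightarrow> 0 * B"
    using R by (intro tendsto_intros LIMSEQ_realpow_zero)
  ultimately have "dist x y \<le> 0" by (intro LIMSEQ_le_const[of "\<lambda>n. R ^ n * B"]) auto
  then show ?thesis by simp
qed

lemma finite_family_contraction:
  fixes f :: "'i \<Rightarrow> 'a::metric_space \<Rightarrow> 'a"
  assumes "finite I" "\<And>i. i \<in> I \<Longrightarrow> contracting_similitude (f i)"
  obtains R where "0 \<le> R" "R < 1" "\<And>i x y. i \<in> I \<Longrightarrow> dist (f i x) (f i y) \<le> R * dist x y"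
proof -
  obtain r where r: "\<And>i. i \<in> I \<Longrightarrow> 0 < r i \<and> r i < 1 \<and> (\<forall>x y. dist (f i x) (f i y) = r i * dist x y)"
    using assms(2) unfolding contracting_similitude_def by metis
  define R where "R = Max (insert 0 (r ` I))"
  have "r i \<le> R" if "i \<in> I" for i unfolding R_def using assms(1) that by (intro Max_ge) auto
  moreover have "0 \<le> R" unfolding R_def using assms(1) by (intro Max_ge) auto
  moreover have "R < 1" unfolding R_def using assms(1) r by auto
  ultimately show ?thesis using r by (intro that[of R]) (auto intro: mult_right_mono)
qed

text \<open>After subtraction of \<open>f 0\<close> the map fixes the origin and scales distances,
  hence is linear. Copies of segments thus keep their parametrization.\<close>

lemma affine_of_similitude:
  fixes f :: "'a::euclidean_space \<Rightarrow> 'a"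
  assumes "contracting_similitude f"
  shows "f (\<xi> x y t) = \<xi> (f x) (f y) t"
proof -
  obtain r where r: "\<And>x y. dist (f x) (f y) = r * dist x y"
    using assms unfolding contracting_similitude_def by blast
  define g where "g z = f z - f 0" for z
  have "dist (g x) (g y) = dist (f x) (f y)" for x y by (simp add: g_def dist_norm)
  then have "linear g" by (intro scaling_linear[of g r]) (auto simp: g_def r)
  then have "g (t *\<^sub>R x + (1 - t) *\<^sub>R y) = t *\<^sub>R g x + (1 - t) *\<^sub>R g y"
    by (simp add: linear_add linear_scale)
  then have "f (t *\<^sub>R x + (1 - t) *\<^sub>R y) = t *\<^sub>R (f x - f 0) + (1 - t) *\<^sub>R (f y - f 0) + f 0"
    by (simp add: g_def algebra_simps)
  also have "\<dots> = t *\<^sub>R f x + (1 - t) *\<^sub>R f y" by (simp add: algebra_simps)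
  finally show ?thesis by (simp add: \<xi>_def)
qed

locale stretched =
  fixes S :: "'a::euclidean_space stretched"
  assumes fractal: "stretched_fractal S"
begin

lemma sim_similitude: "i \<in> letters S \<Longrightarrow> contracting_similitude (sim S i)"
  and sim_fixp: "i \<in> letters S \<Longrightarrow> sim S i (fixp S i) = fixp S i"
  and num_ge_2: "num S \<ge> 2"
  and attr_ne: "attr S \<noteq> {}" and compact_attr: "compact (attr S)"
  and attr_eq: "attr S = (\<Union>i\<in>letters S. sim S i ` attr S)"
  and connected_attr: "connected (attr S)" and pcf: "pcf S"
  and alpha: "0 < alpha S" "alpha S < 1"
  and K_ne: "strK S \<noteq> {}" and compact_K: "compact (strK S)"
  and K_eq: "strK S = (\<Union>i\<in>letters S. G S i ` strK S) \<union> (\<Union>c\<in>crit S. \<Union>l\<in>{1..ncells S c}. seg S c l)"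
  and G_disjoint: "i \<in> letters S \<Longrightarrow> j \<in> letters S \<Longrightarrow> i \<noteq> j \<Longrightarrow> G S i ` strK S \<inter> G S j ` strK S = {}"
  and cword: "c \<in> crit S \<Longrightarrow> l \<in> {1..ncells S c} \<Longrightarrow> cword S c l \<in> words S \<and> cword S c l \<noteq> [] \<and>
           cfix S c l \<in> fixp S ` letters S \<and> cfix S c l \<in> postcrit S \<and>
           wmap (sim S) (cword S c l) (cfix S c l) = c"
  and inj_cword: "c \<in> crit S \<Longrightarrow> inj_on (\<lambda>l. hd (cword S c l)) {1..ncells S c}"
  and endp_ne: "c \<in> crit S \<Longrightarrow> l \<in> {1..ncells S c} \<Longrightarrow> endp S c l \<noteq> c"
  using fractal unfolding stretched_fractal_def by (simp_all, blast?)

lemma G_similitude: assumes "i \<in> letters S" shows "contracting_similitude (G S i)"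
proof -
  obtain r where r: "0 < r" "r < 1" "\<And>x y. dist (sim S i x) (sim S i y) = r * dist x y"
    using sim_similitude[OF assms] unfolding contracting_similitude_def by blast
  have "dist (G S i x) (G S i y) = alpha S * r * dist x y" for x y
  proof -
    have "G S i x - G S i y = alpha S *\<^sub>R (sim S i x - sim S i y)"
      by (simp add: G_def algebra_simps)
    then show ?thesis using r(3)[of x y] alpha by (simp add: dist_norm)
  qed
  moreover have "alpha S * r < 1" using r alpha mult_strict_mono[of "alpha S" 1 r 1] by simp
  ultimately show ?thesis unfolding contracting_similitude_def using r alpha by (intro exI[of _ "alpha S * r"]) auto
qed

lemma G_fixp: "i \<in> letters S \<Longrightarrow> G S i (fixp S i) = fixp S i"
  by (simp add: G_def sim_fixp)

lemma G_ratio: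
  obtains R where "0 \<le> R" "R < 1" "\<And>i x y. i \<in> letters S \<Longrightarrow> dist (G S i x) (G S i y) \<le> R * dist x y"
  using finite_family_contraction[of "letters S" "G S"] G_similitude by auto

lemma inj_G: "i \<in> letters S \<Longrightarrow> inj (G S i)"
  using G_similitude unfolding contracting_similitude_def inj_def
  by (metis dist_eq_0_iff less_irrefl mult_eq_0_iff)

lemma inj_Gw: "w \<in> words S \<Longrightarrow> inj (Gw S w)"
  by (induction w) (auto intro!: inj_compose inj_G simp del: comp_apply)

lemma Gw_affine: "w \<in> words S \<Longrightarrow> Gw S w (\<xi> x y t) = \<xi> (Gw S w x) (Gw S w y) t"
  by (induction w) (auto simp: affine_of_similitude G_similitude)

lemma Gw_dist_le: "w \<in> words S \<Longrightarrow> dist (Gw S w x) (Gw S w y) \<le> dist x y"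
proof -
  assume w: "w \<in> words S"
  obtain R where R: "0 \<le> R" "R < 1" "\<And>i x y. i \<in> letters S \<Longrightarrow> dist (G S i x) (G S i y) \<le> R * dist x y"
    using G_ratio by blast
  have "dist (Gw S w x) (Gw S w y) \<le> R ^ length w * dist x y"
    using w by (intro wmap_dist_le[OF R(3,1)]) (auto simp: words_def)
  also have "\<dots> \<le> 1 * dist x y" using R by (intro mult_right_mono power_le_one) auto
  finally show ?thesis by simp
qed

lemma continuous_on_Gw: "w \<in> words S \<Longrightarrow> continuous_on A (Gw S w)"
  using Gw_dist_le[of w] by (intro lipschitz_on_continuous_on[of 1] lipschitz_onI) auto

lemma Gw_in_K: "w \<in> words S \<Longrightarrow> x \<in> strK S \<Longrightarrow> Gw S w x \<in> strK S"
proof (induction w)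
  case (Cons i w)
  then have "G S i (Gw S w x) \<in> (\<Union>i\<in>letters S. G S i ` strK S)" by auto
  then show ?case using K_eq by auto
qed simp

lemma seg_subset_K: "c \<in> crit S \<Longrightarrow> l \<in> {1..ncells S c} \<Longrightarrow> seg S c l \<subseteq> strK S"
  using K_eq by blast

lemma xi_in_seg: "t \<in> {0..1} \<Longrightarrow> \<xi> c (endp S c l) t \<in> seg S c l"
  unfolding seg_def closed_segment_def \<xi>_def
  by (intro CollectI exI[of _ "1 - t"]) auto

lemma seg_eq_image: "seg S c l = \<xi> c (endp S c l) ` {0..1}"
proof
  show "seg S c l \<subseteq> \<xi> c (endp S c l) ` {0..1}"
  proof
    fix x assume "x \<in> seg S c l"
    then obtain u where "0 \<le> u" "u \<le> 1" "x = (1 - u) *\<^sub>R c + u *\<^sub>R endp S c l"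
      unfolding seg_def closed_segment_def by blast
    then have "x = \<xi> c (endp S c l) (1 - u)" "1 - u \<in> {0..1}" by (auto simp: \<xi>_def)
    then show "x \<in> \<xi> c (endp S c l) ` {0..1}" by blast
  qed
qed (use xi_in_seg in auto)

text \<open>Take a point of K nearest to q_i. Its image under G_i is again in K and nearer by a
  factor r < 1, so the distance is 0.\<close>

lemma fixp_in_K: assumes i: "i \<in> letters S" shows "fixp S i \<in> strK S"
proof -
  obtain y where y: "y \<in> strK S" "\<And>z. z \<in> strK S \<Longrightarrow> dist (fixp S i) y \<le> dist (fixp S i) z"
    using distance_attains_inf[OF compact_imp_closed[OF compact_K] K_ne, of "fixp S i"] by blast
  obtain r where r: "0 < r" "r < 1" "\<And>x y. dist (G S i x) (G S i y) = r * dist x y"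
    using G_similitude[OF i] unfolding contracting_similitude_def by blast
  have "dist (fixp S i) y \<le> dist (fixp S i) (G S i y)"
    using Gw_in_K[of "[i]" y] i y by simp
  also have "\<dots> = r * dist (fixp S i) y" using r(3)[of "fixp S i" y] G_fixp[OF i] by simp
  finally have "(1 - r) * dist (fixp S i) y \<le> 0" by (simp add: algebra_simps)
  then have "dist (fixp S i) y \<le> 0" using r by (simp add: mult_le_0_iff)
  then show ?thesis using y by simp
qed

lemma simw_in_attr: "w \<in> words S \<Longrightarrow> x \<in> attr S \<Longrightarrow> wmap (sim S) w x \<in> attr S"
proof (induction w)
  case (Cons i w)
  then have "sim S i (wmap (sim S) w x) \<in> (\<Union>i\<in>letters S. sim S i ` attr S)" by auto
  then show ?case using attr_eq by auto
qed simp

lemma cell_subset_attr: "i \<in> letters S \<Longrightarrow> sim S i ` attr S \<subseteq> attr S"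
  using simw_in_attr[of "[i]"] by auto

section \<open>Addresses; finiteness of the critical set and of V_0\<close>

lemma address_unique:
  assumes "address S \<omega> x" "address S \<omega> y" shows "x = y"
proof -
  obtain R where R: "0 \<le> R" "R < 1" "\<And>i x y. i \<in> letters S \<Longrightarrow> dist (sim S i x) (sim S i y) \<le> R * dist x y"
    using finite_family_contraction[of "letters S" "sim S"] sim_similitude by auto
  show ?thesis
    using assms unfolding address_def
    by (intro eq_of_common_cells[OF R(3,1,2), where \<tau>=\<omega> and A="attr S" and m=0] compact_imp_bounded compact_attr) auto
qed

lemma address_exists:
  assumes "x \<in> attr S" obtains \<omega> where "address S \<omega> x"
proof -
  have step: "\<exists>i z. i \<in> letters S \<and> z \<in> attr S \<and> y = sim S i z" if "y \<in> attr S" for y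
    using that attr_eq by blast
  then obtain I Z where IZ: "\<And>y. y \<in> attr S \<Longrightarrow> I y \<in> letters S \<and> Z y \<in> attr S \<and> y = sim S (I y) (Z y)"
    by metis
  define p where "p n = (Z ^^ n) x" for n
  have p: "p n \<in> attr S" for n by (induction n) (use assms IZ in \<open>auto simp: p_def\<close>)
  have "x = wmap (sim S) (map (\<lambda>n. I (p n)) [0..<n]) (p n)" for n
  proof (induction n)
    case (Suc n)
    have "p n = sim S (I (p n)) (p (Suc n))" using IZ[OF p[of n]] by (simp add: p_def)
    then show ?case using Suc by (simp add: wmap_append)
  qed (simp add: p_def)
  then have "address S (\<lambda>n. I (p n)) x"
    unfolding address_def using p IZ by blast
  then show ?thesis using that by blast
qed

text \<open>The post-critical set in the shift space, whose finiteness is what \<open>pcf\<close>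
  states.\<close>

definition tails :: "(nat \<Rightarrow> nat) set" where
  "tails = {(\<lambda>k. \<omega> (n + k)) |\<omega> n. n \<ge> 1 \<and> (\<exists>x\<in>crit S. address S \<omega> x)}"

lemma finite_tails: "finite tails"
  using pcf unfolding pcf_def tails_def .

lemma crit_subset_attr: "crit S \<subseteq> attr S"
  using attr_eq unfolding crit_def by blast

text \<open>A critical point is determined by the first letter of an address and the remaining tail.\<close>

lemma finite_crit: "finite (crit S)"
proof -
  have "\<exists>\<omega>. address S \<omega> c" if "c \<in> crit S" for c
    using address_exists[of c] crit_subset_attr that by blast
  then obtain a where a: "\<And>c. c \<in> crit S \<Longrightarrow> address S (a c) c" by metis
  let ?f = "\<lambda>c. (a c 0, \<lambda>k. a c (1 + k))"
  have "?f ` crit S \<subseteq> letters S \<times> tails"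
  proof
    fix y assume "y \<in> ?f ` crit S"
    then obtain c where c: "c \<in> crit S" "y = ?f c" by blast
    have "a c 0 \<in> letters S" using a[OF c(1)] unfolding address_def by blast
    moreover have "(\<lambda>k. a c (1 + k)) \<in> tails" unfolding tails_def using a[OF c(1)] c(1) by blast
    ultimately show "y \<in> letters S \<times> tails" using c by simp
  qed
  moreover have "inj_on ?f (crit S)"
  proof (rule inj_onI)
    fix c d assume cd: "c \<in> crit S" "d \<in> crit S" "?f c = ?f d"
    have "a c k = a d k" for k
    proof (cases k)
      case (Suc m)
      then show ?thesis using cd(3) fun_cong[of "\<lambda>k. a c (1 + k)" "\<lambda>k. a d (1 + k)" m] by simp
    qed (use cd in simp)
    then have "a c = a d" by (rule ext)
    with a[OF cd(2)] have "address S (a c) d" by simp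
    with a[OF cd(1)] show "c = d" by (rule address_unique)
  qed
  ultimately show ?thesis using finite_tails
    by (intro inj_on_finite[of ?f "crit S" "letters S \<times> tails"]) auto
qed

text \<open>
  The address \<open>v i i i \<dots>\<close> of \<open>F\<^sub>v(q\<^sub>i)\<close>.  The addresses of the points \<open>p\<close> with \<open>p_hat \<in> V\<^sub>0\<close> are tails
  of addresses of critical points, and they determine \<open>p_hat\<close>.
\<close>

definition eventually_const :: "nat list \<Rightarrow> nat \<Rightarrow> nat \<Rightarrow> nat" where
  "eventually_const v i k = (if k < length v then v ! k else i)"

lemma map_eventually_const:
  "length v \<le> n \<Longrightarrow> map (eventually_const v i) [0..<n] = v @ replicate (n - length v) i"
  by (intro nth_equalityI) (auto simp: eventually_const_def nth_append)

lemma address_eventually_const: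
  assumes v: "v \<in> words S" and i: "i \<in> letters S" and q: "fixp S i \<in> attr S"
  shows "address S (eventually_const v i) (wmap (sim S) v (fixp S i))"
  unfolding address_def
proof safe
  show "eventually_const v i k \<in> letters S" for k
    using v i by (auto simp: eventually_const_def words_def)
  fix n
  \<comment> \<open>Appending further letters i to v does not move the point, since F_i fixes q_i.
    The longer word has a prefix of length n even if v is shorter than n.\<close>
  let ?u = "map (eventually_const v i) [0..<n + length v]"
  have "wmap (sim S) v (fixp S i) = wmap (sim S) ?u (fixp S i)"
    by (simp add: map_eventually_const wmap_append wmap_replicate_fixed sim_fixp[OF i])
  also have "?u = map (eventually_const v i) [0..<n] @ map (eventually_const v i) [n..<n + length v]"
    by (simp only: upt_add_eq_append[OF le0] map_append)
  finally have eq: "wmap (sim S) v (fixp S i) = wmap (sim S) (map (eventually_const v i) [0..<n])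
     (wmap (sim S) (map (eventually_const v i) [n..<n + length v]) (fixp S i))"
    by (simp add: wmap_append)
  have "map (eventually_const v i) [n..<n + length v] \<in> words S"
    using \<open>\<And>k. eventually_const v i k \<in> letters S\<close> by (auto simp: words_def)
  then show "wmap (sim S) v (fixp S i) \<in> wmap (sim S) (map (eventually_const v i) [0..<n]) ` attr S"
    unfolding eq by (intro imageI simw_in_attr q)
qed

lemma postcrit_subset_attr: "postcrit S \<subseteq> attr S"
  by (auto simp: postcrit_def)

lemma finite_V0: "finite (V0 S)"
proof -
  let ?P = "\<lambda>v i. v \<in> words S \<and> i \<in> letters S \<and> fixp S i \<in> postcrit S \<and> wmap (sim S) v (fixp S i) \<in> postcrit S"
  have "\<exists>v i. ?P v i \<and> x = Gw S v (fixp S i)" if "x \<in> V0 S" for x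
    using that unfolding V0_def by blast
  then obtain v i where vi: "\<And>x. x \<in> V0 S \<Longrightarrow> ?P (v x) (i x) \<and> x = Gw S (v x) (fixp S (i x))" by metis
  let ?f = "\<lambda>x. eventually_const (v x) (i x)"
  have "?f ` V0 S \<subseteq> tails"
  proof
    fix \<tau> assume "\<tau> \<in> ?f ` V0 S"
    then obtain x where x: "x \<in> V0 S" "\<tau> = ?f x" by blast
    have P: "?P (v x) (i x)" using vi[OF x(1)] by blast
    then obtain w where w: "w \<in> words S" "w \<noteq> []" "wmap (sim S) w (wmap (sim S) (v x) (fixp S (i x))) \<in> crit S"
      unfolding postcrit_def by blast
    \<comment> \<open>Prepending a word that carries the point into the critical set exhibits the
      address as a proper tail of the address of a critical point.\<close>
    have "address S (eventually_const (w @ v x) (i x)) (wmap (sim S) (w @ v x) (fixp S (i x)))"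
      using P w(1) postcrit_subset_attr by (intro address_eventually_const) auto
    moreover have "wmap (sim S) (w @ v x) (fixp S (i x)) \<in> crit S" using w(3) by (simp add: wmap_append)
    moreover have "\<tau> = (\<lambda>k. eventually_const (w @ v x) (i x) (length w + k))"
      unfolding x(2) by (auto simp: eventually_const_def fun_eq_iff)
    moreover have "length w \<ge> 1" using w(2) by (cases w) auto
    ultimately show "\<tau> \<in> tails" unfolding tails_def by blast
  qed
  moreover have "inj_on ?f (V0 S)"
  proof (rule inj_onI)
    fix x y assume xy: "x \<in> V0 S" "y \<in> V0 S" "?f x = ?f y"
    obtain R where R: "0 \<le> R" "R < 1" "\<And>i x y. i \<in> letters S \<Longrightarrow> dist (G S i x) (G S i y) \<le> R * dist x y"
      using G_ratio by blast
    \<comment> \<open>Letters i appended to \<open>v z\<close> fix q_i, so the point lies in the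
      cell of K of every long enough prefix of its address.\<close>
    have cell: "z \<in> Gw S (map (?f z) [0..<n]) ` strK S" if z: "z \<in> V0 S" and n: "length (v z) \<le> n" for z n
    proof -
      have "z = Gw S (map (?f z) [0..<n]) (fixp S (i z))"
        using vi[OF z] n by (simp add: map_eventually_const wmap_append wmap_replicate_fixed G_fixp)
      then show ?thesis using fixp_in_K vi[OF z] by blast
    qed
    show "x = y"
    proof (rule eq_of_common_cells[OF R(3,1,2), where \<tau>="?f x" and A="strK S" and m="max (length (v x)) (length (v y))"])
      show "range (?f x) \<subseteq> letters S" using vi[OF xy(1)] by (auto simp: eventually_const_def words_def)
      show "bounded (strK S)" by (rule compact_imp_bounded[OF compact_K])
    qed (use cell[OF xy(1)] cell[OF xy(2)] xy(3) in auto)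
  qed
  ultimately show ?thesis using finite_tails by (intro inj_on_finite[of ?f "V0 S" tails])
qed

lemma V0_subset_K: "V0 S \<subseteq> strK S"
  unfolding V0_def using Gw_in_K fixp_in_K by auto

lemma postcrit_of_image:
  assumes "sim S j y \<in> crit S \<union> postcrit S" "j \<in> letters S" "y \<in> attr S"
  shows "y \<in> postcrit S"
  using assms(1)
proof
  assume "sim S j y \<in> crit S"
  then show ?thesis using assms(2,3) unfolding postcrit_def by (auto intro!: bexI[of _ "[j]"])
next
  assume "sim S j y \<in> postcrit S"
  then obtain w where "w \<in> words S" "w \<noteq> []" "wmap (sim S) w (sim S j y) \<in> crit S" unfolding postcrit_def by blast
  then show ?thesis using assms(2,3) unfolding postcrit_def by (auto simp: wmap_append intro!: bexI[of _ "w @ [j]"])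
qed

definition V1 :: "'a set" where
  "V1 = (\<Union>i\<in>letters S. G S i ` V0 S)"

text \<open>Deleting the first letter of a representation of a critical or post-critical point
  leaves a post-critical point. The inclusion of V_0 in V_1 and the position of the end points of
  segments both rest on this.\<close>

lemma V0_of_image:
  assumes "j # v \<in> words S" "i \<in> letters S" "fixp S i \<in> postcrit S"
    "wmap (sim S) (j # v) (fixp S i) \<in> crit S \<union> postcrit S"
  shows "Gw S v (fixp S i) \<in> V0 S"
proof -
  have "wmap (sim S) v (fixp S i) \<in> attr S"
    using assms postcrit_subset_attr by (intro simw_in_attr) auto
  then have "wmap (sim S) v (fixp S i) \<in> postcrit S"
    using assms by (intro postcrit_of_image[of j]) auto
  then show ?thesis unfolding V0_def using assms by auto
qed

lemma V0_subset_V1: "V0 S \<subseteq> V1"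
proof
  fix x assume "x \<in> V0 S"
  then obtain v i where vi: "v \<in> words S" "i \<in> letters S" "fixp S i \<in> postcrit S"
    "wmap (sim S) v (fixp S i) \<in> postcrit S" "x = Gw S v (fixp S i)" unfolding V0_def by blast
  show "x \<in> V1"
  proof (cases v)
    case Nil
    then have "x = G S i x" "x \<in> V0 S" using vi \<open>x \<in> V0 S\<close> by (auto simp: G_fixp)
    then show ?thesis unfolding V1_def using vi by blast
  next
    case (Cons j v')
    then have "Gw S v' (fixp S i) \<in> V0 S" using vi by (intro V0_of_image[of j]) auto
    then show ?thesis unfolding V1_def using vi Cons by auto
  qed
qed

text \<open>The first letter of w^{c,l} names a cell of K holding the end point and a cell of F
  holding c; this carries adjacency in F over to K.\<close>

lemma endp_in_cell:
  assumes "c \<in> crit S" "l \<in> {1..ncells S c}"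
  shows "endp S c l \<in> G S (hd (cword S c l)) ` V0 S" "hd (cword S c l) \<in> letters S"
    "c \<in> sim S (hd (cword S c l)) ` attr S"
proof -
  note cw = cword[OF assms]
  obtain j v where v: "cword S c l = j # v" using cw by (cases "cword S c l") auto
  obtain i where i: "i \<in> letters S" "cfix S c l = fixp S i" using cw by blast
  have jv: "j # v \<in> words S" using cw v by simp
  then show "hd (cword S c l) \<in> letters S" by (simp add: v)
  have "wmap (sim S) (j # v) (fixp S i) = c" using cw i v by simp
  then have "Gw S v (fixp S i) \<in> V0 S"
    using cw i jv assms(1) by (intro V0_of_image[OF jv i(1)]) auto
  then show "endp S c l \<in> G S (hd (cword S c l)) ` V0 S" unfolding endp_def i v by auto
  have "wmap (sim S) v (fixp S i) \<in> attr S" using cw i jv postcrit_subset_attr by (intro simw_in_attr) auto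
  then show "c \<in> sim S (hd (cword S c l)) ` attr S" using \<open>wmap (sim S) (j # v) (fixp S i) = c\<close> v by auto
qed

lemma finite_V1: "finite V1"
  unfolding V1_def using finite_V0 by auto

lemma endp_in_V1: "c \<in> crit S \<Longrightarrow> l \<in> {1..ncells S c} \<Longrightarrow> endp S c l \<in> V1"
  unfolding V1_def by (rule UN_I[of "hd (cword S c l)"]) (rule endp_in_cell; assumption)+

text \<open>The words at c have as many distinct first letters as there are cells of F containing c,
  and each first letter names such a cell; by counting, all cells occur.\<close>

lemma cells_at_crit:
  assumes "c \<in> crit S" "i \<in> letters S" "c \<in> sim S i ` attr S"
  obtains l where "l \<in> {1..ncells S c}" "hd (cword S c l) = i"
proof -
  let ?h = "\<lambda>l. hd (cword S c l)" and ?I = "{i \<in> letters S. c \<in> sim S i ` attr S}"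
  have "?h ` {1..ncells S c} \<subseteq> ?I" using endp_in_cell(2,3)[OF assms(1)] by (intro image_subsetI) simp
  moreover have "card (?h ` {1..ncells S c}) = card ?I"
    using card_image[OF inj_cword[OF assms(1)]] by (simp add: ncells_def)
  ultimately have "?h ` {1..ncells S c} = ?I" by (intro card_subset_eq) auto
  moreover have "i \<in> ?I" using assms by simp
  ultimately show ?thesis using that by (metis (no_types, lifting) imageE)
qed

section \<open>Connectedness of the cell structure\<close>

definition adjacent :: "(nat \<times> nat) set" where
  "adjacent = {(i, j). i \<in> letters S \<and> j \<in> letters S \<and> i \<noteq> j \<and> sim S i ` attr S \<inter> sim S j ` attr S \<noteq> {}}"

text \<open>Otherwise the cells reachable from i and the remaining cells would split F into two
  disjoint nonempty closed sets.\<close>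

lemma adjacent_connected:
  assumes "i \<in> letters S" "j \<in> letters S" shows "(i, j) \<in> adjacent\<^sup>*"
proof (rule ccontr)
  assume "(i, j) \<notin> adjacent\<^sup>*"
  define R where "R = {k \<in> letters S. (i, k) \<in> adjacent\<^sup>*}"
  define U where "U I = (\<Union>k\<in>I. sim S k ` attr S)" for I
  have cont: "continuous_on (attr S) (sim S k)" if k: "k \<in> letters S" for k
  proof -
    obtain r where "0 < r" "\<And>x y. dist (sim S k x) (sim S k y) = r * dist x y"
      using sim_similitude[OF k] unfolding contracting_similitude_def by blast
    then show ?thesis by (intro lipschitz_on_continuous_on[of r] lipschitz_onI) auto
  qed
  have closed: "closed (U I)" if "I \<subseteq> letters S" for I
    unfolding U_def using that finite_subset[OF that]
    by (intro closed_UN ballI compact_imp_closed compact_continuous_image cont compact_attr) auto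
  have "U R \<inter> U (letters S - R) = {}"
  proof (rule ccontr)
    assume "U R \<inter> U (letters S - R) \<noteq> {}"
    then obtain k m where km: "k \<in> R" "m \<in> letters S" "m \<notin> R" "sim S k ` attr S \<inter> sim S m ` attr S \<noteq> {}"
      unfolding U_def by blast
    then have "(k, m) \<in> adjacent" unfolding adjacent_def R_def by auto
    then have "m \<in> R" using km unfolding R_def by (auto intro: rtrancl_into_rtrancl)
    then show False using km by blast
  qed
  moreover have "attr S \<subseteq> U R \<union> U (letters S - R)"
    by (subst attr_eq) (auto simp: U_def R_def)
  moreover have "closed (U R)" "closed (U (letters S - R))" by (auto intro!: closed simp: R_def)
  ultimately have "U R \<inter> attr S = {} \<or> U (letters S - R) \<inter> attr S = {}"
    by (intro connected_closedD[OF connected_attr]) auto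
  moreover have "U R \<inter> attr S \<noteq> {}"
  proof -
    have "i \<in> R" using assms by (simp add: R_def)
    then have "sim S i ` attr S \<subseteq> U R \<inter> attr S" using cell_subset_attr assms unfolding U_def by blast
    then show ?thesis using attr_ne by auto
  qed
  moreover have "U (letters S - R) \<inter> attr S \<noteq> {}"
  proof -
    have "j \<in> letters S - R" using assms \<open>(i, j) \<notin> adjacent\<^sup>*\<close> by (simp add: R_def)
    then have "sim S j ` attr S \<subseteq> U (letters S - R) \<inter> attr S" using cell_subset_attr assms unfolding U_def by blast
    then show ?thesis using attr_ne by auto
  qed
  ultimately show False by blast
qed

lemma crit_of_adjacent:
  assumes "(i, j) \<in> adjacent"
  obtains c l m where "c \<in> crit S" "l \<in> {1..ncells S c}" "m \<in> {1..ncells S c}"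
    "hd (cword S c l) = i" "hd (cword S c m) = j"
proof -
  obtain c where c: "c \<in> sim S i ` attr S" "c \<in> sim S j ` attr S" and ij: "i \<in> letters S" "j \<in> letters S" "i \<noteq> j"
    using assms unfolding adjacent_def by blast
  have "c \<in> crit S" unfolding crit_def using c ij by blast
  with cells_at_crit c ij that show ?thesis by metis
qed

text \<open>As N \<ge> 2, the letters 1 and 2 are joined by a chain of adjacent cells, which yields
  a critical point. V_0 and \<open>segs\<close> are therefore nonempty.\<close>

lemma obtain_seg:
  obtains c l where "c \<in> crit S" "l \<in> {1..ncells S c}"
proof -
  have "1 \<in> letters S" "2 \<in> letters S" using num_ge_2 by (auto simp: letters_def)
  then have "(1, 2) \<in> adjacent\<^sup>*" by (rule adjacent_connected)
  then obtain j where "(1, j) \<in> adjacent" by (metis converse_rtranclE numeral_eq_one_iff semiring_norm(85))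
  then show ?thesis using crit_of_adjacent that by metis
qed

lemma V0_ne: "V0 S \<noteq> {}"
  using obtain_seg endp_in_cell(1) by blast

section \<open>Cells and segments of K\<close>

definition segs :: "'a set" where
  "segs = (\<Union>c\<in>crit S. \<Union>l\<in>{1..ncells S c}. seg S c l)"

lemma K_cases:
  assumes "x \<in> strK S"
  obtains i z where "i \<in> letters S" "z \<in> strK S" "x = G S i z" | "x \<in> segs"
proof -
  have "x \<in> (\<Union>i\<in>letters S. G S i ` strK S) \<union> segs"
    using assms by (subst (asm) K_eq) (simp add: segs_def)
  then show ?thesis using that by blast
qed

lemma K_cell_decomposition:
  assumes "x \<in> strK S"
  shows "(\<exists>w\<in>words_n S n. x \<in> Gw S w ` strK S) \<or> (\<exists>w\<in>words S. x \<in> Gw S w ` segs)"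
proof (induction n)
  case 0
  then show ?case using assms by simp
next
  case (Suc n)
  then show ?case
  proof
    assume "\<exists>w\<in>words_n S n. x \<in> Gw S w ` strK S"
    then obtain w y where w: "w \<in> words_n S n" "y \<in> strK S" "x = Gw S w y" by blast
    have wS: "w \<in> words S" using w by (simp add: words_n_def)
    from w(2) show ?thesis
    proof (cases rule: K_cases)
      case (1 i z)
      then have "x = Gw S (w @ [i]) z" "w @ [i] \<in> words_n S (Suc n)" using w by (auto simp: wmap_append words_n_def)
      then show ?thesis using 1 by blast
    qed (use w wS in blast)
  qed blast
qed

lemma segs_subset_K: "segs \<subseteq> strK S"
  unfolding segs_def using seg_subset_K by blast

text \<open>A point lies on a copy of a segment or in a cell of level n. In the latter case the cell
  contains a copy of \<open>segs\<close>, and its diameter is small for large n.\<close>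

lemma segs_dense:
  assumes "x \<in> strK S" "e > 0"
  obtains w y where "w \<in> words S" "y \<in> segs" "dist x (Gw S w y) < e"
proof -
  obtain R where R: "0 \<le> R" "R < 1" "\<And>i x y. i \<in> letters S \<Longrightarrow> dist (G S i x) (G S i y) \<le> R * dist x y"
    using G_ratio by blast
  obtain B where B: "\<And>a b. a \<in> strK S \<Longrightarrow> b \<in> strK S \<Longrightarrow> dist a b \<le> B"
    using compact_imp_bounded[OF compact_K] by (meson bounded_two_points)
  have "(\<lambda>n. R ^ n * B) \<longlonglongrightarrow> 0 * B" using R by (intro tendsto_intros LIMSEQ_realpow_zero)
  then have "\<forall>\<^sub>F n in sequentially. R ^ n * B < e" using assms(2) by (intro order_tendstoD) auto
  then obtain n where n: "R ^ n * B < e" by (auto simp: eventually_sequentially)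
  obtain c l where "c \<in> crit S" "l \<in> {1..ncells S c}" using obtain_seg by blast
  then have "endp S c l \<in> segs" unfolding segs_def seg_def by blast
  then obtain y where y: "y \<in> segs" by blast
  from K_cell_decomposition[OF assms(1), of n] show ?thesis
  proof
    assume "\<exists>w\<in>words_n S n. x \<in> Gw S w ` strK S"
    then obtain w z where w: "w \<in> words_n S n" "z \<in> strK S" "x = Gw S w z" by blast
    then have "dist x (Gw S w y) \<le> R ^ length w * dist z y"
      unfolding w(3) by (intro wmap_dist_le[OF R(3,1)]) (auto simp: words_n_def words_def)
    also have "\<dots> \<le> R ^ n * B"
      using B[OF w(2)] y segs_subset_K w(1) R(1) by (auto simp: words_n_def intro!: mult_left_mono)
    finally show ?thesis using that[of w y] w(1) y n by (auto simp: words_n_def)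
  qed (use that assms(2) in force)
qed

lemma cells_disjoint:
  assumes "w \<in> words S" "v \<in> words S" "length w = length v" "w \<noteq> v"
  shows "Gw S w ` strK S \<inter> Gw S v ` strK S = {}"
  using assms
proof (induction w arbitrary: v)
  case (Cons i w)
  then obtain j v' where v: "v = j # v'" by (cases v) auto
  show ?case
  proof (cases "i = j")
    case False
    have "Gw S (i # w) ` strK S \<subseteq> G S i ` strK S" "Gw S v ` strK S \<subseteq> G S j ` strK S"
      using Cons.prems v Gw_in_K by auto
    then show ?thesis using G_disjoint[of i j] Cons.prems v False by auto
  next
    case True
    then have "Gw S w ` strK S \<inter> Gw S v' ` strK S = {}" using Cons v by auto
    moreover have "G S j a = G S j b \<longleftrightarrow> a = b" for a b
      using inj_G[of j] Cons.prems v by (simp add: inj_eq)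
    ultimately show ?thesis unfolding v True by auto
  qed
qed auto

section \<open>Oscillation over the first-level graph\<close>

text \<open>To be used with \<open>h\<close> a composition of u with G_w: \<open>T\<close> bounds
  the differences that the energy controls directly, inside subcells and along segments.\<close>

definition small_oscillation :: "('a \<Rightarrow> real) \<Rightarrow> real \<Rightarrow> bool" where
  "small_oscillation h T \<longleftrightarrow> 0 \<le> T \<and>
     (\<forall>i\<in>letters S. \<forall>x\<in>V0 S. \<forall>y\<in>V0 S. \<bar>h (G S i x) - h (G S i y)\<bar> \<le> T) \<and>
     (\<forall>c\<in>crit S. \<forall>l\<in>{1..ncells S c}. \<forall>x\<in>seg S c l. \<bar>h x - h (endp S c l)\<bar> \<le> T)"

text \<open>The factor \<open>A\<close> depends on the two points and not on \<open>h\<close> or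
  \<open>T\<close>, so points can be linked by chains without tracking the length of the
  chain.\<close>

definition comparable :: "'a \<Rightarrow> 'a \<Rightarrow> bool" where
  "comparable x y \<longleftrightarrow> (\<exists>A\<ge>0. \<forall>h T. small_oscillation h T \<longrightarrow> \<bar>h x - h y\<bar> \<le> A * T)"

lemma comparableI: "(\<And>h T. small_oscillation h T \<Longrightarrow> \<bar>h x - h y\<bar> \<le> T) \<Longrightarrow> comparable x y"
  unfolding comparable_def by (intro exI[of _ 1]) auto

lemma comparable_sym: "comparable x y \<Longrightarrow> comparable y x"
  unfolding comparable_def by (simp add: abs_minus_commute)

lemma comparable_trans:
  assumes "comparable x y" "comparable y z" shows "comparable x z"
proof -
  obtain A B where "A \<ge> 0" "B \<ge> 0" and AB: "\<And>h T. small_oscillation h T \<Longrightarrow> \<bar>h x - h y\<bar> \<le> A * T"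
    "\<And>h T. small_oscillation h T \<Longrightarrow> \<bar>h y - h z\<bar> \<le> B * T"
    using assms unfolding comparable_def by blast
  have "\<bar>h x - h z\<bar> \<le> (A + B) * T" if "small_oscillation h T" for h T
    using AB(1)[OF that] AB(2)[OF that] by (simp add: distrib_right)
  then show ?thesis unfolding comparable_def using \<open>A \<ge> 0\<close> \<open>B \<ge> 0\<close> by (intro exI[of _ "A + B"]) auto
qed

lemma comparable_cell:
  assumes "i \<in> letters S" "x \<in> G S i ` V0 S" "y \<in> G S i ` V0 S" shows "comparable x y"
  using assms by (intro comparableI) (auto simp: small_oscillation_def)

text \<open>Each step of a chain of adjacent cells passes from one end point along a segment to the
  common critical point, and along another segment to an end point in the next cell.\<close>

lemma comparable_V1:
  assumes "x \<in> V1" "y \<in> V1" shows "comparable x y"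
proof -
  obtain i j where ij: "i \<in> letters S" "x \<in> G S i ` V0 S" "j \<in> letters S" "y \<in> G S j ` V0 S"
    using assms unfolding V1_def by blast
  from adjacent_connected[OF ij(1,3)] ij(4) show ?thesis
  proof (induction arbitrary: y rule: rtrancl_induct)
    case base
    then show ?case using comparable_cell ij by blast
  next
    case (step k m)
    obtain c l p where c: "c \<in> crit S" "l \<in> {1..ncells S c}" "p \<in> {1..ncells S c}"
      "hd (cword S c l) = k" "hd (cword S c p) = m" using crit_of_adjacent[OF step(2)] by blast
    have end_c: "comparable c (endp S c l')" if "l' \<in> {1..ncells S c}" for l'
      using c(1) that by (intro comparableI) (auto simp: small_oscillation_def seg_def)
    have "comparable x (endp S c l)" using step.IH endp_in_cell(1)[OF c(1,2)] c(4) by simp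
    moreover have "comparable (endp S c l) c" using comparable_sym end_c c by blast
    moreover have "comparable c (endp S c p)" using end_c c by blast
    moreover have "comparable (endp S c p) y"
      using comparable_cell[of m] endp_in_cell[OF c(1,3)] c(5) step.prems by simp
    ultimately show ?case by (meson comparable_trans)
  qed
qed

text \<open>V_1 is finite, so the sum of all pairwise constants is uniform. A point of a segment is
  within \<open>T\<close> of an end point in V_1; two such corrections account for the added
  2.\<close>

lemma oscillation_bound:
  obtains A where "A \<ge> 0" "\<And>h T x y. small_oscillation h T \<Longrightarrow> x \<in> V1 \<union> segs \<Longrightarrow> y \<in> V1 \<union> segs \<Longrightarrow> \<bar>h x - h y\<bar> \<le> A * T"
proof -
  have "\<exists>A. A \<ge> 0 \<and> (\<forall>h T. small_oscillation h T \<longrightarrow> \<bar>h (fst p) - h (snd p)\<bar> \<le> A * T)" if "p \<in> V1 \<times> V1" for p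
    using comparable_V1[of "fst p" "snd p"] that unfolding comparable_def by auto
  then obtain B where B: "\<And>p. p \<in> V1 \<times> V1 \<Longrightarrow> B p \<ge> 0 \<and> (\<forall>h T. small_oscillation h T \<longrightarrow> \<bar>h (fst p) - h (snd p)\<bar> \<le> B p * T)"
    by metis
  define A where "A = (\<Sum>p\<in>V1 \<times> V1. B p)"
  have A: "A \<ge> 0" unfolding A_def using B by (intro sum_nonneg) blast
  have V: "\<bar>h x - h y\<bar> \<le> A * T" if h: "small_oscillation h T" and xy: "x \<in> V1" "y \<in> V1" for h T x y
  proof -
    have "B (x, y) \<le> A" unfolding A_def using finite_V1 xy B by (intro member_le_sum) auto
    moreover have "T \<ge> 0" using h by (simp add: small_oscillation_def)
    ultimately have "B (x, y) * T \<le> A * T" by (rule mult_right_mono)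
    moreover have "\<bar>h x - h y\<bar> \<le> B (x, y) * T" using B[of "(x, y)"] xy h by auto
    ultimately show ?thesis by linarith
  qed
  have near: "\<exists>y\<in>V1. \<forall>h T. small_oscillation h T \<longrightarrow> \<bar>h x - h y\<bar> \<le> T" if "x \<in> V1 \<union> segs" for x
    using that
  proof
    assume "x \<in> V1"
    then show ?thesis by (intro bexI[of _ x]) (auto simp: small_oscillation_def)
  next
    assume "x \<in> segs"
    then obtain c l where "c \<in> crit S" "l \<in> {1..ncells S c}" "x \<in> seg S c l" unfolding segs_def by blast
    then show ?thesis using endp_in_V1 by (intro bexI[of _ "endp S c l"]) (auto simp: small_oscillation_def)
  qed
  have "\<bar>h x - h y\<bar> \<le> (A + 2) * T" if h: "small_oscillation h T" and xy: "x \<in> V1 \<union> segs" "y \<in> V1 \<union> segs" for h T x y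
  proof -
    obtain x' y' where "x' \<in> V1" "y' \<in> V1" "\<bar>h x - h x'\<bar> \<le> T" "\<bar>h y - h y'\<bar> \<le> T"
      using near[OF xy(1)] near[OF xy(2)] h by blast
    then show ?thesis using V[OF h, of x' y'] by (simp add: algebra_simps)
  qed
  then show ?thesis using A by (intro that[of "A + 2"]) auto
qed

end

section \<open>The energy as a limit of difference forms\<close>

lemma dyadic_energy_0: "dyadic_energy 0 h = (h 1 - h 0)\<^sup>2"
  by (simp add: dyadic_energy_def)

lemma dyadic_energy_nonneg: "0 \<le> dyadic_energy k h"
  by (simp add: dyadic_energy_def sum_nonneg)

lemma dyadic_energy_lipschitz:
  assumes "\<And>s t. s \<in> {0..1} \<Longrightarrow> t \<in> {0..1} \<Longrightarrow> \<bar>h s - h t\<bar> \<le> L * \<bar>s - t\<bar>"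
  shows "dyadic_energy k h \<le> L\<^sup>2"
proof -
  have "(h (real (Suc j) / 2 ^ k) - h (real j / 2 ^ k))\<^sup>2 \<le> (L / 2 ^ k)\<^sup>2" if j: "j < 2 ^ k" for j
  proof -
    have "real (Suc j) \<le> 2 ^ k" using j by (metis Suc_leI of_nat_le_iff of_nat_numeral of_nat_power)
    then have "real (Suc j) / 2 ^ k \<in> {0..1}" "real j / 2 ^ k \<in> {0..1}" using j by (auto simp: divide_simps)
    from assms[OF this] have "\<bar>h (real (Suc j) / 2 ^ k) - h (real j / 2 ^ k)\<bar> \<le> L * \<bar>real (Suc j) / 2 ^ k - real j / 2 ^ k\<bar>" .
    also have "real (Suc j) / 2 ^ k - real j / 2 ^ k = 1 / 2 ^ k" by (simp add: diff_divide_distrib[symmetric])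
    finally have "\<bar>h (real (Suc j) / 2 ^ k) - h (real j / 2 ^ k)\<bar> \<le> L / 2 ^ k" by simp
    from power_mono[OF this abs_ge_zero, of 2] show ?thesis by simp
  qed
  then have "dyadic_energy k h \<le> 2 ^ k * (\<Sum>j<(2::nat) ^ k. (L / 2 ^ k)\<^sup>2)"
    unfolding dyadic_energy_def by (intro mult_left_mono sum_mono) auto
  also have "\<dots> = L\<^sup>2" by (simp add: power2_eq_square)
  finally show ?thesis .
qed

lemma \<xi>_0 [simp]: "\<xi> x y 0 = y" and \<xi>_1 [simp]: "\<xi> x y 1 = x"
  by (simp_all add: \<xi>_def)

lemma continuous_on_\<xi>: "continuous_on A (\<xi> x y)" for x :: "'a::real_normed_vector"
  unfolding \<xi>_def[abs_def] by (intro continuous_intros)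

lemma dist_\<xi>: "dist (\<xi> x y s) (\<xi> x y t) = \<bar>s - t\<bar> * dist x y" for x :: "'a::real_normed_vector"
proof -
  have "\<xi> x y s - \<xi> x y t = (s - t) *\<^sub>R (x - y)" by (simp add: \<xi>_def algebra_simps)
  then show ?thesis by (simp add: dist_norm)
qed

locale harmonic_stretched = stretched S for S :: "'a::euclidean_space stretched" +
  fixes r0 :: "'a set \<Rightarrow> ereal" and lam :: "nat \<Rightarrow> real" and rho :: "nat \<Rightarrow> 'a \<Rightarrow> nat \<Rightarrow> real"
  assumes regular: "regular_harmonic_sequence S r0 lam rho"
begin

abbreviation form_domain :: "('a \<Rightarrow> real) set"
  where "form_domain \<equiv> energy_dom S r0 lam rho"

abbreviation form_energy :: "('a \<Rightarrow> real) \<Rightarrow> real"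
  where "form_energy \<equiv> energy_q S r0 lam rho"

lemma harmonic: "i \<ge> 1 \<Longrightarrow> harmonic_structure S r0 (lam i) (rho i)"
  using regular unfolding regular_harmonic_sequence_def harmonic_sequence_def by blast

lemma r0_pos: "x \<in> V0 S \<Longrightarrow> y \<in> V0 S \<Longrightarrow> x \<noteq> y \<Longrightarrow> 0 < r0 {x, y}"
  and r0_connected: "x \<in> V0 S \<Longrightarrow> y \<in> V0 S \<Longrightarrow>
      (x, y) \<in> {(a, b). a \<in> V0 S \<and> b \<in> V0 S \<and> a \<noteq> b \<and> r0 {a, b} < \<infinity>}\<^sup>*"
  using harmonic[of 1] unfolding harmonic_structure_def by blast+

lemma lam_pos: "i \<ge> 1 \<Longrightarrow> 0 < lam i"
  and rho_pos: "i \<ge> 1 \<Longrightarrow> c \<in> crit S \<Longrightarrow> l \<in> {1..ncells S c} \<Longrightarrow> 0 < rho i c l"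
  using harmonic[of i] unfolding harmonic_structure_def by blast+

lemma prod_lam_pos: "(\<And>i. i \<in> I \<Longrightarrow> i \<ge> 1) \<Longrightarrow> 0 < (\<Prod>i\<in>I. lam i)"
  by (intro prod_pos) (auto intro: lam_pos)

lemma conductance_nonneg: "x \<in> V0 S \<Longrightarrow> y \<in> V0 S - {x} \<Longrightarrow> 0 \<le> real_of_ereal (1 / r0 {x, y})"
  using r0_pos[of x y] by (cases "r0 {x, y}") (auto simp: one_ereal_def)

lemma Q0_form: "difference_form (V0 S) (Q0 S r0)"
proof -
  have "difference_form (V0 S) (\<lambda>g. 1 / 2 * (\<Sum>x\<in>V0 S. \<Sum>y\<in>V0 S - {x}. real_of_ereal (1 / r0 {x, y}) * (g x - g y)\<^sup>2))"
    by (intro difference_form_single difference_form_cmult difference_form_sum conductance_nonneg) auto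
  then show ?thesis by (simp add: Q0_def[abs_def] mult.commute)
qed

lemma Q0_nonneg: "0 \<le> Q0 S r0 g"
  by (rule difference_form_nonneg[OF Q0_form])

section \<open>Energies on the finite graphs\<close>

text \<open>\<open>f\<close> is a competitor in the infimum of the compatibility condition.
  Nonnegativity of \<open>Q1\<close> supplies the lower bound that a real infimum requires.\<close>

lemma Q0_le_Q1:
  assumes "i \<ge> 1" shows "Q0 S r0 f \<le> Q1 S r0 (lam i) (rho i) f"
proof -
  have nn: "0 \<le> Q1 S r0 (lam i) (rho i) f" for f
    unfolding Q1_def using lam_pos[OF assms] rho_pos[OF assms] Q0_nonneg
    by (intro add_nonneg_nonneg mult_nonneg_nonneg sum_nonneg divide_nonneg_pos) (auto intro: less_imp_le)
  have "Q0 S r0 f = (INF h\<in>{h. \<forall>x\<in>V0 S. h x = f x}. Q1 S r0 (lam i) (rho i) h)"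
    using harmonic[OF assms] unfolding harmonic_structure_def by simp
  also have "\<dots> \<le> Q1 S r0 (lam i) (rho i) f"
    by (rule cINF_lower) (auto intro: bdd_belowI2[of _ 0] nn)
  finally show ?thesis .
qed

text \<open>An edge of finite resistance has positive conductance and so bounds its own difference.
  Paths are handled by (a + b)^2 \<le> 2 a^2 + 2 b^2, and finiteness of V_0 gives one constant for
  all pairs.\<close>

lemma Q0_controls_oscillation:
  obtains C where "C \<ge> 0" "\<And>g x y. x \<in> V0 S \<Longrightarrow> y \<in> V0 S \<Longrightarrow> (g x - g y)\<^sup>2 \<le> C * Q0 S r0 g"
proof -
  let ?E = "{(a, b). a \<in> V0 S \<and> b \<in> V0 S \<and> a \<noteq> b \<and> r0 {a, b} < \<infinity>}"
  have edge: "\<exists>C\<ge>0. \<forall>g. (g a - g b)\<^sup>2 \<le> C * Q0 S r0 g" if "(a, b) \<in> ?E" for a b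
  proof -
    have ab: "a \<in> V0 S" "b \<in> V0 S" "a \<noteq> b" "r0 {a, b} < \<infinity>" using that by auto
    define w where "w x y = real_of_ereal (1 / r0 {x, y})" for x y
    have w: "w a b > 0"
      using r0_pos[OF ab(1-3)] ab(4) by (cases "r0 {a, b}") (auto simp: w_def one_ereal_def)
    \<comment> \<open>The factor 2 undoes the halving in \<open>Q0\<close>; one of the two
      orientations of the edge suffices.\<close>
    have "(g a - g b)\<^sup>2 * w a b \<le> 2 * Q0 S r0 g" for g
    proof -
      have "(g a - g b)\<^sup>2 * w a b \<le> (\<Sum>y\<in>V0 S - {a}. (g a - g y)\<^sup>2 * w a y)"
        using ab finite_V0 conductance_nonneg by (intro member_le_sum) (auto simp: w_def)
      also have "\<dots> \<le> (\<Sum>x\<in>V0 S. \<Sum>y\<in>V0 S - {x}. (g x - g y)\<^sup>2 * w x y)"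
        using ab finite_V0 conductance_nonneg
        by (intro member_le_sum[of a "V0 S" "\<lambda>x. \<Sum>y\<in>V0 S - {x}. (g x - g y)\<^sup>2 * w x y"])
          (auto simp: w_def intro!: sum_nonneg mult_nonneg_nonneg conductance_nonneg)
      also have "\<dots> = 2 * Q0 S r0 g" by (simp add: Q0_def w_def)
      finally show ?thesis .
    qed
    then have "(g a - g b)\<^sup>2 \<le> 2 / w a b * Q0 S r0 g" for g
      using w by (simp add: field_simps)
    then show ?thesis using w by (intro exI[of _ "2 / w a b"]) auto
  qed
  have path: "\<exists>C\<ge>0. \<forall>g. (g a - g b)\<^sup>2 \<le> C * Q0 S r0 g" if "(a, b) \<in> ?E\<^sup>*" for a b
    using that
  proof (induction rule: rtrancl_induct)
    case (step b c)
    from step.IH edge[OF step(2)] obtain C D where CD: "C \<ge> 0" "D \<ge> 0" "\<And>g. (g a - g b)\<^sup>2 \<le> C * Q0 S r0 g"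
      "\<And>g. (g b - g c)\<^sup>2 \<le> D * Q0 S r0 g" by blast
    have "(g a - g c)\<^sup>2 \<le> (2 * C + 2 * D) * Q0 S r0 g" for g
    proof -
      have "(g a - g c)\<^sup>2 \<le> 2 * (g a - g b)\<^sup>2 + 2 * (g b - g c)\<^sup>2"
        using zero_le_power2[of "(g a - g b) - (g b - g c)"] by (simp add: power2_eq_square algebra_simps)
      then show ?thesis using CD(3)[of g] CD(4)[of g] by (simp add: algebra_simps)
    qed
    then show ?case using CD by (intro exI[of _ "2 * C + 2 * D"]) auto
  qed (auto intro: exI[of _ 0])
  have "\<exists>C. C \<ge> 0 \<and> (\<forall>g. (g (fst p) - g (snd p))\<^sup>2 \<le> C * Q0 S r0 g)" if "p \<in> V0 S \<times> V0 S" for p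
    using path[OF r0_connected, of "fst p" "snd p"] that by auto
  then obtain B where B: "\<And>p. p \<in> V0 S \<times> V0 S \<Longrightarrow> B p \<ge> 0 \<and> (\<forall>g. (g (fst p) - g (snd p))\<^sup>2 \<le> B p * Q0 S r0 g)"
    by metis
  define C where "C = (\<Sum>p\<in>V0 S \<times> V0 S. B p)"
  have "(g x - g y)\<^sup>2 \<le> C * Q0 S r0 g" if "x \<in> V0 S" "y \<in> V0 S" for g x y
  proof -
    have "(g x - g y)\<^sup>2 \<le> B (x, y) * Q0 S r0 g" using B[of "(x, y)"] that by auto
    also have "\<dots> \<le> C * Q0 S r0 g"
      unfolding C_def using that finite_V0 B by (intro mult_right_mono member_le_sum Q0_nonneg) auto
    finally show ?thesis .
  qed
  moreover have "C \<ge> 0" unfolding C_def using B by (intro sum_nonneg) blast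
  ultimately show ?thesis using that by blast
qed

section \<open>The discrete energies and their limit\<close>

definition seg_energy :: "nat \<Rightarrow> nat \<Rightarrow> ('a \<Rightarrow> real) \<Rightarrow> real" where
  "seg_energy j k h = (\<Sum>c\<in>crit S. \<Sum>l\<in>{1..ncells S c}. 1 / rho j c l * dyadic_energy k (h \<circ> \<xi> c (endp S c l)))"

text \<open>\<open>energy_n\<close> with every Dirichlet integral replaced by the dyadic energy of
  level \<open>k\<close>. The two levels are kept separate to prove monotonicity in each.\<close>

definition discrete_energy :: "nat \<Rightarrow> nat \<Rightarrow> ('a \<Rightarrow> real) \<Rightarrow> real" where
  "discrete_energy n k u =
     1 / (\<Prod>i=1..n. lam i) * (\<Sum>w\<in>words_n S n. Q0 S r0 (u \<circ> Gw S w)) +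
     (\<Sum>j=1..n. 1 / (\<Prod>i\<in>{1..<j}. lam i) * (\<Sum>w\<in>words_n S (j - 1). seg_energy j k (u \<circ> Gw S w)))"

lemma \<xi>_image_K:
  assumes "c \<in> crit S" "l \<in> {1..ncells S c}" "w \<in> words S"
  shows "(Gw S w \<circ> \<xi> c (endp S c l)) ` {0..1} \<subseteq> strK S"
  using assms Gw_in_K xi_in_seg seg_subset_K by fastforce

lemma seg_energy_form:
  assumes "j \<ge> 1" "w \<in> words S"
  shows "difference_form (strK S) (\<lambda>u. seg_energy j k (u \<circ> Gw S w))"
  unfolding seg_energy_def comp_assoc
proof (intro difference_form_sum difference_form_cmult)
  fix c l assume "c \<in> crit S" "l \<in> {1..ncells S c}"
  then show "difference_form (strK S) (\<lambda>u. dyadic_energy k (u \<circ> (Gw S w \<circ> \<xi> c (endp S c l))))"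
    using assms by (intro difference_form_compose[OF difference_form_dyadic_energy] \<xi>_image_K)
  show "0 \<le> 1 / rho j c l" using rho_pos[OF assms(1) \<open>c \<in> crit S\<close> \<open>l \<in> {1..ncells S c}\<close>] by simp
qed

lemma discrete_energy_form: "difference_form (strK S) (discrete_energy n k)"
proof -
  have "difference_form (strK S) (\<lambda>u. Q0 S r0 (u \<circ> Gw S w))" if "w \<in> words S" for w
    using that V0_subset_K Gw_in_K by (intro difference_form_compose[OF Q0_form]) auto
  then show ?thesis
    unfolding discrete_energy_def[abs_def]
    by (intro difference_form_add difference_form_cmult difference_form_sum seg_energy_form)
      (auto simp: words_n_def intro!: prod_nonneg less_imp_le[OF lam_pos])
qed

lemma seg_energy_mono: "j \<ge> 1 \<Longrightarrow> k \<le> m \<Longrightarrow> seg_energy j k h \<le> seg_energy j m h"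
  unfolding seg_energy_def
  by (intro sum_mono mult_left_mono dyadic_energy_mono) (auto intro: less_imp_le[OF rho_pos])

lemma seg_energy_nonneg: "j \<ge> 1 \<Longrightarrow> 0 \<le> seg_energy j k h"
  unfolding seg_energy_def
  by (intro sum_nonneg mult_nonneg_nonneg dyadic_energy_nonneg) (auto intro: less_imp_le[OF rho_pos])

lemma discrete_energy_mono_k:
  assumes "k \<le> m" shows "discrete_energy n k u \<le> discrete_energy n m u"
  unfolding discrete_energy_def
  by (intro add_left_mono sum_mono mult_left_mono seg_energy_mono assms)
    (auto intro!: prod_nonneg less_imp_le[OF lam_pos])

text \<open>Compatibility, with each edge term read as a dyadic energy of level 0 and then increased
  to level \<open>k\<close>.\<close>

lemma Q0_le_next_level:
  assumes "j \<ge> 1"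
  shows "Q0 S r0 h \<le> 1 / lam j * (\<Sum>i\<in>letters S. Q0 S r0 (h \<circ> G S i)) + seg_energy j k h"
proof -
  have "(\<Sum>c\<in>crit S. \<Sum>l\<in>{1..ncells S c}. (h c - h (endp S c l))\<^sup>2 / rho j c l) \<le> seg_energy j k h"
    unfolding seg_energy_def
  proof (intro sum_mono)
    fix c l assume cl: "c \<in> crit S" "l \<in> {1..ncells S c}"
    have "1 / rho j c l * dyadic_energy 0 (h \<circ> \<xi> c (endp S c l)) \<le> 1 / rho j c l * dyadic_energy k (h \<circ> \<xi> c (endp S c l))"
      using rho_pos[OF assms cl] by (intro mult_left_mono dyadic_energy_mono) auto
    then show "(h c - h (endp S c l))\<^sup>2 / rho j c l \<le> 1 / rho j c l * dyadic_energy k (h \<circ> \<xi> c (endp S c l))"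
      by (simp add: dyadic_energy_0)
  qed
  then show ?thesis using Q0_le_Q1[OF assms, of h] by (simp add: Q1_def)
qed

text \<open>\<open>Q0_le_next_level\<close> with the structure of index n + 1 is applied in every
  cell of level n. The segment terms this produces have weight 1/\<delta>_n, which is exactly the
  weight of the summand j = n + 1, because \<gamma>_{n+1} = \<delta>_n.\<close>

lemma discrete_energy_mono_Suc: "discrete_energy n k u \<le> discrete_energy (Suc n) k u"
proof -
  let ?R = "\<Sum>j=1..n. 1 / (\<Prod>i\<in>{1..<j}. lam i) * (\<Sum>w\<in>words_n S (j - 1). seg_energy j k (u \<circ> Gw S w))"
  define \<delta> where "\<delta> = (\<Prod>i=1..n. lam i)"
  have \<delta>: "\<delta> > 0" unfolding \<delta>_def by (rule prod_lam_pos) simp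
  have "(\<Sum>w\<in>words_n S n. Q0 S r0 (u \<circ> Gw S w)) \<le>
     (\<Sum>w\<in>words_n S n. 1 / lam (Suc n) * (\<Sum>i\<in>letters S. Q0 S r0 (u \<circ> Gw S (w @ [i]))) + seg_energy (Suc n) k (u \<circ> Gw S w))"
    using Q0_le_next_level[of "Suc n" "u \<circ> Gw S _" k]
    by (intro sum_mono) (simp add: wmap_append comp_assoc)
  also have "\<dots> = 1 / lam (Suc n) * (\<Sum>w\<in>words_n S (Suc n). Q0 S r0 (u \<circ> Gw S w)) + (\<Sum>w\<in>words_n S n. seg_energy (Suc n) k (u \<circ> Gw S w))"
    by (simp add: sum.distrib sum_words_n_Suc sum_distrib_left)
  finally have "1 / \<delta> * (\<Sum>w\<in>words_n S n. Q0 S r0 (u \<circ> Gw S w)) \<le> 1 / \<delta> * \<dots>"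
    using \<delta> by (intro mult_left_mono) auto
  moreover have "discrete_energy n k u = 1 / \<delta> * (\<Sum>w\<in>words_n S n. Q0 S r0 (u \<circ> Gw S w)) + ?R"
    by (simp add: discrete_energy_def \<delta>_def)
  moreover have "{1..<Suc n} = {1..n}" by auto
  then have "discrete_energy (Suc n) k u = 1 / (\<delta> * lam (Suc n)) * (\<Sum>w\<in>words_n S (Suc n). Q0 S r0 (u \<circ> Gw S w))
      + (?R + 1 / \<delta> * (\<Sum>w\<in>words_n S n. seg_energy (Suc n) k (u \<circ> Gw S w)))"
    by (simp add: discrete_energy_def \<delta>_def)
  ultimately show ?thesis by (simp add: distrib_left)
qed

lemma discrete_energy_mono:
  assumes "n \<le> m" "k \<le> l" shows "discrete_energy n k u \<le> discrete_energy m l u"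
proof -
  have "discrete_energy n k u \<le> discrete_energy m k u"
    using lift_Suc_mono_le[of "\<lambda>n. discrete_energy n k u", OF discrete_energy_mono_Suc assms(1)] .
  also have "\<dots> \<le> discrete_energy m l u" by (rule discrete_energy_mono_k[OF assms(2)])
  finally show ?thesis .
qed

lemma discrete_energy_ge_Q0:
  assumes "w \<in> words S" shows "Q0 S r0 (u \<circ> Gw S w) \<le> (\<Prod>i=1..length w. lam i) * discrete_energy (length w) k u"
proof -
  let ?\<delta> = "\<Prod>i=1..length w. lam i"
  have wn: "w \<in> words_n S (length w)" using assms by (simp add: words_n_def)
  have \<delta>: "?\<delta> > 0" by (rule prod_lam_pos) simp
  have "Q0 S r0 (u \<circ> Gw S w) \<le> (\<Sum>w\<in>words_n S (length w). Q0 S r0 (u \<circ> Gw S w))"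
    using assms by (intro member_le_sum[of w _ "\<lambda>w. Q0 S r0 (u \<circ> Gw S w)"]) (simp_all add: wn Q0_nonneg)
  moreover have "1 / ?\<delta> * (\<Sum>w\<in>words_n S (length w). Q0 S r0 (u \<circ> Gw S w)) \<le> discrete_energy (length w) k u"
    unfolding discrete_energy_def using seg_energy_nonneg
    by (auto intro!: sum_nonneg divide_nonneg_nonneg mult_nonneg_nonneg prod_nonneg less_imp_le[OF lam_pos])
  ultimately show ?thesis using \<delta> by (simp add: field_simps)
qed

text \<open>The segments attached to words of length n form the summand j = n + 1; hence the
  resistance has index \<open>Suc (length w)\<close> while the product stops at n. The other
  summands are nonnegative.\<close>

lemma discrete_energy_ge_dyadic:
  assumes w: "w \<in> words S" and c: "c \<in> crit S" "l \<in> {1..ncells S c}"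
  shows "dyadic_energy k (u \<circ> Gw S w \<circ> \<xi> c (endp S c l))
    \<le> rho (Suc (length w)) c l * (\<Prod>i=1..length w. lam i) * discrete_energy (Suc (length w)) k u"
proof -
  let ?n = "length w" and ?\<delta> = "\<Prod>i=1..length w. lam i"
  have wn: "w \<in> words_n S ?n" using w by (simp add: words_n_def)
  let ?d = "\<lambda>h c l. 1 / rho (Suc ?n) c l * dyadic_energy k (h \<circ> \<xi> c (endp S c l))"
  have \<delta>: "?\<delta> > 0" by (rule prod_lam_pos) simp
  have nn: "0 \<le> ?d h c l" if "c \<in> crit S" "l \<in> {1..ncells S c}" for h c l
    using rho_pos[of "Suc ?n", OF _ that] dyadic_energy_nonneg by simp
  have "?d (u \<circ> Gw S w) c l \<le> (\<Sum>l\<in>{1..ncells S c}. ?d (u \<circ> Gw S w) c l)"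
    using c nn by (intro member_le_sum) auto
  also have "\<dots> \<le> seg_energy (Suc ?n) k (u \<circ> Gw S w)"
    unfolding seg_energy_def
    using c finite_crit nn by (intro member_le_sum[of c "crit S" "\<lambda>c. \<Sum>l\<in>{1..ncells S c}. ?d (u \<circ> Gw S w) c l"] sum_nonneg) auto
  also have "\<dots> \<le> (\<Sum>w\<in>words_n S ?n. seg_energy (Suc ?n) k (u \<circ> Gw S w))"
    using w seg_energy_nonneg by (intro member_le_sum[of w _ "\<lambda>w. seg_energy (Suc ?n) k (u \<circ> Gw S w)"]) (simp_all add: wn)
  finally have 1: "?d (u \<circ> Gw S w) c l \<le> (\<Sum>w\<in>words_n S ?n. seg_energy (Suc ?n) k (u \<circ> Gw S w))" .
  have "{1..<Suc ?n} = {1..?n}" by auto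
  then have "1 / ?\<delta> * (\<Sum>w\<in>words_n S ?n. seg_energy (Suc ?n) k (u \<circ> Gw S w)) =
     1 / (\<Prod>i\<in>{1..<Suc ?n}. lam i) * (\<Sum>w\<in>words_n S (Suc ?n - 1). seg_energy (Suc ?n) k (u \<circ> Gw S w))" by simp
  also have "\<dots> \<le> (\<Sum>j=1..Suc ?n. 1 / (\<Prod>i\<in>{1..<j}. lam i) * (\<Sum>w\<in>words_n S (j - 1). seg_energy j k (u \<circ> Gw S w)))"
    using seg_energy_nonneg
    by (intro member_le_sum[of "Suc ?n" _ "\<lambda>j. 1 / (\<Prod>i\<in>{1..<j}. lam i) * (\<Sum>w\<in>words_n S (j - 1). seg_energy j k (u \<circ> Gw S w))"])
      (auto intro!: sum_nonneg divide_nonneg_nonneg mult_nonneg_nonneg prod_nonneg less_imp_le[OF lam_pos])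
  also have "\<dots> \<le> discrete_energy (Suc ?n) k u"
    unfolding discrete_energy_def using Q0_nonneg
    by (auto simp del: prod.cl_ivl_Suc intro!: sum_nonneg divide_nonneg_nonneg mult_nonneg_nonneg prod_nonneg less_imp_le[OF lam_pos])
  finally have 2: "1 / ?\<delta> * (\<Sum>w\<in>words_n S ?n. seg_energy (Suc ?n) k (u \<circ> Gw S w)) \<le> discrete_energy (Suc ?n) k u" .
  have "?d (u \<circ> Gw S w) c l \<le> ?\<delta> * discrete_energy (Suc ?n) k u"
    using 1 2 \<delta> by (simp add: field_simps)
  then show ?thesis using rho_pos[of "Suc ?n", OF _ c] by (simp add: field_simps)
qed

lemma continuous_on_segment:
  assumes "continuous_on (strK S) u" "c \<in> crit S" "l \<in> {1..ncells S c}" "w \<in> words S"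
  shows "continuous_on {0..1} (u \<circ> Gw S w \<circ> \<xi> c (endp S c l))"
  unfolding comp_assoc
  using \<xi>_image_K[OF assms(2-4)] assms
  by (intro continuous_on_compose continuous_on_\<xi> continuous_on_Gw) (auto intro: continuous_on_subset)

definition H1_on_segments :: "('a \<Rightarrow> real) \<Rightarrow> bool" where
  "H1_on_segments u \<longleftrightarrow> (\<forall>c\<in>crit S. \<forall>l\<in>{1..ncells S c}. \<forall>w\<in>words S. u \<circ> Gw S w \<circ> \<xi> c (endp S c l) \<in> H1)"

lemma energy_n_tendsto:
  assumes "continuous_on (strK S) u" "H1_on_segments u"
  shows "(\<lambda>k. discrete_energy n k u) \<longlonglongrightarrow> energy_n S r0 lam rho n u"
  unfolding discrete_energy_def energy_n_def Drho_k_def Drho_def seg_energy_def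
  using assms
  by (intro tendsto_intros dyadic_energy_tendsto continuous_on_segment)
    (auto simp: words_n_def H1_on_segments_def)

lemma discrete_energy_le_energy_n:
  assumes "continuous_on (strK S) u" "H1_on_segments u"
  shows "discrete_energy n k u \<le> energy_n S r0 lam rho n u"
  by (rule incseq_le[OF _ energy_n_tendsto[OF assms]]) (simp add: incseq_def discrete_energy_mono_k)

lemma energy_n_mono:
  assumes "continuous_on (strK S) u" "H1_on_segments u"
  shows "incseq (\<lambda>n. energy_n S r0 lam rho n u)"
  by (rule incseq_SucI, rule LIMSEQ_le[OF energy_n_tendsto[OF assms] energy_n_tendsto[OF assms]])
    (auto intro: discrete_energy_mono_Suc)

text \<open>Monotonicity in both levels turns a bound on the diagonal into one for all pairs of
  levels, and so bounds all dyadic energies on a given segment.\<close>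

lemma H1_on_segments_of_bounded:
  assumes u: "continuous_on (strK S) u" and C: "\<And>n. discrete_energy n n u \<le> C"
  shows "H1_on_segments u"
  unfolding H1_on_segments_def
proof (intro ballI)
  fix c l w assume c: "c \<in> crit S" "l \<in> {1..ncells S c}" and w: "w \<in> words S"
  show "u \<circ> Gw S w \<circ> \<xi> c (endp S c l) \<in> H1"
  proof (rule H1_of_dyadic_energy_bounded(1)[OF continuous_on_segment[OF u c w]])
    fix k
    have "discrete_energy (Suc (length w)) k u \<le> C"
      using discrete_energy_mono[of "Suc (length w)" "max (Suc (length w)) k" k "max (Suc (length w)) k" u]
        C[of "max (Suc (length w)) k"] by simp
    moreover have "0 \<le> rho (Suc (length w)) c l * (\<Prod>i=1..length w. lam i)"
      using rho_pos[OF _ c, of "Suc (length w)"] prod_lam_pos[of "{1..length w}"] by simp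
    ultimately show "dyadic_energy k (u \<circ> Gw S w \<circ> \<xi> c (endp S c l)) \<le> rho (Suc (length w)) c l * (\<Prod>i=1..length w. lam i) * C"
      using discrete_energy_ge_dyadic[OF w c, of k u] mult_left_mono by (meson order_trans)
  qed
qed

lemma energy_n_le:
  assumes u: "continuous_on (strK S) u" and C: "\<And>n. discrete_energy n n u \<le> C"
  shows "energy_n S r0 lam rho n u \<le> C"
proof (rule LIMSEQ_le_const2[OF energy_n_tendsto[OF u H1_on_segments_of_bounded[OF u C]]], intro exI allI impI)
  fix k
  show "discrete_energy n k u \<le> C"
    using discrete_energy_mono[of n "max n k" k "max n k" u] C[of "max n k"] by simp
qed

text \<open>The H^1 conditions and the convergence of the energies merge into one bound on
  difference forms, the shape in which \<open>regular_energy\<close> takes the domain.\<close>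

lemma energy_dom_iff:
  "u \<in> form_domain \<longleftrightarrow> continuous_on (strK S) u \<and> (\<exists>C. \<forall>n. discrete_energy n n u \<le> C)"
proof
  assume "u \<in> form_domain"
  then have u: "continuous_on (strK S) u" "H1_on_segments u" "convergent (\<lambda>n. energy_n S r0 lam rho n u)"
    unfolding energy_dom_def H1_on_segments_def by auto
  then obtain L where L: "(\<lambda>n. energy_n S r0 lam rho n u) \<longlonglongrightarrow> L" unfolding convergent_def by blast
  have "discrete_energy n n u \<le> L" for n
    using discrete_energy_le_energy_n[OF u(1,2), of n n] incseq_le[OF energy_n_mono[OF u(1,2)] L, of n] by linarith
  then show "continuous_on (strK S) u \<and> (\<exists>C. \<forall>n. discrete_energy n n u \<le> C)" using u by blast
next
  assume "continuous_on (strK S) u \<and> (\<exists>C. \<forall>n. discrete_energy n n u \<le> C)"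
  then obtain C where u: "continuous_on (strK S) u" and C: "\<And>n. discrete_energy n n u \<le> C" by blast
  note h = H1_on_segments_of_bounded[OF u C]
  have "convergent (\<lambda>n. energy_n S r0 lam rho n u)"
    using incseq_convergent[OF energy_n_mono[OF u h], of C] energy_n_le[OF u C] unfolding convergent_def by blast
  then show "u \<in> form_domain"
    using u h unfolding energy_dom_def H1_on_segments_def by auto
qed

text \<open>The diagonal lies below \<open>energy_n\<close>, and its own limit is a bound for
  \<open>energy_n\<close>; hence both have the same limit.\<close>

lemma energy_q_tendsto:
  assumes "u \<in> form_domain"
  shows "(\<lambda>n. discrete_energy n n u) \<longlonglongrightarrow> form_energy u"
proof -
  obtain C where u: "continuous_on (strK S) u" and C: "\<And>n. discrete_energy n n u \<le> C"
    using assms energy_dom_iff by blast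
  have inc: "incseq (\<lambda>n. discrete_energy n n u)" by (simp add: incseq_def discrete_energy_mono)
  then obtain L where L: "(\<lambda>n. discrete_energy n n u) \<longlonglongrightarrow> L" "\<And>n. discrete_energy n n u \<le> L"
    using incseq_convergent[OF inc] C by blast
  have "(\<lambda>n. energy_n S r0 lam rho n u) \<longlonglongrightarrow> L"
  proof (rule tendsto_sandwich[OF _ _ L(1) tendsto_const])
    show "\<forall>\<^sub>F n in sequentially. discrete_energy n n u \<le> energy_n S r0 lam rho n u"
      using discrete_energy_le_energy_n[OF u H1_on_segments_of_bounded[OF u C]] by simp
    show "\<forall>\<^sub>F n in sequentially. energy_n S r0 lam rho n u \<le> L"
      using energy_n_le[OF u L(2)] by simp
  qed
  then show ?thesis using L(1) unfolding energy_q_def by (simp add: limI)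
qed

lemma discrete_energy_le_energy_q:
  assumes "u \<in> form_domain" shows "discrete_energy n k u \<le> form_energy u"
proof -
  have "discrete_energy n k u \<le> discrete_energy (max n k) (max n k) u" by (rule discrete_energy_mono) auto
  also have "\<dots> \<le> form_energy u"
    by (rule incseq_le[OF _ energy_q_tendsto[OF assms]]) (simp add: incseq_def discrete_energy_mono)
  finally show ?thesis .
qed

lemma energy_q_nonneg: "u \<in> form_domain \<Longrightarrow> 0 \<le> form_energy u"
  using discrete_energy_le_energy_q[of u 0 0] difference_form_nonneg[OF discrete_energy_form, of 0 0 u] by linarith

end

section \<open>Oscillation and separation\<close>

context harmonic_stretched
begin

lemma regularity_bounds:
  obtains b R where "0 < b" "b < 1" "\<And>i. i \<ge> 1 \<Longrightarrow> lam i \<le> b" "0 \<le> R"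
    "\<And>i c l. i \<ge> 1 \<Longrightarrow> c \<in> crit S \<Longrightarrow> l \<in> {1..ncells S c} \<Longrightarrow> rho i c l \<le> R"
proof -
  obtain b where b: "b < 1" "\<And>i. i \<ge> 1 \<Longrightarrow> lam i \<le> b"
    using regular unfolding regular_harmonic_sequence_def by blast
  obtain R where R: "\<And>i c l. i \<ge> 1 \<Longrightarrow> c \<in> crit S \<Longrightarrow> l \<in> {1..ncells S c} \<Longrightarrow> rho i c l \<le> R"
    using regular unfolding regular_harmonic_sequence_def bdd_above_def by blast
  have "0 < b" using lam_pos[of 1] b(2)[of 1] by simp
  moreover have "rho i c l \<le> \<bar>R\<bar>" if "i \<ge> 1" "c \<in> crit S" "l \<in> {1..ncells S c}" for i c l
    using R[OF that] by linarith
  ultimately show ?thesis using b that[of b "\<bar>R\<bar>"] by simp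
qed

text \<open>For a word w of length n, Q^Sigma of u on each subcell is at most \<delta>_{n+1}
  \<E>(u), and each segment attached to w has Dirichlet integral at most R \<delta>_n \<E>(u).
  Squared differences are thus at most (C + R) b^n \<E>(u) with b a bound for the \<lambda>_i;
  taking roots makes the rate \<open>sqrt b\<close>, and \<open>oscillation_bound\<close> supplies
  the remaining factor.\<close>

lemma oscillation_on_cells:
  obtains P b where "0 \<le> P" "0 < b" "b < 1"
    "\<And>u w x y. u \<in> form_domain \<Longrightarrow> w \<in> words S \<Longrightarrow> x \<in> V1 \<union> segs \<Longrightarrow> y \<in> V1 \<union> segs \<Longrightarrow>
      \<bar>u (Gw S w x) - u (Gw S w y)\<bar> \<le> P * sqrt (form_energy u) * b ^ length w"
proof -
  obtain b R where b: "0 < b" "b < 1" "\<And>i. i \<ge> 1 \<Longrightarrow> lam i \<le> b" and R: "0 \<le> R"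
    "\<And>i c l. i \<ge> 1 \<Longrightarrow> c \<in> crit S \<Longrightarrow> l \<in> {1..ncells S c} \<Longrightarrow> rho i c l \<le> R"
    using regularity_bounds by blast
  obtain C where C: "C \<ge> 0" "\<And>g x y. x \<in> V0 S \<Longrightarrow> y \<in> V0 S \<Longrightarrow> (g x - g y)\<^sup>2 \<le> C * Q0 S r0 g"
    using Q0_controls_oscillation by blast
  obtain A where A: "A \<ge> 0" "\<And>h T x y. small_oscillation h T \<Longrightarrow> x \<in> V1 \<union> segs \<Longrightarrow> y \<in> V1 \<union> segs \<Longrightarrow> \<bar>h x - h y\<bar> \<le> A * T"
    using oscillation_bound by blast
  have \<delta>: "(\<Prod>i=1..n. lam i) \<le> b ^ n" "0 < (\<Prod>i=1..n. lam i)" for n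
  proof -
    have "(\<Prod>i=1..n. lam i) \<le> (\<Prod>i=1..n. b)"
      by (intro prod_mono) (auto intro: less_imp_le[OF lam_pos] b(3))
    then show "(\<Prod>i=1..n. lam i) \<le> b ^ n" by simp
    show "0 < (\<Prod>i=1..n. lam i)" by (rule prod_lam_pos) simp
  qed
  have small: "small_oscillation (u \<circ> Gw S w) (sqrt ((C + R) * b ^ length w * form_energy u))"
    if u: "u \<in> form_domain" and w: "w \<in> words S" for u w
  proof -
    let ?E = "form_energy u" and ?n = "length w"
    have E: "0 \<le> ?E" by (rule energy_q_nonneg[OF u])
    have Q: "(u (Gw S w (G S i x)) - u (Gw S w (G S i y)))\<^sup>2 \<le> (C + R) * b ^ ?n * ?E"
      if i: "i \<in> letters S" and xy: "x \<in> V0 S" "y \<in> V0 S" for i x y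
    proof -
      have wi: "w @ [i] \<in> words S" using w i by simp
      have "Q0 S r0 (u \<circ> Gw S (w @ [i])) \<le> (\<Prod>i=1..length (w @ [i]). lam i) * ?E"
        by (rule order_trans[OF discrete_energy_ge_Q0[OF wi] mult_left_mono[OF discrete_energy_le_energy_q[OF u]]])
          (rule less_imp_le[OF \<delta>(2)])
      also have "\<dots> \<le> b ^ length (w @ [i]) * ?E" by (intro mult_right_mono \<delta>(1) E)
      also have "\<dots> \<le> b ^ ?n * ?E" using b by (intro mult_right_mono power_decreasing E) auto
      finally have "C * Q0 S r0 (u \<circ> Gw S (w @ [i])) \<le> C * (b ^ ?n * ?E)" using C(1) by (rule mult_left_mono)
      also have "\<dots> \<le> (C + R) * (b ^ ?n * ?E)" using R(1) b(1) E by (intro mult_right_mono) auto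
      finally show ?thesis
        using C(2)[OF xy, of "u \<circ> Gw S (w @ [i])"] by (simp add: wmap_append mult.assoc)
    qed
    have D: "(u (Gw S w x) - u (Gw S w (endp S c l)))\<^sup>2 \<le> (C + R) * b ^ ?n * ?E"
      if c: "c \<in> crit S" "l \<in> {1..ncells S c}" and x: "x \<in> seg S c l" for c l x
    proof -
      let ?h = "u \<circ> Gw S w \<circ> \<xi> c (endp S c l)"
      obtain t where t: "t \<in> {0..1}" "x = \<xi> c (endp S c l) t" using x unfolding seg_eq_image by blast
      have "?h \<in> H1" using u c w unfolding energy_dom_def by blast
      have cu: "continuous_on (strK S) u" using u energy_dom_iff by blast
      have "dyadic_energy k ?h \<le> R * b ^ ?n * ?E" for k
      proof -
        have "dyadic_energy k ?h \<le> rho (Suc ?n) c l * (\<Prod>i=1..?n. lam i) * discrete_energy (Suc ?n) k u"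
          by (rule discrete_energy_ge_dyadic[OF w c])
        also have "\<dots> \<le> rho (Suc ?n) c l * (\<Prod>i=1..?n. lam i) * ?E"
          using rho_pos[OF _ c, of "Suc ?n"] \<delta>(2)[of ?n]
          by (intro mult_left_mono discrete_energy_le_energy_q[OF u]) auto
        also have "\<dots> \<le> R * b ^ ?n * ?E"
          using R(2)[OF _ c, of "Suc ?n"] R(1) rho_pos[OF _ c, of "Suc ?n"] less_imp_le[OF \<delta>(2)[of ?n]]
          by (intro mult_right_mono mult_mono \<delta>(1) E) auto
        finally show ?thesis .
      qed
      then have "dir_int ?h \<le> R * b ^ ?n * ?E"
        using H1_of_dyadic_energy_bounded(2)[OF continuous_on_segment[OF cu c w]] by blast
      moreover have "(?h t - ?h 0)\<^sup>2 \<le> dir_int ?h" using t(1) by (intro H1_diff_sq_le[OF \<open>?h \<in> H1\<close>]) auto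
      moreover have "R * b ^ ?n * ?E \<le> (C + R) * b ^ ?n * ?E" using C(1) b(1) E by (intro mult_right_mono) auto
      ultimately show ?thesis using t(2) by simp
    qed
    show ?thesis
      unfolding small_oscillation_def
      using Q D C(1) R(1) b(1) E by (auto intro!: real_le_rsqrt)
  qed
  define P where "P = A * sqrt (C + R)"
  show ?thesis
  proof (rule that[of P "sqrt b"])
    show "0 \<le> P" unfolding P_def using A(1) C(1) R(1) by simp
    show "0 < sqrt b" "sqrt b < 1" using b by auto
    fix u w x y
    assume u: "u \<in> form_domain" and w: "w \<in> words S" and xy: "x \<in> V1 \<union> segs" "y \<in> V1 \<union> segs"
    show "\<bar>u (Gw S w x) - u (Gw S w y)\<bar> \<le> P * sqrt (form_energy u) * sqrt b ^ length w"
      using A(2)[OF small[OF u w] xy] unfolding P_def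
      by (simp add: real_sqrt_mult real_sqrt_power mult_ac)
  qed
qed

text \<open>Fix v0 in V_0. Since v0 and G_i(v0) lie in V_1, the values at G_w(v0) and G_{wi}(v0)
  differ by at most P b^n times the root of the energy, where n is the length of w. Their geometric
  sum, with 1 added in \<open>Z\<close> for the last step to a segment point, gives the bound on
  copies of segments, and density with continuity extends it to K.\<close>

lemma oscillation_on_K:
  "\<exists>C. \<forall>u\<in>form_domain. \<forall>x\<in>strK S. \<forall>y\<in>strK S. (u x - u y)\<^sup>2 \<le> C * form_energy u"
proof -
  obtain P b where P: "0 \<le> P" "0 < b" "b < 1"
    "\<And>u w x y. u \<in> form_domain \<Longrightarrow> w \<in> words S \<Longrightarrow> x \<in> V1 \<union> segs \<Longrightarrow> y \<in> V1 \<union> segs \<Longrightarrow>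
      \<bar>u (Gw S w x) - u (Gw S w y)\<bar> \<le> P * sqrt (form_energy u) * b ^ length w"
    using oscillation_on_cells by blast
  obtain v0 where v0: "v0 \<in> V0 S" using V0_ne by blast
  define Z where "Z = P * (1 / (1 - b) + 1)"
  have Z: "Z \<ge> 0" unfolding Z_def using P(1,3) by simp
  have main: "\<bar>u x - u v0\<bar> \<le> Z * sqrt (form_energy u)" if u: "u \<in> form_domain" and x: "x \<in> strK S" for u x
  proof -
    define s where "s = sqrt (form_energy u)"
    have s: "s \<ge> 0" unfolding s_def using energy_q_nonneg[OF u] by simp
    have chain: "\<bar>u (Gw S w v0) - u v0\<bar> \<le> P * s * (\<Sum>k<length w. b ^ k)" if "w \<in> words S" for w
      using that
    proof (induction w rule: rev_induct)
      case (snoc i w)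
      then have w: "w \<in> words S" "i \<in> letters S" by auto
      have "G S i v0 \<in> V1" using w v0 unfolding V1_def by blast
      moreover have "v0 \<in> V1" using v0 V0_subset_V1 by blast
      ultimately have "\<bar>u (Gw S w (G S i v0)) - u (Gw S w v0)\<bar> \<le> P * s * b ^ length w"
        unfolding s_def using u w by (intro P(4)) auto
      moreover have "\<bar>u (Gw S w v0) - u v0\<bar> \<le> P * s * (\<Sum>k<length w. b ^ k)" using snoc w by simp
      ultimately show ?case by (simp add: wmap_append distrib_left)
    qed simp
    have geo: "(\<Sum>k<n. b ^ k) \<le> 1 / (1 - b)" for n
    proof -
      have "(1 - b) * (\<Sum>k<n. b ^ k) = 1 - b ^ n" by (simp add: one_diff_power_eq)
      also have "\<dots> \<le> 1" using P(2) by simp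
      finally show ?thesis using P(3) by (simp add: pos_le_divide_eq mult.commute)
    qed
    have near: "\<bar>u (Gw S w y) - u v0\<bar> \<le> Z * s" if w: "w \<in> words S" and y: "y \<in> segs" for w y
    proof -
      have "\<bar>u (Gw S w y) - u (Gw S w v0)\<bar> \<le> P * s * b ^ length w"
        unfolding s_def using u w y v0 V0_subset_V1 by (intro P(4)) auto
      also have "\<dots> \<le> P * s * 1" using P(1,2,3) s by (intro mult_left_mono power_le_one) auto
      finally have "\<bar>u (Gw S w y) - u (Gw S w v0)\<bar> \<le> P * s" by simp
      moreover have "\<bar>u (Gw S w v0) - u v0\<bar> \<le> P * s * (1 / (1 - b))"
        by (rule order_trans[OF chain[OF w]]) (use P(1) s in \<open>intro mult_left_mono geo\<close>, auto)
      ultimately have "\<bar>u (Gw S w y) - u v0\<bar> \<le> P * s * (1 / (1 - b)) + P * s" by linarith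
      then show ?thesis unfolding Z_def by (simp add: algebra_simps)
    qed
    have cu: "continuous_on (strK S) u" using u energy_dom_iff by blast
    show ?thesis unfolding s_def[symmetric]
    proof (rule field_le_epsilon)
      fix e :: real assume "e > 0"
      then obtain d where d: "d > 0" "\<And>z. z \<in> strK S \<Longrightarrow> dist z x < d \<Longrightarrow> dist (u z) (u x) < e"
        using cu x unfolding continuous_on_iff by blast
      obtain w y where wy: "w \<in> words S" "y \<in> segs" "dist x (Gw S w y) < d" using segs_dense[OF x d(1)] by blast
      have "Gw S w y \<in> strK S" using wy Gw_in_K segs_subset_K by blast
      then have "dist (u (Gw S w y)) (u x) < e" using d(2) wy(3) by (simp only: dist_commute[of x])
      then show "\<bar>u x - u v0\<bar> \<le> Z * s + e" using near[OF wy(1,2)] unfolding dist_real_def by linarith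
    qed
  qed
  have "(u x - u y)\<^sup>2 \<le> (2 * Z)\<^sup>2 * form_energy u"
    if u: "u \<in> form_domain" and xy: "x \<in> strK S" "y \<in> strK S" for u x y
  proof -
    have "\<bar>u x - u y\<bar> \<le> 2 * Z * sqrt (form_energy u)"
      using main[OF u xy(1)] main[OF u xy(2)] by linarith
    from power_mono[OF this abs_ge_zero, of 2] show ?thesis
      using energy_q_nonneg[OF u] by (simp add: power_mult_distrib)
  qed
  then show ?thesis by blast
qed

section \<open>Separation of points by functions in the domain\<close>

lemma Gw_cell_subset:
  assumes "w \<in> words S" "n \<le> length w"
  shows "Gw S w ` strK S \<subseteq> Gw S (take n w) ` strK S" "take n w \<in> words_n S n"
proof -
  have w: "take n w \<in> words S" "drop n w \<in> words S" using assms(1) append_in_words_iff[of "take n w" "drop n w"] by auto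
  have "Gw S w = Gw S (take n w) \<circ> Gw S (drop n w)" using wmap_append[of "G S" "take n w" "drop n w"] by simp
  then show "Gw S w ` strK S \<subseteq> Gw S (take n w) ` strK S" using Gw_in_K w by auto
  show "take n w \<in> words_n S n" using w assms(2) by (simp add: words_n_def)
qed

text \<open>Constancy on the cells of level n kills the graph terms from level n on and the segment
  terms with j > n, whose words have length at least n. The finitely many remaining segment terms
  are bounded by the Lipschitz constant, uniformly in the dyadic level.\<close>

lemma lipschitz_locally_constant_in_energy_dom:
  assumes L: "\<And>x y. \<bar>u x - u y\<bar> \<le> L * dist x y" and L0: "L \<ge> 0"
    and const: "\<And>w x y. w \<in> words_n S n \<Longrightarrow> x \<in> Gw S w ` strK S \<Longrightarrow> y \<in> Gw S w ` strK S \<Longrightarrow> u x = u y"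
  shows "u \<in> form_domain"
proof -
  have cu: "continuous_on (strK S) u"
    using L L0 by (intro lipschitz_on_continuous_on[of L] lipschitz_onI) (auto simp: dist_real_def)
  obtain z where z: "z \<in> strK S" using K_ne by blast
  have uconst: "u (Gw S w x) = u (Gw S w z)" if "w \<in> words S" "n \<le> length w" "x \<in> strK S" for w x
    using Gw_cell_subset[OF that(1,2)] that(3) z const[of "take n w"] by blast
  have Q: "Q0 S r0 (u \<circ> Gw S w) = 0" if "w \<in> words S" "n \<le> length w" for w
  proof -
    have "Q0 S r0 (u \<circ> Gw S w) = Q0 S r0 (\<lambda>x. u (Gw S w z))"
      using uconst[OF that] V0_subset_K by (intro difference_form_cong[OF Q0_form]) auto
    then show ?thesis by (simp add: difference_form_const[OF Q0_form])
  qed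
  \<comment> \<open>Vanishing beyond n makes the sum of the bounds independent of the level of the
    energy.\<close>
  define B where "B j = (if j \<le> n then 1 / (\<Prod>i\<in>{1..<j}. lam i) * (\<Sum>w\<in>words_n S (j - 1).
      \<Sum>c\<in>crit S. \<Sum>l\<in>{1..ncells S c}. 1 / rho j c l * (L * dist c (endp S c l))\<^sup>2) else 0)" for j
  have seg: "1 / (\<Prod>i\<in>{1..<j}. lam i) * (\<Sum>w\<in>words_n S (j - 1). seg_energy j k (u \<circ> Gw S w)) \<le> B j" if j: "j \<ge> 1" for j k
  proof (cases "j \<le> n")
    case True
    have d: "dyadic_energy k (u \<circ> Gw S w \<circ> \<xi> c (endp S c l)) \<le> (L * dist c (endp S c l))\<^sup>2"
      if w: "w \<in> words S" for w c l
    proof (rule dyadic_energy_lipschitz)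
      fix s t
      have "\<bar>u (Gw S w (\<xi> c (endp S c l) s)) - u (Gw S w (\<xi> c (endp S c l) t))\<bar>
          \<le> L * dist (Gw S w (\<xi> c (endp S c l) s)) (Gw S w (\<xi> c (endp S c l) t))" by (rule L)
      also have "\<dots> \<le> L * dist (\<xi> c (endp S c l) s) (\<xi> c (endp S c l) t)"
        by (intro mult_left_mono Gw_dist_le w L0)
      finally show "\<bar>(u \<circ> Gw S w \<circ> \<xi> c (endp S c l)) s - (u \<circ> Gw S w \<circ> \<xi> c (endp S c l)) t\<bar> \<le> L * dist c (endp S c l) * \<bar>s - t\<bar>"
        by (simp add: dist_\<xi> mult_ac)
    qed
    have "seg_energy j k (u \<circ> Gw S w) \<le> (\<Sum>c\<in>crit S. \<Sum>l\<in>{1..ncells S c}. 1 / rho j c l * (L * dist c (endp S c l))\<^sup>2)"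
      if "w \<in> words_n S (j - 1)" for w
      unfolding seg_energy_def using that j
      by (intro sum_mono mult_left_mono d) (auto simp: words_n_def intro: less_imp_le[OF rho_pos])
    moreover have "0 \<le> 1 / (\<Prod>i\<in>{1..<j}. lam i)"
      using prod_lam_pos[of "{1..<j}"] by simp
    ultimately show ?thesis
      using True unfolding B_def by (simp only: if_True) (intro mult_left_mono sum_mono)
  next
    case False
    have "seg_energy j k (u \<circ> Gw S w) = 0" if w: "w \<in> words_n S (j - 1)" for w
    proof -
      have w': "w \<in> words S" "n \<le> length w" using w False by (auto simp: words_n_def)
      \<comment> \<open>The empty word turns \<open>seg_energy_form\<close> into a statement about
        \<open>seg_energy\<close> itself, which then depends on values in K alone.\<close>
      have "seg_energy j k (u \<circ> Gw S w) = seg_energy j k ((\<lambda>x. u (Gw S w z)) \<circ> Gw S [])"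
        using uconst[OF w'] difference_form_cong[OF seg_energy_form[OF j Nil_in_words], of "u \<circ> Gw S w" "\<lambda>x. u (Gw S w z)" k] by simp
      also have "\<dots> = 0" by (rule difference_form_const[OF seg_energy_form[OF j Nil_in_words]])
      finally show ?thesis .
    qed
    then show ?thesis using False by (simp add: B_def)
  qed
  have "discrete_energy m m u \<le> (\<Sum>j=1..n. B j)" for m
  proof -
    \<comment> \<open>Raising the cell level to at least n makes the graph part vanish.\<close>
    have "discrete_energy m m u \<le> discrete_energy (max m n) m u" by (rule discrete_energy_mono) auto
    also have "\<dots> = (\<Sum>j=1..max m n. 1 / (\<Prod>i\<in>{1..<j}. lam i) * (\<Sum>w\<in>words_n S (j - 1). seg_energy j m (u \<circ> Gw S w)))"
      unfolding discrete_energy_def using Q by (simp add: words_n_def)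
    also have "\<dots> \<le> (\<Sum>j=1..max m n. B j)" by (intro sum_mono seg) auto
    also have "\<dots> = (\<Sum>j=1..n. B j)" by (intro sum.mono_neutral_right) (auto simp: B_def)
    finally show ?thesis .
  qed
  then show ?thesis using cu energy_dom_iff by blast
qed

text \<open>Choose n so large that no cell of level n contains both points. The cells containing x
  and the other cells then give disjoint compact sets \<open>A\<close> and \<open>B\<close>, and a
  truncated multiple of the distance to \<open>A\<close> is 0 on one and 1 on the other. The points
  are inserted explicitly because they may lie outside all cells of level n.\<close>

lemma energy_dom_separates:
  assumes x: "x \<in> strK S" and y: "y \<in> strK S" and "x \<noteq> y"
  shows "\<exists>u\<in>form_domain. u x \<noteq> u y"
proof -
  obtain R where R: "0 \<le> R" "R < 1" "\<And>i x y. i \<in> letters S \<Longrightarrow> dist (G S i x) (G S i y) \<le> R * dist x y"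
    using G_ratio by blast
  obtain D where D: "\<And>a b. a \<in> strK S \<Longrightarrow> b \<in> strK S \<Longrightarrow> dist a b \<le> D"
    using compact_imp_bounded[OF compact_K] by (meson bounded_two_points)
  have "(\<lambda>n. R ^ n * D) \<longlonglongrightarrow> 0 * D" using R by (intro tendsto_intros LIMSEQ_realpow_zero)
  then have "\<forall>\<^sub>F n in sequentially. R ^ n * D < dist x y" using \<open>x \<noteq> y\<close> by (intro order_tendstoD) auto
  then obtain n where n: "R ^ n * D < dist x y" by (auto simp: eventually_sequentially)
  let ?cell = "\<lambda>w. Gw S w ` strK S"
  have apart: "y \<notin> ?cell w" if w: "w \<in> words_n S n" "x \<in> ?cell w" for w
  proof
    assume "y \<in> ?cell w"
    then obtain a b where ab: "a \<in> strK S" "b \<in> strK S" "x = Gw S w a" "y = Gw S w b" using w by blast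
    have "dist x y \<le> R ^ length w * dist a b"
      unfolding ab using w by (intro wmap_dist_le[OF R(3,1)]) (auto simp: words_n_def words_def)
    also have "\<dots> \<le> R ^ n * D" using D[OF ab(1,2)] w R(1) by (auto simp: words_n_def intro!: mult_left_mono)
    finally show False using n by simp
  qed
  define A where "A = insert x (\<Union>w\<in>{w \<in> words_n S n. x \<in> ?cell w}. ?cell w)"
  define B where "B = insert y (\<Union>w\<in>{w \<in> words_n S n. x \<notin> ?cell w}. ?cell w)"
  have cc: "compact (?cell w)" if "w \<in> words_n S n" for w
    using that by (intro compact_continuous_image continuous_on_Gw compact_K) (simp add: words_n_def)
  have "compact A" "compact B" unfolding A_def B_def by (auto intro!: compact_insert compact_UN cc)
  moreover have "A \<inter> B = {}"
  proof -
    have "?cell w \<inter> ?cell v = {}" if "w \<in> words_n S n" "x \<in> ?cell w" "v \<in> words_n S n" "x \<notin> ?cell v" for w v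
      using that by (intro cells_disjoint) (auto simp: words_n_def)
    then show ?thesis unfolding A_def B_def using apart \<open>x \<noteq> y\<close> by auto
  qed
  ultimately obtain d where d: "d > 0" "\<And>a b. a \<in> A \<Longrightarrow> b \<in> B \<Longrightarrow> d \<le> dist a b"
    using separate_compact_closed[of A B] compact_imp_closed by blast
  define u where "u z = min 1 (infdist z A / d)" for z
  have uA: "u z = 0" if "z \<in> A" for z using that by (simp add: u_def)
  have uB: "u z = 1" if "z \<in> B" for z
  proof -
    have "A \<noteq> {}" by (simp add: A_def)
    then have "d \<le> infdist z A"
      using d(2)[OF _ that] by (auto simp: infdist_notempty dist_commute intro!: cINF_greatest)
    then show ?thesis using d(1) by (simp add: u_def)
  qed
  have "u \<in> form_domain"
  proof (rule lipschitz_locally_constant_in_energy_dom[of u "1 / d" n])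
    fix a b
    have "\<bar>infdist a A - infdist b A\<bar> \<le> dist a b"
      using infdist_triangle_abs[of a A b] by simp
    then have "\<bar>infdist a A / d - infdist b A / d\<bar> \<le> dist a b / d"
      using d(1) by (simp add: diff_divide_distrib[symmetric] divide_right_mono)
    then show "\<bar>u a - u b\<bar> \<le> 1 / d * dist a b" unfolding u_def by simp
  next
    fix w a b assume "w \<in> words_n S n" "a \<in> ?cell w" "b \<in> ?cell w"
    then have "a \<in> A \<and> b \<in> A \<or> a \<in> B \<and> b \<in> B" unfolding A_def B_def by blast
    then show "u a = u b" using uA uB by auto
  qed (use d in simp)
  moreover have "u x = 0" "u y = 1" using uA uB by (auto simp: A_def B_def)
  ultimately show ?thesis by (intro bexI[of _ u]) auto
qed

end

section \<open>The measures\<close>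

lemma mixture_facts:
  assumes "sets M = sets N"
  shows "sets (mixture \<eta> M N) = sets M" "space (mixture \<eta> M N) = space M"
    "A \<in> sets M \<Longrightarrow> emeasure (mixture \<eta> M N) A = ennreal \<eta> * emeasure M A + ennreal (1 - \<eta>) * emeasure N A"
proof -
  show "sets (mixture \<eta> M N) = sets M" "space (mixture \<eta> M N) = space M"
    unfolding mixture_def by (simp_all add: sets.sets_measure_of_eq sets.space_measure_of_eq)
  assume A: "A \<in> sets M"
  show "emeasure (mixture \<eta> M N) A = ennreal \<eta> * emeasure M A + ennreal (1 - \<eta>) * emeasure N A"
    unfolding mixture_def
  proof (rule emeasure_measure_of_sigma)
    show "sigma_algebra (space M) (sets M)" by (rule sets.sigma_algebra_axioms)
    show "positive (sets M) (\<lambda>A. ennreal \<eta> * emeasure M A + ennreal (1 - \<eta>) * emeasure N A)"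
      by (simp add: positive_def)
    show "countably_additive (sets M) (\<lambda>A. ennreal \<eta> * emeasure M A + ennreal (1 - \<eta>) * emeasure N A)"
    proof (rule countably_additiveI)
      fix F :: "nat \<Rightarrow> 'a set" assume F: "range F \<subseteq> sets M" "disjoint_family F"
      have "(\<Sum>i. ennreal \<eta> * emeasure M (F i) + ennreal (1 - \<eta>) * emeasure N (F i))
          = (\<Sum>i. ennreal \<eta> * emeasure M (F i)) + (\<Sum>i. ennreal (1 - \<eta>) * emeasure N (F i))"
        by (rule suminf_add[symmetric]) (auto intro: summableI)
      also have "\<dots> = ennreal \<eta> * (\<Sum>i. emeasure M (F i)) + ennreal (1 - \<eta>) * (\<Sum>i. emeasure N (F i))"
        by simp
      also have "\<dots> = ennreal \<eta> * emeasure M (\<Union>i. F i) + ennreal (1 - \<eta>) * emeasure N (\<Union>i. F i)"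
        using F assms by (simp add: suminf_emeasure)
      finally show "(\<Sum>i. ennreal \<eta> * emeasure M (F i) + ennreal (1 - \<eta>) * emeasure N (F i))
        = ennreal \<eta> * emeasure M (\<Union>i. F i) + ennreal (1 - \<eta>) * emeasure N (\<Union>i. F i)" .
    qed
  qed (rule A)
qed

lemma emeasure_length_measure:
  assumes "A \<in> sets borel"
  shows "emeasure (length_measure x y) A = ennreal (dist x y) * emeasure lborel (\<xi> x y -` A \<inter> {0..1})"
proof -
  have m: "\<xi> x y \<in> measurable (restrict_space lborel {0..1}) borel"
    by (intro borel_measurable_unit_lborelI borel_measurable_continuous_onI continuous_on_\<xi>)
  have "\<xi> x y -` A \<inter> {0..1} \<in> sets borel"
    using measurable_sets_borel[OF borel_measurable_continuous_onI[OF continuous_on_\<xi>] assms, of x y] by auto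
  then show ?thesis
    unfolding length_measure_def
    using assms m by (simp add: emeasure_distr space_restrict_space emeasure_restrict_space)
qed

context stretched
begin

text \<open>Near a point where u does not vanish runs a copy of a segment, and on it u is nonzero
  for an interval of parameters. That interval has positive length, and the weight \<beta>^n a_{c,l}
  of the copy, with n the length of its word, is positive.\<close>

lemma segment_measure_full_support:
  assumes seg: "segment_measure S \<beta> a M" and \<beta>: "0 < \<beta>"
    and a: "\<And>c l. c \<in> crit S \<Longrightarrow> l \<in> {1..ncells S c} \<Longrightarrow> 0 < a c l"
    and u: "continuous_on (strK S) u" and ux: "x \<in> strK S" "u x \<noteq> (0::real)"
  shows "emeasure M {z \<in> strK S. u z \<noteq> 0} \<noteq> 0"
proof -
  have "\<bar>u x\<bar> > 0" using ux by simp
  then obtain d where d: "d > 0" "\<And>z. z \<in> strK S \<Longrightarrow> dist z x < d \<Longrightarrow> dist (u z) (u x) < \<bar>u x\<bar>"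
    using u ux(1) unfolding continuous_on_iff by metis
  obtain w y where wy: "w \<in> words S" "y \<in> segs" "dist x (Gw S w y) < d" using segs_dense[OF ux(1) d(1)] by blast
  obtain c l where c: "c \<in> crit S" "l \<in> {1..ncells S c}" "y \<in> seg S c l" using wy(2) unfolding segs_def by blast
  obtain t where t: "t \<in> {0..1}" "y = \<xi> c (endp S c l) t" using c(3) unfolding seg_eq_image by blast
  let ?p = "Gw S w c" and ?q = "Gw S w (endp S c l)"
  let ?seg = "Gw S w ` seg S c l"
  have aff: "Gw S w (\<xi> c (endp S c l) s) = \<xi> ?p ?q s" for s by (rule Gw_affine[OF wy(1)])
  have seg_eq: "?seg = \<xi> ?p ?q ` {0..1}" unfolding seg_eq_image image_image aff ..
  have segK: "?seg \<subseteq> strK S" using Gw_in_K[OF wy(1)] seg_subset_K[OF c(1,2)] by blast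
  have "Gw S w y \<in> ?seg" using c(3) by blast
  then have "dist (u (Gw S w y)) (u x) < \<bar>u x\<bar>" using d(2) subsetD[OF segK] wy(3) by (simp only: dist_commute[of x])
  then have uy: "u (\<xi> ?p ?q t) \<noteq> 0" unfolding t(2) aff dist_real_def by linarith
  define h where "h s = u (\<xi> ?p ?q s)" for s
  have ch: "continuous_on {0..1} h"
    unfolding h_def using seg_eq segK
    by (intro continuous_on_compose2[OF u continuous_on_\<xi>]) auto
  define A where "A = {z \<in> ?seg. u z \<noteq> 0}"
  have comp: "compact ?seg" unfolding seg_eq by (intro compact_continuous_image continuous_on_\<xi>) simp
  have Ab: "A \<in> sets borel"
  proof -
    have "openin (top_of_set ?seg) (?seg \<inter> u -` (- {0}))"
      by (rule continuous_openin_preimage_gen[OF continuous_on_subset[OF u segK]]) auto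
    then obtain T where "open T" "?seg \<inter> u -` (- {0}) = ?seg \<inter> T" unfolding openin_open by blast
    then have "A = ?seg \<inter> T" unfolding A_def by auto
    then show ?thesis using \<open>open T\<close> comp by (auto intro: borel_compact)
  qed
  have pq: "dist ?p ?q > 0" using inj_Gw[OF wy(1)] endp_ne[OF c(1,2)] by (auto simp: inj_eq)
  have "emeasure lborel (\<xi> ?p ?q -` A \<inter> {0..1}) \<noteq> 0"
  proof -
    obtain e where e: "e > 0" "\<And>s. s \<in> {0..1} \<Longrightarrow> dist s t < e \<Longrightarrow> dist (h s) (h t) < \<bar>h t\<bar>"
      using ch t(1) uy unfolding continuous_on_iff h_def by (metis zero_less_abs_iff)
    have hs: "s \<in> \<xi> ?p ?q -` A \<inter> {0..1}" if "s \<in> {0..1}" "dist s t < e" for s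
    proof -
      have "h s \<noteq> 0" using e(2)[OF that] unfolding dist_real_def by linarith
      then show ?thesis using that(1) unfolding A_def seg_eq h_def by auto
    qed
    \<comment> \<open>The interval is clipped to [0,1], as t may be an end point; it remains
      nondegenerate.\<close>
    define lo hi where "lo = max 0 (t - e / 2)" and "hi = min 1 (t + e / 2)"
    have "lo < hi" using t(1) e(1) by (auto simp: lo_def hi_def)
    have "{lo..hi} \<subseteq> \<xi> ?p ?q -` A \<inter> {0..1}"
    proof
      fix s assume "s \<in> {lo..hi}"
      then have "s \<in> {0..1}" "dist s t < e" using e(1) by (auto simp: lo_def hi_def dist_real_def)
      then show "s \<in> \<xi> ?p ?q -` A \<inter> {0..1}" by (rule hs)
    qed
    moreover have "\<xi> ?p ?q -` A \<inter> {0..1} \<in> sets lborel"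
      using measurable_sets_borel[OF borel_measurable_continuous_onI[OF continuous_on_\<xi>] Ab, of ?p ?q] by auto
    ultimately have "emeasure lborel {lo..hi} \<le> emeasure lborel (\<xi> ?p ?q -` A \<inter> {0..1})"
      by (rule emeasure_mono)
    then show ?thesis using \<open>lo < hi\<close> by auto
  qed
  then have LA: "emeasure (length_measure ?p ?q) A \<noteq> 0"
    unfolding emeasure_length_measure[OF Ab] using pq by simp
  \<comment> \<open>Division by \<open>top\<close> in \<open>ennreal\<close> gives 0, so the length
    of the segment must be known to be finite.\<close>
  have "emeasure (length_measure ?p ?q) ?seg \<noteq> top"
  proof -
    have "emeasure lborel (\<xi> ?p ?q -` ?seg \<inter> {0..1}) \<le> emeasure lborel {0..1::real}" by (rule emeasure_mono) auto
    then have "emeasure lborel (\<xi> ?p ?q -` ?seg \<inter> {0..1}) \<noteq> top" by (auto simp: top_unique)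
    then show ?thesis
      using comp by (subst emeasure_length_measure) (auto simp: ennreal_mult_eq_top_iff borel_compact)
  qed
  moreover have "emeasure M A = ennreal (\<beta> ^ length w * a c l) *
      (emeasure (length_measure ?p ?q) A / emeasure (length_measure ?p ?q) ?seg)"
    using seg wy(1) c(1,2) Ab unfolding segment_measure_def Let_def by (auto simp: A_def)
  moreover have "ennreal (\<beta> ^ length w * a c l) \<noteq> 0" using \<beta> a[OF c(1,2)] by (simp add: ennreal_eq_0_iff not_le)
  ultimately have MA: "emeasure M A \<noteq> 0" using LA by (simp only: mult_eq_0_iff ennreal_divide_eq_0_iff) simp
  have sets: "sets M = sets (restrict_space borel (strK S))" using seg unfolding segment_measure_def by blast
  have "{z \<in> strK S. u z \<noteq> 0} \<in> sets M"
  proof -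
    have "u \<in> borel_measurable (restrict_space borel (strK S))" by (rule borel_measurable_continuous_on_restrict[OF u])
    then have "{z \<in> space (restrict_space borel (strK S)). u z \<noteq> 0} \<in> sets (restrict_space borel (strK S))" by measurable
    then show ?thesis unfolding sets by (simp add: space_restrict_space)
  qed
  then have "emeasure M A \<le> emeasure M {z \<in> strK S. u z \<noteq> 0}"
    using segK by (intro emeasure_mono) (auto simp: A_def)
  then show ?thesis using MA by auto
qed

end

theorem lemma5p1:
  fixes S :: "'a::euclidean_space stretched"
    and r0 :: "'a set \<Rightarrow> ereal"
    and lam :: "nat \<Rightarrow> real"
    and rho :: "nat \<Rightarrow> 'a \<Rightarrow> nat \<Rightarrow> real"
    and \<mu>\<^sub>\<Sigma> \<mu>\<^sub>I :: "'a measure"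
    and \<beta> \<eta> :: real
    and a :: "'a \<Rightarrow> nat \<Rightarrow> real"
  assumes "stretched_fractal S"
    and "regular_harmonic_sequence S r0 lam rho"
    and "self_similar_measure S \<mu>\<^sub>\<Sigma>"
    and "0 < \<beta>" and "\<beta> < 1 / real (num S)"
    and "\<And>c l. c \<in> crit S \<Longrightarrow> l \<in> {1..ncells S c} \<Longrightarrow> 0 < a c l"
    and "(\<Sum>c\<in>crit S. \<Sum>l\<in>{1..ncells S c}. a c l) = 1 - \<beta> * real (num S)"
    and "segment_measure S \<beta> a \<mu>\<^sub>I"
    and "0 < \<eta>" and "\<eta> \<le> 1"
  shows "regular_dirichlet_form (strK S) (mixture \<eta> \<mu>\<^sub>I \<mu>\<^sub>\<Sigma>)
           (energy S r0 lam rho) (energy_dom S r0 lam rho)"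
proof -
  interpret harmonic_stretched S r0 lam rho
    by unfold_locales (rule assms)+
  let ?M = "mixture \<eta> \<mu>\<^sub>I \<mu>\<^sub>\<Sigma>"
  have sI: "sets \<mu>\<^sub>I = sets (restrict_space borel (strK S))" and tI: "emeasure \<mu>\<^sub>I (space \<mu>\<^sub>I) = 1"
    using assms(8) unfolding segment_measure_def by blast+
  have sS: "sets \<mu>\<^sub>\<Sigma> = sets (restrict_space borel (strK S))" and tS: "emeasure \<mu>\<^sub>\<Sigma> (space \<mu>\<^sub>\<Sigma>) = 1"
    using assms(3) unfolding self_similar_measure_def by blast+
  have s: "sets \<mu>\<^sub>I = sets \<mu>\<^sub>\<Sigma>" using sI sS by simp
  note mix = mixture_facts[OF s, where \<eta>=\<eta>]
  have spI: "space \<mu>\<^sub>I = strK S" and sp: "space \<mu>\<^sub>\<Sigma> = space \<mu>\<^sub>I"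
    using sets_eq_imp_space_eq[OF sI] sets_eq_imp_space_eq[OF s] by (simp_all add: space_restrict_space)
  interpret regular_energy "strK S" "\<lambda>n. discrete_energy n n" ?M "energy S r0 lam rho" "energy_dom S r0 lam rho"
    "energy_q S r0 lam rho"
  proof (rule regular_energy.intro)
    show "prob_space ?M"
    proof (rule prob_spaceI)
      have "emeasure ?M (space ?M) = ennreal \<eta> + ennreal (1 - \<eta>)"
        unfolding mix(2) using mix(3)[OF sets.top] tI tS sp by simp
      \<comment> \<open>\<open>ennreal\<close> truncates negative numbers to 0; the weights add up
        to 1 because \<eta> \<le> 1.\<close>
      also have "\<dots> = 1" using assms(9,10) by (simp flip: ennreal_plus)
      finally show "emeasure ?M (space ?M) = 1" .
    qed
    show "sets ?M = sets (restrict_space borel (strK S))" unfolding mix(1) by (rule sI)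
    show "discrete_energy n n u \<le> discrete_energy (Suc n) (Suc n) u" for n u
      by (rule discrete_energy_mono) auto
    show "energy S r0 lam rho u v = polar (energy_q S r0 lam rho) u v" for u v
      by (simp add: energy_def polar_def)
    fix u :: "'a \<Rightarrow> real" and x
    assume u: "continuous_on (strK S) u" and ae: "AE x in ?M. u x = 0" and x: "x \<in> strK S"
    show "u x = 0"
    proof (rule ccontr)
      assume "u x \<noteq> 0"
      let ?A = "{z \<in> strK S. u z \<noteq> 0}"
      have "emeasure \<mu>\<^sub>I ?A \<noteq> 0"
        by (rule segment_measure_full_support[OF assms(8,4) _ u x \<open>u x \<noteq> 0\<close>]) (rule assms(6))
      \<comment> \<open>Nonmeasurable sets have \<open>emeasure\<close> 0 by convention, so a
        nonzero value entails measurability.\<close>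
      then have A: "?A \<in> sets \<mu>\<^sub>I" using emeasure_notin_sets by blast
      have "emeasure ?M ?A = 0"
      proof -
        have "?A = {z \<in> space ?M. \<not> u z = 0}" unfolding mix(2) spI by simp
        then show ?thesis using ae A mix(1) by (subst (asm) AE_iff_measurable[OF _ refl]) auto
      qed
      \<comment> \<open>As \<eta> > 0, a null set of the mixture is a null set of the segment
        measure.\<close>
      then show False using mix(3)[OF A] \<open>emeasure \<mu>\<^sub>I ?A \<noteq> 0\<close> assms(9) by simp
    qed
  qed (rule compact_K discrete_energy_form energy_dom_iff energy_q_tendsto oscillation_on_K energy_dom_separates; assumption?)+
  show ?thesis by (rule regular_dirichlet_form)
qed

end
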